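(* Suppose $\Sigma$ is of type-H, and let $g$ be an exchangeable probability distribution on $\mathcal T$. Let $\lambda,\lambda_1,\lambda_2\in\mathbb R$ (with $1+2\lambda\ne0$ and $1+\lambda_1+\lambda_2\ne0$ whenever the total effect $\theta$ is concerned). Then a pseudo symmetric measure is $\mathcal E_g$-optimal for $\tau$ (respectively $\theta$) in the undirectional model with parameter $\lambda$ if and only if it is $\mathcal E_g$-optimal for $\tau$ (respectively $\theta$) in the directional model with parameters $\lambda_1,\lambda_2$. Furthermore, if $\lambda_1=\lambda_2=\lambda$, the same equivalence holds for $\mathcal A_g$-, $\mathcal D_g$- and $\mathcal T_g$-optimality.
   Context: Fix integers $k\ge 2$ and $t\ge 2$. Let $\mathcal S$ be the set of all $t^k$ sequences $s=(t_1,\dots,t_k)$ with entries $t_j\in\{1,\dots,t\}$. For $s\in\mathcal S$ let $T_s$ be the $k\times t$ matrix with $(j,i)$ entry equal to $1$ if $t_j=i$ and $0$ otherwise; let $H$ be the $k\times k$ matrix with $(i,j)$ entry $1$ if $i\equiv j+1\pmod k$ and $0$ otherwise; put $L_s=HT_s$, $R_s=H'T_s$ (a prime denotes transpose). Let $\Sigma$ be a fixed $k\times k$ positive definite matrix, $1_k$ the all-ones vector, and $\tilde B=\Sigma^{-1}-\Sigma^{-1}1_k1_k'\Sigma^{-1}/(1_k'\Sigma^{-1}1_k)$. With $G_0=T_s,G_1=L_s,G_2=R_s$ define for $0\le i,j\le 2$ the $t\times t$ matrices $C_{sij}=G_i'\tilde BG_j$. A measure is a vector $\xi=(p_s)_{s\in\mathcal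 S}$ with $p_s\ge0$, $\sum_sp_s=1$; $\mathcal P$ is the set of all measures. Put $C_{\xi ij}=\sum_sp_sC_{sij}$. The measure $\xi$ is pseudo symmetric if each $C_{\xi ij}$ is completely symmetric, i.e. of the form $aI_t+bJ_t$ with $J_t$ the all-ones matrix. $M^+$ denotes the Moore–Penrose inverse. $\Sigma$ is of type-H if $\Sigma=I_k+\eta1_k'+1_k\eta'$ for some $\eta\in\mathbb R^k$. For $u,w\in\mathbb R^3$ (coordinates indexed $0,1,2$) let $C_\xi[u,w]=\sum_{i,j=0}^2u_iw_jC_{\xi ij}$. Let $\mathcal T=\{x\in\mathbb R^t:1_t'x=0,\ x\ne0\}$. For $u\in\mathbb R^3$, vectors $w_1,\dots,w_m\in\mathbb R^3$ ($m\in\{1,2\}$) and $x\in\mathcal T$ define $\mathcal I_\xi(u;w_1,\dots,w_m;x)=C_\xi[u,u]-F'G^+F$, where $F$ is the $m\times t$ matrix whose $a$-th row is $(C_\xi[u,w_a]x)'$ and $G$ is the $m\times m$ matrix with entries $x'C_\xi[w_a,w_b]x$. Directional model (parameters $\lambda_1,\lambda_2$): with $\ell=(1,\lambda_1,\lambda_2)'$, $e_1=(0,1,0)'$, $e_2=(0,0,1)'$, $\ell_0=(-1,1+\lambda_2,-\lambda_2)'$, $\ell_1=(-1,-\lambda_1,1+\lambda_1)'$, the information matrices are $C_\xi(\tau)=\mathcal I_\xi(\ell;e_1,e_2;\tau)$ for the direct effect and $C_\xi(\theta)=(1+\lambda_1+\lambda_2)^{-2}\mathcal I_\xi(\ell;\ell_0,\ell_1;\theta)$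 for the total effect. Undirectional model (parameter $\lambda$): with $\ell_\lambda=(1,\lambda,\lambda)'$, $\ell_2=(0,1,1)'$, $\ell_3=(2,-1,-1)'$, the information matrices are $\tilde C_\xi(\tau)=\mathcal I_\xi(\ell_\lambda;\ell_2;\tau)$ and $\tilde C_\xi(\theta)=(1+2\lambda)^{-2}\mathcal I_\xi(\ell_\lambda;\ell_3;\theta)$. A probability distribution $g$ on $\mathcal T$ is exchangeable if the law of $Px$ equals that of $x$ for every $t\times t$ permutation matrix $P$. For a $t\times t$ nonnegative definite matrix $C$ with $C1_t=0$ and eigenvalues $0=a_0\le a_1\le\cdots\le a_{t-1}$ let $\Phi_A(C)=(t-1)(\sum_{i=1}^{t-1}a_i^{-1})^{-1}$ (interpreted as $0$ if $a_1=0$), $\Phi_D(C)=(\prod_{i=1}^{t-1}a_i)^{1/(t-1)}$, $\Phi_E(C)=a_1$, $\Phi_T(C)=(t-1)^{-1}\sum_{i=1}^{t-1}a_i$. In a given model, a measure is $\mathcal A_g$-optimal for $\tau$ (resp. $\theta$) if it maximizes $\xi\mapsto\int\Phi_A(\mathcal C_\xi(x))\,g(dx)$ over $\mathcal P$, where $\mathcal C_\xi$ is that model's information matrix for $\tau$ (resp. $\theta$); $\mathcal D_g$-, $\mathcal E_g$-, $\mathcal T_g$-optimality are defined analogously with $\Phi_D,\Phi_E,\Phi_T$. *)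

theory Defs
  imports "HOL-Probability.Probability" "Jordan_Normal_Form.Matrix" "Jordan_Normal_Form.Char_Poly"
begin

text \<open>Treatments are labelled 0..t-1, periods 0..k-1. A sequence is a list of length k.\<close>

definition seqs :: "nat \<Rightarrow> nat \<Rightarrow> nat list set" where
  "seqs k t = {s. length s = k \<and> set s \<subseteq> {..<t}}"

definition Tmat :: "nat \<Rightarrow> nat \<Rightarrow> nat list \<Rightarrow> real mat" where
  "Tmat k t s = mat k t (\<lambda>(j,i). if s ! j = i then 1 else 0)"

definition Hmat :: "nat \<Rightarrow> real mat" where
  "Hmat k = mat k k (\<lambda>(i,j). if i mod k = (j + 1) mod k then 1 else 0)"

definition Lmat :: "nat \<Rightarrow> nat \<Rightarrow> nat list \<Rightarrow> real mat" where
  "Lmat k t s = Hmat k * Tmat k t s"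

definition Rmat :: "nat \<Rightarrow> nat \<Rightarrow> nat list \<Rightarrow> real mat" where
  "Rmat k t s = transpose_mat (Hmat k) * Tmat k t s"

definition Gmat :: "nat \<Rightarrow> nat \<Rightarrow> nat list \<Rightarrow> nat \<Rightarrow> real mat" where
  "Gmat k t s i = (if i = 0 then Tmat k t s else if i = 1 then Lmat k t s else Rmat k t s)"

definition ones_vec :: "nat \<Rightarrow> real mat" where
  "ones_vec n = mat n 1 (\<lambda>_. 1)"

definition ones_mat :: "nat \<Rightarrow> real mat" where
  "ones_mat n = mat n n (\<lambda>_. 1)"

definition pos_def :: "nat \<Rightarrow> real mat \<Rightarrow> bool" where
  "pos_def k S \<longleftrightarrow> S \<in> carrier_mat k k \<and> transpose_mat S = S \<and>
     (\<forall>v. v \<in> carrier_vec k \<longrightarrow> v \<noteq> 0\<^sub>v k \<longrightarrow>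
        (\<Sum>i<k. \<Sum>j<k. v $ i * S $$ (i,j) * v $ j) > 0)"

definition inv_mat :: "nat \<Rightarrow> real mat \<Rightarrow> real mat" where
  "inv_mat k S = (THE X. X \<in> carrier_mat k k \<and> S * X = 1\<^sub>m k)"

definition typeH :: "nat \<Rightarrow> real mat \<Rightarrow> bool" where
  "typeH k S \<longleftrightarrow> (\<exists>eta. eta \<in> carrier_mat k 1 \<and>
      S = 1\<^sub>m k + eta * transpose_mat (ones_vec k) + ones_vec k * transpose_mat eta)"

definition Btilde :: "nat \<Rightarrow> real mat \<Rightarrow> real mat" where
  "Btilde k S = (let Si = inv_mat k S; one = ones_vec k in
     Si - (1 / ((transpose_mat one * Si * one) $$ (0,0))) \<cdot>\<^sub>m (Si * one * transpose_mat one * Si))"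

definition Cs :: "nat \<Rightarrow> nat \<Rightarrow> real mat \<Rightarrow> nat list \<Rightarrow> nat \<Rightarrow> nat \<Rightarrow> real mat" where
  "Cs k t S s i j = transpose_mat (Gmat k t s i) * Btilde k S * Gmat k t s j"

definition meas_set :: "nat \<Rightarrow> nat \<Rightarrow> (nat list \<Rightarrow> real) set" where
  "meas_set k t = {p. (\<forall>s\<in>seqs k t. p s \<ge> 0) \<and> (\<Sum>s\<in>seqs k t. p s) = 1}"

definition Cxi :: "nat \<Rightarrow> nat \<Rightarrow> real mat \<Rightarrow> (nat list \<Rightarrow> real) \<Rightarrow> nat \<Rightarrow> nat \<Rightarrow> real mat" where
  "Cxi k t S p i j = mat t t (\<lambda>(a,b). \<Sum>s\<in>seqs k t. p s * Cs k t S s i j $$ (a,b))"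

definition completely_symmetric :: "nat \<Rightarrow> real mat \<Rightarrow> bool" where
  "completely_symmetric t C \<longleftrightarrow> (\<exists>a b. C = a \<cdot>\<^sub>m 1\<^sub>m t + b \<cdot>\<^sub>m ones_mat t)"

definition pseudo_symmetric :: "nat \<Rightarrow> nat \<Rightarrow> real mat \<Rightarrow> (nat list \<Rightarrow> real) \<Rightarrow> bool" where
  "pseudo_symmetric k t S p \<longleftrightarrow> (\<forall>i\<le>2. \<forall>j\<le>2. completely_symmetric t (Cxi k t S p i j))"

text \<open>Vectors in R^3 are given as functions on indices 0,1,2.\<close>
definition Cuw :: "nat \<Rightarrow> nat \<Rightarrow> real mat \<Rightarrow> (nat list \<Rightarrow> real) \<Rightarrow> (nat \<Rightarrow> real) \<Rightarrow> (nat \<Rightarrow> real) \<Rightarrow> real mat" where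
  "Cuw k t S p u w = mat t t (\<lambda>(a,b). \<Sum>i\<le>2. \<Sum>j\<le>2. u i * w j * Cxi k t S p i j $$ (a,b))"

definition moore_penrose :: "real mat \<Rightarrow> real mat" where
  "moore_penrose A = (THE X. X \<in> carrier_mat (dim_col A) (dim_row A) \<and>
      A * X * A = A \<and> X * A * X = X \<and>
      transpose_mat (A * X) = A * X \<and> transpose_mat (X * A) = X * A)"

definition col_mat :: "real vec \<Rightarrow> real mat" where
  "col_mat x = mat (dim_vec x) 1 (\<lambda>(i,_). x $ i)"

definition Info :: "nat \<Rightarrow> nat \<Rightarrow> real mat \<Rightarrow> (nat list \<Rightarrow> real) \<Rightarrow> (nat \<Rightarrow> real) \<Rightarrow> (nat \<Rightarrow> real) list \<Rightarrow> real vec \<Rightarrow> real mat" where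
  "Info k t S p u ws x = (let m = length ws;
      F = mat m t (\<lambda>(a,b). (Cuw k t S p u (ws ! a) *\<^sub>v x) $ b);
      G = mat m m (\<lambda>(a,b). (transpose_mat (col_mat x) * Cuw k t S p (ws ! a) (ws ! b) * col_mat x) $$ (0,0))
    in Cuw k t S p u u - transpose_mat F * moore_penrose G * F)"

definition vec3 :: "real \<Rightarrow> real \<Rightarrow> real \<Rightarrow> nat \<Rightarrow> real" where
  "vec3 a b c = (\<lambda>i. if i = 0 then a else if i = 1 then b else c)"

definition C_dir_tau :: "nat \<Rightarrow> nat \<Rightarrow> real mat \<Rightarrow> real \<Rightarrow> real \<Rightarrow> (nat list \<Rightarrow> real) \<Rightarrow> real vec \<Rightarrow> real mat" where
  "C_dir_tau k t S l1 l2 p x = Info k t S p (vec3 1 l1 l2) [vec3 0 1 0, vec3 0 0 1] x"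

definition C_dir_theta :: "nat \<Rightarrow> nat \<Rightarrow> real mat \<Rightarrow> real \<Rightarrow> real \<Rightarrow> (nat list \<Rightarrow> real) \<Rightarrow> real vec \<Rightarrow> real mat" where
  "C_dir_theta k t S l1 l2 p x = (1 / (1 + l1 + l2)\<^sup>2) \<cdot>\<^sub>m
     Info k t S p (vec3 1 l1 l2) [vec3 (-1) (1 + l2) (-l2), vec3 (-1) (-l1) (1 + l1)] x"

definition C_undir_tau :: "nat \<Rightarrow> nat \<Rightarrow> real mat \<Rightarrow> real \<Rightarrow> (nat list \<Rightarrow> real) \<Rightarrow> real vec \<Rightarrow> real mat" where
  "C_undir_tau k t S l p x = Info k t S p (vec3 1 l l) [vec3 0 1 1] x"

definition C_undir_theta :: "nat \<Rightarrow> nat \<Rightarrow> real mat \<Rightarrow> real \<Rightarrow> (nat list \<Rightarrow> real) \<Rightarrow> real vec \<Rightarrow> real mat" where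
  "C_undir_theta k t S l p x = (1 / (1 + 2 * l)\<^sup>2) \<cdot>\<^sub>m Info k t S p (vec3 1 l l) [vec3 2 (-1) (-1)] x"

definition eigs :: "real mat \<Rightarrow> real list" where
  "eigs C = (THE as. sorted as \<and> char_poly C = (\<Prod>a\<leftarrow>as. [:- a, 1:]))"

definition Phi_A :: "nat \<Rightarrow> real mat \<Rightarrow> real" where
  "Phi_A t C = (let a = eigs C in if a ! 1 = 0 then 0
     else real (t - 1) / (\<Sum>i\<in>{1..t-1}. 1 / a ! i))"

definition Phi_D :: "nat \<Rightarrow> real mat \<Rightarrow> real" where
  "Phi_D t C = (let a = eigs C in root (t - 1) (\<Prod>i\<in>{1..t-1}. a ! i))"

definition Phi_E :: "nat \<Rightarrow> real mat \<Rightarrow> real" where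
  "Phi_E t C = eigs C ! 1"

definition Phi_T :: "nat \<Rightarrow> real mat \<Rightarrow> real" where
  "Phi_T t C = (let a = eigs C in (\<Sum>i\<in>{1..t-1}. a ! i) / real (t - 1))"

text \<open>Points of R^t are represented as functions nat => real vanishing from index t on.\<close>
definition Tset :: "nat \<Rightarrow> (nat \<Rightarrow> real) set" where
  "Tset t = {x. (\<forall>i\<ge>t. x i = 0) \<and> (\<Sum>i<t. x i) = 0 \<and> (\<exists>i<t. x i \<noteq> 0)}"

definition exch_distribution :: "nat \<Rightarrow> (nat \<Rightarrow> real) measure \<Rightarrow> bool" where
  "exch_distribution t g \<longleftrightarrow> prob_space g \<and> sets g = sets borel \<and> emeasure g (Tset t) = 1 \<and>
     (\<forall>\<pi>. \<pi> permutes {..<t} \<longrightarrow> distr g g (\<lambda>x i. x (\<pi> i)) = g)"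

definition optimal :: "nat \<Rightarrow> nat \<Rightarrow> (nat \<Rightarrow> real) measure \<Rightarrow> (real mat \<Rightarrow> real)
     \<Rightarrow> ((nat list \<Rightarrow> real) \<Rightarrow> real vec \<Rightarrow> real mat) \<Rightarrow> (nat list \<Rightarrow> real) \<Rightarrow> bool" where
  "optimal k t g Phi Cinf p \<longleftrightarrow> p \<in> meas_set k t \<and>
     (\<forall>q\<in>meas_set k t. (\<integral>x. Phi (Cinf q (vec t x)) \<partial>g) \<le> (\<integral>x. Phi (Cinf p (vec t x)) \<partial>g))"

end

theory Submission
  imports Defs "Jordan_Normal_Form.Spectral_Radius"
begin

text \<open>
For a covariance matrix of type H, the matrix \<open>Btilde\<close> is the centering projection. As the shifts are
cyclic, the quadratic form \<open>w \<mapsto> x' C[w,w] x\<close> is then invariant under exchanging the left and right neighbour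
coordinates of \<open>w\<close>. The information matrix is a Schur complement: its value at \<open>x\<close> is the minimum of this
quadratic form over the affine family spanned by the nuisance weights. By convexity and the invariance, the
directional and the undirectional families have the same minimum.

For a pseudo symmetric measure the eigenvalues of the information matrix are 0, \<open>\<beta>\<close> (once, in the direction of
\<open>x\<close>) and \<open>\<alpha>\<close>, independently of \<open>x\<close>, where \<open>\<beta>\<close> is that minimum and \<open>\<alpha>\<close> depends on the
weights of the effect of interest only. So the smallest eigenvalue agrees in both models, and the whole spectrum
does when these weights coincide. An arbitrary measure is dominated by its average over
all relabellings of the treatments: each criterion lies below a linear function of \<open>x'Cx / |x|\<^sup>2\<close> and of the
trace of \<open>C\<close> that is tight at \<open>(\<beta>, \<alpha>, \<dots>, \<alpha>)\<close>, and exchangeability makes the expectation of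
\<open>x x' / |x|\<^sup>2\<close> a multiple of the centering projection. Hence optimality only has to be tested
against pseudo symmetric measures.
\<close>

section \<open>Symmetric real matrices\<close>

text \<open>The obstacle is that a Schur complement is not linear in the measure, so relabellings
  cannot simply be averaged inside a criterion. Domination by the symmetrized measure rests on two
  choices. One vector \<open>w\<close>, optimal for the symmetrized measure, serves as a competitor
  for the original measure at every \<open>x\<close>; the bound
  \<open>x' C[w,w] x / |x|\<^sup>2\<close> is linear in the measure and its expectation is a trace,
  which relabelling does not change. On the sum-zero vectors orthogonal to \<open>x\<close> the
  information matrix is replaced by \<open>C[u,u]\<close>, which costs nothing for a pseudo
  symmetric measure because both have the eigenvalue \<open>\<alpha>\<close> there. This is why the
  criteria are bounded in terms of just these two numbers. The bound is tight only up to
  \<open>\<epsilon>\<close>, since the geometric mean can have infinite slope at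
  \<open>\<beta> = 0\<close>. Integrability for an arbitrary measure is treated by cases: a
  non-integrable function has integral 0 by convention, and the bound to be reached is
  nonnegative.\<close>

unbundle no vec_syntax and no inner_syntax

text \<open>Existence of a root needs the complex field. A complex eigenvalue \<open>a\<close> with
  eigenvector \<open>v\<close> satisfies \<open>Q = a N\<close>, where \<open>Q\<close> is the
  Hermitian form of \<open>C\<close> at \<open>v\<close> and \<open>N\<close> the squared length.
  Both are real because \<open>C\<close> is real symmetric, so \<open>a\<close> is a real root of
  the characteristic polynomial of \<open>C\<close>.\<close>

lemma symmetric_has_eigenvector:
  fixes C :: "real mat"
  assumes C: "C \<in> carrier_mat n n" and sym: "transpose_mat C = C" and n: "n > 0"
  shows "\<exists>l v. v \<in> carrier_vec n \<and> v \<noteq> 0\<^sub>v n \<and> C *\<^sub>v v = l \<cdot>\<^sub>v v"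
proof -
  define A where "A = map_mat complex_of_real C"
  have A: "A \<in> carrier_mat n n" using C by (simp add: A_def)
  from spectrum_non_empty[OF A n] obtain a where a: "eigenvalue A a"
    unfolding spectrum_def by auto
  then obtain v where v: "v \<in> carrier_vec n" "v \<noteq> 0\<^sub>v n" "A *\<^sub>v v = a \<cdot>\<^sub>v v"
    using A unfolding eigenvalue_def eigenvector_def by auto
  have C_sym: "C $$ (i,j) = C $$ (j,i)" if "i < n" "j < n" for i j
    using arg_cong[OF sym, of "\<lambda>M. M $$ (i,j)"] that C by simp
  have row: "(\<Sum>j<n. of_real (C $$ (i,j)) * v $ j) = a * v $ i" if "i < n" for i
    using arg_cong[OF v(3), of "\<lambda>w. w $ i"] that A v(1) C
    by (simp add: A_def scalar_prod_def row_def lessThan_atLeast0)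
  define N where "N = (\<Sum>i<n. (cmod (v $ i))\<^sup>2)"
  define Q where "Q = (\<Sum>i<n. \<Sum>j<n. cnj (v $ i) * (of_real (C $$ (i,j)) * v $ j))"
  have Q1: "Q = a * of_real N"
  proof -
    have "Q = (\<Sum>i<n. cnj (v $ i) * (a * v $ i))"
      unfolding Q_def by (intro sum.cong refl) (simp add: sum_distrib_left[symmetric] row)
    also have "\<dots> = (\<Sum>i<n. a * of_real ((cmod (v $ i))\<^sup>2))"
      by (intro sum.cong refl) (simp add: complex_norm_square[symmetric] mult_ac)
    finally show ?thesis by (simp add: N_def sum_distrib_left)
  qed
  have "cnj Q = (\<Sum>i<n. \<Sum>j<n. v $ i * (of_real (C $$ (i,j)) * cnj (v $ j)))"
    by (simp add: Q_def)
  also have "\<dots> = (\<Sum>i<n. \<Sum>j<n. v $ j * (of_real (C $$ (j,i)) * cnj (v $ i)))"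
    by (rule sum.swap)
  also have "\<dots> = Q" unfolding Q_def
    by (intro sum.cong refl) (simp add: C_sym mult_ac)
  finally have "cnj Q = Q" .
  moreover have "N > 0"
  proof -
    obtain i where "i < n" "v $ i \<noteq> 0" using v(1,2) by (metis eq_vecI carrier_vecD index_zero_vec)
    then show ?thesis unfolding N_def by (intro sum_pos2[of _ i]) auto
  qed
  ultimately have "cnj a = a" using Q1 by simp
  then have "a \<in> \<real>" by (simp add: Reals_cnj_iff)
  then obtain l where l: "a = of_real l" by (auto elim: Reals_cases)
  have "poly (char_poly A) a = 0" using a eigenvalue_root_char_poly[OF A] by simp
  then have "poly (char_poly C) l = 0"
    unfolding A_def l of_real_hom.char_poly_hom[OF C] by simp
  then have "eigenvalue C l" using eigenvalue_root_char_poly[OF C] by simp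
  then show ?thesis using C unfolding eigenvalue_def eigenvector_def by auto
qed

lemma mult_mat_vec_unit:
  fixes M :: "real mat"
  assumes "M \<in> carrier_mat m n" and "j < n"
  shows "M *\<^sub>v unit_vec n j = col M j"
proof (rule eq_vecI)
  fix i assume "i < dim_vec (col M j)"
  then show "(M *\<^sub>v unit_vec n j) $ i = col M j $ i"
    using assms by (simp add: scalar_prod_def if_distrib cong: if_cong)
qed (use assms in auto)

text \<open>Householder reflection in the hyperplane orthogonal to \<open>u = v - e_0\<close>; it
  exchanges the unit vectors \<open>e_0\<close> and \<open>v\<close>. For \<open>v = e_0\<close> the
  direction \<open>u\<close> vanishes and the identity is used instead.\<close>

lemma reflection_exists:
  fixes v :: "real vec"
  assumes v: "v \<in> carrier_vec n" and unit: "v \<bullet> v = 1" and n: "n > 0"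
  shows "\<exists>W. W \<in> carrier_mat n n \<and> transpose_mat W = W \<and> W * W = 1\<^sub>m n \<and> col W 0 = v"
proof (cases "v = unit_vec n 0")
  case True
  then show ?thesis using n by (intro exI[of _ "1\<^sub>m n"]) auto
next
  case False
  define u where "u i = v $ i - (if i = 0 then 1 else 0)" for i
  define U where "U = (\<Sum>i<n. u i * u i)"
  have vv: "(\<Sum>i<n. v $ i * v $ i) = 1"
    using unit v by (simp add: scalar_prod_def lessThan_atLeast0)
  have "U = (\<Sum>i<n. v $ i * v $ i - 2 * (if i = 0 then v $ i else 0) + (if i = 0 then 1 else 0))"
    unfolding U_def by (intro sum.cong) (auto simp: u_def algebra_simps)
  also have "\<dots> = 2 - 2 * v $ 0"
    using n by (simp add: sum.distrib sum_subtractf vv sum_distrib_left[symmetric] sum.delta)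
  finally have U: "U = 2 - 2 * v $ 0" .
  obtain i where i: "i < n" "u i \<noteq> 0"
  proof -
    have "\<exists>i<n. v $ i \<noteq> unit_vec n 0 $ i"
      using False v by (metis eq_vecI carrier_vecD unit_vec_carrier)
    then show ?thesis using that by (auto simp: u_def)
  qed
  have Upos: "U > 0" unfolding U_def by (intro sum_pos2[of _ i]) (use i in \<open>auto simp: zero_less_mult_iff linorder_neq_iff\<close>)
  define W where "W = mat n n (\<lambda>(i,j). (if i = j then 1 else 0) - 2 / U * (u i * u j))"
  have W: "W \<in> carrier_mat n n" by (simp add: W_def)
  have tW: "transpose_mat W = W" by (rule eq_matI) (auto simp: W_def)
  have WW: "W * W = 1\<^sub>m n"
  proof (rule eq_matI)
    fix i j assume ij: "i < dim_row (1\<^sub>m n)" "j < dim_col (1\<^sub>m n)"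
    have "(W * W) $$ (i,j) = (\<Sum>k<n. ((if i = k then 1 else 0) - 2 / U * (u i * u k))
        * ((if k = j then 1 else 0) - 2 / U * (u k * u j)))"
      using ij by (simp add: W_def scalar_prod_def lessThan_atLeast0)
    also have "\<dots> = (\<Sum>k<n. (if k = i then (if i = j then 1 else 0) else 0)
        - (if k = j then 2 / U * (u i * u j) else 0) - (if k = i then 2 / U * (u i * u j) else 0)
        + 4 / U\<^sup>2 * (u i * u j) * (u k * u k))"
      by (intro sum.cong refl) (auto simp: algebra_simps power2_eq_square)
    also have "\<dots> = (if i = j then 1 else 0) - 4 / U * (u i * u j) + 4 / U\<^sup>2 * (u i * u j) * U"
      using ij unfolding U_def sum_distrib_left
      by (simp add: sum.distrib sum_subtractf sum.delta' sum.delta)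
    also have "\<dots> = (if i = j then 1 else 0)" using Upos by (simp add: power2_eq_square)
    finally show "(W * W) $$ (i,j) = (1\<^sub>m n) $$ (i,j)" using ij by simp
  qed (use W in auto)
  have "col W 0 = v"
  proof (rule eq_vecI)
    fix i assume "i < dim_vec v"
    then have "i < n" using v by simp
    moreover have "u 0 = - U / 2" by (simp add: U u_def)
    ultimately show "col W 0 $ i = v $ i" using n Upos
      by (simp add: W_def u_def)
  qed (use v in \<open>simp add: W_def\<close>)
  with W tW WW show ?thesis by blast
qed

text \<open>The induction step is separated from the induction so that the first eigenvector can be
  prescribed, which is needed later for the constant vector. Conjugation with a reflection that
  carries \<open>e_0\<close> to \<open>v\<close> makes \<open>e_0\<close> an eigenvector; by
  symmetry the first row then vanishes off the diagonal too, and the matrix splits into blocks of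
  size 1 and \<open>n\<close>.\<close>

lemma orthogonal_diagonalization_step:
  fixes C :: "real mat"
  assumes IH: "\<And>C :: real mat. C \<in> carrier_mat n n \<Longrightarrow> transpose_mat C = C \<Longrightarrow>
      \<exists>P d. P \<in> carrier_mat n n \<and> transpose_mat P * P = 1\<^sub>m n \<and> C * P = P * mat_diag n d"
    and C: "C \<in> carrier_mat (Suc n) (Suc n)" and sym: "transpose_mat C = C"
    and v: "v \<in> carrier_vec (Suc n)" "v \<bullet> v = 1" "C *\<^sub>v v = l \<cdot>\<^sub>v v"
  shows "\<exists>P d. P \<in> carrier_mat (Suc n) (Suc n) \<and> transpose_mat P * P = 1\<^sub>m (Suc n)
      \<and> C * P = P * mat_diag (Suc n) d \<and> col P 0 = v \<and> d 0 = l"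
proof -
  let ?N = "Suc n"
  from reflection_exists[OF v(1,2)] obtain W where W: "W \<in> carrier_mat ?N ?N"
    "transpose_mat W = W" "W * W = 1\<^sub>m ?N" "col W 0 = v" by auto
  define M where "M = W * C * W"
  have M: "M \<in> carrier_mat ?N ?N" using W C by (simp add: M_def)
  have M_sym: "transpose_mat M = M"
    using W C sym by (simp add: M_def transpose_mult[of _ ?N ?N _ ?N] assoc_mult_mat[of _ ?N ?N _ ?N _ ?N])
  have We0: "W *\<^sub>v unit_vec ?N 0 = v" using W by (simp add: mult_mat_vec_unit)
  have Wv: "W *\<^sub>v v = unit_vec ?N 0"
    using W We0 by (metis assoc_mult_mat_vec one_mult_mat_vec unit_vec_carrier)
  have "M *\<^sub>v unit_vec ?N 0 = l \<cdot>\<^sub>v unit_vec ?N 0"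
  proof -
    have "M *\<^sub>v unit_vec ?N 0 = W *\<^sub>v (C *\<^sub>v (W *\<^sub>v unit_vec ?N 0))"
      unfolding M_def using W C by (simp add: assoc_mult_mat_vec[of _ ?N ?N _ ?N])
    then show ?thesis using W v Wv We0 by (simp add: mult_mat_vec[of _ ?N ?N])
  qed
  then have colM: "col M 0 = l \<cdot>\<^sub>v unit_vec ?N 0" using M by (simp add: mult_mat_vec_unit)
  have M0: "M $$ (i,0) = (if i = 0 then l else 0)" if "i < ?N" for i
    using arg_cong[OF colM, of "\<lambda>w. w $ i"] that M by auto
  have Msym: "M $$ (i,j) = M $$ (j,i)" if "i < ?N" "j < ?N" for i j
    using arg_cong[OF M_sym, of "\<lambda>A. A $$ (i,j)"] that M by simp
  define C' where "C' = mat n n (\<lambda>(i,j). M $$ (Suc i, Suc j))"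
  have C': "C' \<in> carrier_mat n n" by (simp add: C'_def)
  have "transpose_mat C' = C'" by (rule eq_matI) (auto simp: C'_def Msym)
  from IH[OF C' this] obtain P1 d1 where P1: "P1 \<in> carrier_mat n n"
    "transpose_mat P1 * P1 = 1\<^sub>m n" "C' * P1 = P1 * mat_diag n d1" by blast
  define L where "L = mat 1 1 (\<lambda>_. l)"
  define Q where "Q = four_block_mat (1\<^sub>m 1) (0\<^sub>m 1 n) (0\<^sub>m n 1) P1"
  define d where "d i = (case i of 0 \<Rightarrow> l | Suc j \<Rightarrow> d1 j)" for i
  have Mblock: "M = four_block_mat L (0\<^sub>m 1 n) (0\<^sub>m n 1) C'"
  proof (rule eq_matI)
    fix i j assume "i < dim_row (four_block_mat L (0\<^sub>m 1 n) (0\<^sub>m n 1) C')"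
      "j < dim_col (four_block_mat L (0\<^sub>m 1 n) (0\<^sub>m n 1) C')"
    then have ij: "i < ?N" "j < ?N" by (auto simp: L_def C'_def)
    show "M $$ (i,j) = four_block_mat L (0\<^sub>m 1 n) (0\<^sub>m n 1) C' $$ (i,j)"
      using ij M0[of i] M0[of j] Msym[of i j] by (auto simp: L_def C'_def)
  qed (use M in \<open>auto simp: L_def C'_def\<close>)
  have Dblock: "mat_diag ?N d = four_block_mat L (0\<^sub>m 1 n) (0\<^sub>m n 1) (mat_diag n d1)"
    by (rule eq_matI) (auto simp: L_def mat_diag_def d_def split: nat.splits)
  have L: "L \<in> carrier_mat 1 1" by (simp add: L_def)
  have Dd: "mat_diag n d1 \<in> carrier_mat n n" by (simp add: mat_diag_def)
  have Q: "Q \<in> carrier_mat ?N ?N" unfolding Q_def using P1 four_block_carrier_mat[of "1\<^sub>m 1" 1 1 P1 n n] by simp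
  have MQ: "M * Q = Q * mat_diag ?N d"
  proof -
    have "M * Q = four_block_mat L (0\<^sub>m 1 n) (0\<^sub>m n 1) (C' * P1)"
      unfolding Mblock Q_def using L C' P1
      by (subst mult_four_block_mat[of _ 1 1 _ n _ n _ _ 1 _ n]) auto
    moreover have "Q * mat_diag ?N d = four_block_mat L (0\<^sub>m 1 n) (0\<^sub>m n 1) (P1 * mat_diag n d1)"
      unfolding Dblock Q_def using L C' P1 Dd left_mult_zero_mat[OF Dd, of 1]
      by (subst mult_four_block_mat[of _ 1 1 _ n _ n _ _ 1 _ n]) auto
    ultimately show ?thesis using P1 by simp
  qed
  have QQ: "transpose_mat Q * Q = 1\<^sub>m ?N"
  proof -
    have "transpose_mat Q = four_block_mat (1\<^sub>m 1) (0\<^sub>m 1 n) (0\<^sub>m n 1) (transpose_mat P1)"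
      unfolding Q_def using P1 by (subst transpose_four_block_mat[of _ 1 1 _ n _ n]) auto
    then have "transpose_mat Q * Q = four_block_mat (1\<^sub>m 1) (0\<^sub>m 1 n) (0\<^sub>m n 1) (transpose_mat P1 * P1)"
      unfolding Q_def using P1
      by (simp only:, subst mult_four_block_mat[of _ 1 1 _ n _ n _ _ 1 _ n]) auto
    then show ?thesis using P1 by (simp add: four_block_one_mat)
  qed
  define P where "P = W * Q"
  have P: "P \<in> carrier_mat ?N ?N" using W Q by (simp add: P_def)
  have "transpose_mat P * P = transpose_mat Q * (transpose_mat W * (W * Q))"
    unfolding P_def using W(1) Q by (simp add: transpose_mult[of _ ?N ?N _ ?N] assoc_mult_mat[of _ ?N ?N _ ?N _ ?N])
  also have "transpose_mat W * (W * Q) = (W * W) * Q"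
    using W(1) Q unfolding W(2) by (simp add: assoc_mult_mat[of _ ?N ?N _ ?N _ ?N])
  finally have PP: "transpose_mat P * P = 1\<^sub>m ?N" using W Q QQ by simp
  have "C * P = (W * W) * (C * (W * Q))"
    unfolding P_def W(3) using W(1) Q C by (simp add: left_mult_one_mat[of _ ?N ?N])
  also have "\<dots> = W * (M * Q)"
    unfolding M_def using W(1) Q C by (simp add: assoc_mult_mat[of _ ?N ?N _ ?N _ ?N])
  also have "\<dots> = P * mat_diag ?N d"
    unfolding MQ P_def using W(1) Q by (simp add: assoc_mult_mat[of _ ?N ?N _ ?N _ ?N] mat_diag_def)
  finally have CP: "C * P = P * mat_diag ?N d" .
  have "col Q 0 = unit_vec ?N 0"
    by (rule eq_vecI) (use P1 in \<open>auto simp: Q_def\<close>)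
  moreover have "col P 0 = W *\<^sub>v col Q 0" unfolding P_def by (rule col_mult2[OF W(1) Q]) simp
  ultimately have "col P 0 = v" using We0 by (simp only:)
  with P PP CP show ?thesis by (intro exI[of _ P] exI[of _ d]) (simp add: d_def)
qed

theorem orthogonal_diagonalization:
  fixes C :: "real mat"
  assumes "C \<in> carrier_mat n n" and "transpose_mat C = C"
  shows "\<exists>P d. P \<in> carrier_mat n n \<and> transpose_mat P * P = 1\<^sub>m n \<and> C * P = P * mat_diag n d"
  using assms
proof (induction n arbitrary: C)
  case 0
  then show ?case by (intro exI[of _ "1\<^sub>m 0"] exI[of _ "\<lambda>_. 0"]) (auto intro!: eq_matI simp: mat_diag_def)
next
  case (Suc n)
  from symmetric_has_eigenvector[OF Suc.prems] obtain l w where w: "w \<in> carrier_vec (Suc n)"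
    "w \<noteq> 0\<^sub>v (Suc n)" "C *\<^sub>v w = l \<cdot>\<^sub>v w" by blast
  obtain i where "i < Suc n" "w $ i \<noteq> 0"
    using w(1,2) by (metis eq_vecI carrier_vecD index_zero_vec)
  then have "0 < (\<Sum>i<Suc n. (w $ i)\<^sup>2)" by (intro sum_pos2[of _ i]) auto
  then have ww: "w \<bullet> w > 0"
    using w(1) by (simp add: scalar_prod_def power2_eq_square lessThan_atLeast0)
  define v where "v = (1 / sqrt (w \<bullet> w)) \<cdot>\<^sub>v w"
  have "v \<in> carrier_vec (Suc n)" "v \<bullet> v = 1" "C *\<^sub>v v = l \<cdot>\<^sub>v v"
    using w ww Suc.prems(1) by (auto simp: v_def mult_mat_vec[of _ "Suc n" "Suc n"] smult_smult_assoc mult.commute)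
  from orthogonal_diagonalization_step[OF Suc.IH Suc.prems this] show ?case by blast
qed

text \<open>The characteristic polynomial determines the multiset of its roots, and a sorted list is
  determined by its multiset; hence the description \<open>THE\<close> in \<open>eigs\<close> is
  satisfied by one list only.\<close>

lemma eigs_eqI:
  assumes "sorted xs" and "char_poly C = (\<Prod>a\<leftarrow>xs. [:- a, 1:])"
  shows "eigs C = xs"
  unfolding eigs_def
proof (rule the_equality)
  have proots: "proots (\<Prod>a\<leftarrow>ys. [:- a, 1:]) = mset ys" for ys :: "real list"
  proof (induction ys)
    case (Cons a ys)
    have "(\<Prod>a\<leftarrow>ys. [:- a, 1:]) \<noteq> 0" by (auto simp: prod_list_zero_iff)
    then show ?case
      using Cons.IH proots_mult[of "[:- a, 1:]" "\<Prod>a\<leftarrow>ys. [:- a, 1:]"]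
      by (simp only: list.map prod_list.Cons proots_linear_factor mset.simps) simp
  qed simp
  fix ys :: "real list" assume ys: "sorted ys \<and> char_poly C = (\<Prod>a\<leftarrow>ys. [:- a, 1:])"
  then have "proots (\<Prod>a\<leftarrow>ys. [:- a, 1:]) = proots (\<Prod>a\<leftarrow>xs. [:- a, 1:])" using assms(2) by simp
  then have "mset ys = mset xs" unfolding proots .
  then show "ys = xs" using assms(1) ys properties_for_sort[of ys xs] properties_for_sort[of xs xs] by metis
qed (use assms in auto)

lemma orthogonal_diagonalization_facts:
  fixes C P :: "real mat"
  assumes C: "C \<in> carrier_mat n n" and P: "P \<in> carrier_mat n n"
    and PP: "transpose_mat P * P = 1\<^sub>m n" and CP: "C * P = P * mat_diag n d"
  shows "char_poly C = (\<Prod>a\<leftarrow>map d [0..<n]. [:- a, 1:])"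
    and "C = P * mat_diag n d * transpose_mat P"
    and "i < n \<Longrightarrow> j < n \<Longrightarrow> col P i \<bullet> col P j = (if i = j then 1 else 0)"
    and "i < n \<Longrightarrow> C *\<^sub>v col P i = d i \<cdot>\<^sub>v col P i"
    and "(\<Sum>i<n. C $$ (i,i)) = (\<Sum>i<n. d i)"
    and "y \<in> carrier_vec n \<Longrightarrow> y \<bullet> y = (\<Sum>i<n. (col P i \<bullet> y)\<^sup>2)"
    and "y \<in> carrier_vec n \<Longrightarrow> y \<bullet> (C *\<^sub>v y) = (\<Sum>i<n. d i * (col P i \<bullet> y)\<^sup>2)"
proof -
  let ?D = "mat_diag n d" and ?T = "transpose_mat P"
  have D: "?D \<in> carrier_mat n n" by simp
  have T: "?T \<in> carrier_mat n n" using P by simp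
  have PT: "P * ?T = 1\<^sub>m n" using mat_mult_left_right_inverse[OF T P PP] .
  have "C = C * (P * ?T)" using C PT by simp
  also have "\<dots> = C * P * ?T" using C P T by (simp add: assoc_mult_mat[of _ n n _ n _ n])
  finally show C_eq: "C = P * ?D * ?T" unfolding CP .
  have "similar_mat_wit C ?D P ?T"
    by (rule similar_mat_witI[OF PT PP C_eq C D P T])
  then have "similar_mat C ?D" unfolding similar_mat_def by blast
  then have "char_poly C = char_poly ?D" by (rule char_poly_similar)
  also have "\<dots> = (\<Prod>a\<leftarrow>diag_mat ?D. [:- a, 1:])"
    by (rule char_poly_upper_triangular[OF D]) (auto simp: mat_diag_def)
  also have "diag_mat ?D = map d [0..<n]" by (auto simp: diag_mat_def mat_diag_def)
  finally show "char_poly C = (\<Prod>a\<leftarrow>map d [0..<n]. [:- a, 1:])" .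
  show orth: "col P i \<bullet> col P j = (if i = j then 1 else 0)" if "i < n" "j < n" for i j
    using arg_cong[OF PP, of "\<lambda>M. M $$ (i,j)"] that P by simp
  show "C *\<^sub>v col P i = d i \<cdot>\<^sub>v col P i" if i: "i < n" for i
  proof -
    have "C *\<^sub>v col P i = col (P * ?D) i" using col_mult2[OF C P i] CP by simp
    also have "\<dots> = d i \<cdot>\<^sub>v col P i"
    proof (rule eq_vecI)
      fix j assume j: "j < dim_vec (d i \<cdot>\<^sub>v col P i)"
      show "col (P * ?D) i $ j = (d i \<cdot>\<^sub>v col P i) $ j"
        using j i P by (simp add: mat_diag_def scalar_prod_def if_distrib cong: if_cong)
    qed (use P in auto)
    finally show ?thesis .
  qed
  have entry: "C $$ (i,j) = (\<Sum>k<n. P $$ (i,k) * d k * P $$ (j,k))" if "i < n" "j < n" for i j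
  proof -
    have "(P * ?D) $$ (i,k) = P $$ (i,k) * d k" if "k < n" for k
      using P \<open>i < n\<close> that by (simp add: mat_diag_def scalar_prod_def if_distrib cong: if_cong)
    then show ?thesis
      using that P carrier_matD[OF D] by (subst C_eq) (simp add: scalar_prod_def lessThan_atLeast0 del: mat_diag_mult_right)
  qed
  have "(\<Sum>i<n. C $$ (i,i)) = (\<Sum>k<n. d k * (\<Sum>i<n. P $$ (i,k) * P $$ (i,k)))"
    by (simp add: entry sum_distrib_left mult_ac) (rule sum.swap)
  also have "\<dots> = (\<Sum>k<n. d k)"
    using orth P by (intro sum.cong refl) (auto simp: scalar_prod_def lessThan_atLeast0)
  finally show "(\<Sum>i<n. C $$ (i,i)) = (\<Sum>i<n. d i)" .
  assume y: "y \<in> carrier_vec n"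
  define w where "w = ?T *\<^sub>v y"
  have w: "w \<in> carrier_vec n" unfolding w_def using T y by (rule mult_mat_vec_carrier)
  have wi: "w $ i = col P i \<bullet> y" if "i < n" for i using that P by (simp add: w_def)
  have yw: "y = P *\<^sub>v w" unfolding w_def using y P T PT by (simp add: assoc_mult_mat_vec[of _ n n _ n, symmetric])
  have shift: "y \<bullet> (P *\<^sub>v z) = w \<bullet> z" if z: "z \<in> carrier_vec n" for z
    unfolding w_def using transpose_vec_mult_scalar[OF P z y] y P z
    by (simp add: comm_scalar_prod[of _ n])
  show "y \<bullet> y = (\<Sum>i<n. (col P i \<bullet> y)\<^sup>2)"
    using shift[OF w] w wi by (simp add: yw[symmetric] scalar_prod_def[of w] lessThan_atLeast0 power2_eq_square)
  have PD: "P * ?D \<in> carrier_mat n n" using P D by (rule mult_carrier_mat)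
  have "C *\<^sub>v y = P *\<^sub>v (?D *\<^sub>v w)"
    unfolding w_def assoc_mult_mat_vec[OF P D w[unfolded w_def], symmetric]
    by (subst C_eq) (rule assoc_mult_mat_vec[OF PD T y])
  then have "y \<bullet> (C *\<^sub>v y) = w \<bullet> (?D *\<^sub>v w)" using shift[of "?D *\<^sub>v w"] D w by simp
  also have "?D *\<^sub>v w = vec n (\<lambda>i. d i * w $ i)"
    by (rule eq_vecI)
      (use w in \<open>auto simp: mat_diag_def scalar_prod_def if_distrib[of "\<lambda>x. x * _"] cong: if_cong\<close>)
  also have "w \<bullet> vec n (\<lambda>i. d i * w $ i) = (\<Sum>i<n. d i * (col P i \<bullet> y)\<^sup>2)"
    using wi by (simp add: scalar_prod_def lessThan_atLeast0 power2_eq_square mult_ac)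
  finally show "y \<bullet> (C *\<^sub>v y) = (\<Sum>i<n. d i * (col P i \<bullet> y)\<^sup>2)" .
qed

text \<open>Prescribing the normalized constant vector as first column leaves \<open>n\<close>
  eigenvectors that span the sum-zero vectors. Positive semidefiniteness puts the eigenvalue 0 first
  in the sorted list, so entry \<open>Suc i\<close> of \<open>eigs C\<close> belongs to
  \<open>e i\<close>.\<close>

lemma sum_zero_spectrum:
  fixes C :: "real mat"
  assumes C: "C \<in> carrier_mat (Suc n) (Suc n)" and sym: "transpose_mat C = C"
    and one: "C *\<^sub>v vec (Suc n) (\<lambda>_. 1) = 0\<^sub>v (Suc n)"
    and psd: "\<And>y. y \<in> carrier_vec (Suc n) \<Longrightarrow> y \<bullet> (C *\<^sub>v y) \<ge> 0"
  obtains d e where "eigs C = 0 # map d [0..<n]"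
    and "\<And>i. i < n \<Longrightarrow> 0 \<le> d i" and "\<And>i j. i \<le> j \<Longrightarrow> j < n \<Longrightarrow> d i \<le> d j"
    and "\<And>i. i < n \<Longrightarrow> e i \<in> carrier_vec (Suc n)"
    and "\<And>i. i < n \<Longrightarrow> vec (Suc n) (\<lambda>_. 1) \<bullet> e i = 0"
    and "\<And>i. i < n \<Longrightarrow> C *\<^sub>v e i = d i \<cdot>\<^sub>v e i"
    and "\<And>i j. i < n \<Longrightarrow> j < n \<Longrightarrow> e i \<bullet> e j = (if i = j then 1 else 0)"
    and "(\<Sum>i<Suc n. C $$ (i,i)) = (\<Sum>i<n. d i)"
    and "\<And>y. y \<in> carrier_vec (Suc n) \<Longrightarrow> vec (Suc n) (\<lambda>_. 1) \<bullet> y = 0 \<Longrightarrow> y \<bullet> y = (\<Sum>i<n. (e i \<bullet> y)\<^sup>2)"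
    and "\<And>y. y \<in> carrier_vec (Suc n) \<Longrightarrow> vec (Suc n) (\<lambda>_. 1) \<bullet> y = 0 \<Longrightarrow>
      y \<bullet> (C *\<^sub>v y) = (\<Sum>i<n. d i * (e i \<bullet> y)\<^sup>2)"
proof -
  let ?N = "Suc n" and ?one = "vec (Suc n) (\<lambda>_. 1 :: real)"
  define v where "v = (1 / sqrt ?N) \<cdot>\<^sub>v ?one"
  have v: "v \<in> carrier_vec ?N" "v \<bullet> v = 1" "C *\<^sub>v v = 0 \<cdot>\<^sub>v v"
    using C one by (auto simp: v_def mult_mat_vec[of _ ?N ?N] scalar_prod_def field_simps)
  have "\<exists>P d. P \<in> carrier_mat ?N ?N \<and> transpose_mat P * P = 1\<^sub>m ?N
      \<and> C * P = P * mat_diag ?N d \<and> col P 0 = v \<and> d 0 = 0"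
    by (rule orthogonal_diagonalization_step[OF orthogonal_diagonalization C sym v]) auto
  then obtain P d0 where P: "P \<in> carrier_mat ?N ?N" "transpose_mat P * P = 1\<^sub>m ?N"
    "C * P = P * mat_diag ?N d0" and P0: "col P 0 = v" and d00: "d0 0 = 0" by blast
  note facts = orthogonal_diagonalization_facts[OF C P]
  have one_v: "?one = sqrt ?N \<cdot>\<^sub>v v" by (auto simp: v_def smult_smult_assoc)
  define D where "D i = d0 (Suc i)" for i
  define E where "E i = col P (Suc i)" for i
  have E: "E i \<in> carrier_vec ?N" if "i < n" for i using P(1) that by (simp add: E_def carrier_vecI)
  have D_nonneg: "D i \<ge> 0" if "i < n" for i
  proof -
    have "E i \<bullet> (C *\<^sub>v E i) = D i * (E i \<bullet> E i)"
      using facts(4)[of "Suc i"] that E[OF that] by (simp add: E_def D_def)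
    also have "E i \<bullet> E i = 1" using facts(3)[of "Suc i" "Suc i"] that by (simp add: E_def)
    finally show ?thesis using psd[OF E[OF that]] by simp
  qed
  define xs where "xs = map D [0..<n]"
  \<comment> \<open>\<open>eigs\<close> is sorted while the diagonalization is not: the permutation
    \<open>p\<close> rearranges the eigenvectors together with their eigenvalues.\<close>
  have "mset (sort xs) = mset xs" by simp
  then obtain p where p: "p permutes {..<length xs}" "permute_list p xs = sort xs"
    by (rule mset_eq_permutation)
  have len: "length xs = n" by (simp add: xs_def)
  have p_lt: "p i < n" if "i < n" for i using p(1) that permutes_in_image[OF p(1), of i] len by simp
  define d where "d i = D (p i)" for i
  define e where "e i = E (p i)" for i
  have sort_xs: "sort xs = map d [0..<n]"
    unfolding p(2)[symmetric] permute_list_def len d_def by (auto simp: xs_def p_lt)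
  have re: "(\<Sum>i<n. f (p i)) = (\<Sum>i<n. f i)" for f :: "nat \<Rightarrow> real"
    using sum.permute[OF p(1), of f] len by (simp add: comp_def)
  have split: "(\<Sum>i<?N. f i) = f 0 + (\<Sum>i<n. f (Suc i))" for f :: "nat \<Rightarrow> real"
    by (rule sum.lessThan_Suc_shift)
  have "eigs C = 0 # map d [0..<n]"
  proof (rule eigs_eqI)
    have "set (sort xs) \<subseteq> {0..}" using D_nonneg by (auto simp: xs_def)
    then show "sorted (0 # map d [0..<n])" unfolding sort_xs[symmetric] by auto
    have "map d0 [0..<?N] = 0 # xs" by (simp add: upt_conv_Cons map_Suc_upt[symmetric] xs_def D_def d00 del: upt_Suc)
    then have "char_poly C = (\<Prod>a\<leftarrow>0 # xs. [:- a, 1:])" using facts(1) by simp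
    also have "\<dots> = (\<Prod>a\<leftarrow>0 # sort xs. [:- a, 1:])"
      by (simp flip: prod_mset_prod_list)
    finally show "char_poly C = (\<Prod>a\<leftarrow>0 # map d [0..<n]. [:- a, 1:])" unfolding sort_xs .
  qed
  moreover have "0 \<le> d i" if "i < n" for i using D_nonneg p_lt that by (simp add: d_def)
  moreover have "d i \<le> d j" if "i \<le> j" "j < n" for i j
  proof -
    have "sorted (map d [0..<n])" unfolding sort_xs[symmetric] by simp
    from sorted_nth_mono[OF this that(1)] show ?thesis using that by simp
  qed
  moreover have "e i \<in> carrier_vec ?N" "?one \<bullet> e i = 0" "C *\<^sub>v e i = d i \<cdot>\<^sub>v e i" if "i < n" for i
  proof -
    show "e i \<in> carrier_vec ?N" using E p_lt that by (simp add: e_def)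
    show "C *\<^sub>v e i = d i \<cdot>\<^sub>v e i" using facts(4)[of "Suc (p i)"] p_lt[OF that] by (simp add: e_def d_def E_def D_def)
    have "v \<bullet> e i = 0" using facts(3)[of 0 "Suc (p i)"] p_lt[OF that] by (simp add: e_def E_def P0)
    then show "?one \<bullet> e i = 0" unfolding one_v using v(1) E[OF p_lt[OF that]] by (simp add: e_def)
  qed
  moreover have "e i \<bullet> e j = (if i = j then 1 else 0)" if "i < n" "j < n" for i j
    using facts(3)[of "Suc (p i)" "Suc (p j)"] p_lt that permutes_inj[OF p(1)]
    by (simp add: e_def E_def inj_eq)
  moreover have "(\<Sum>i<Suc n. C $$ (i,i)) = (\<Sum>i<n. d i)"
    unfolding d_def re[of D] facts(5) split[of d0] by (simp add: d00 D_def)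
  moreover have "y \<bullet> y = (\<Sum>i<n. (e i \<bullet> y)\<^sup>2)" "y \<bullet> (C *\<^sub>v y) = (\<Sum>i<n. d i * (e i \<bullet> y)\<^sup>2)"
    if y: "y \<in> carrier_vec ?N" "?one \<bullet> y = 0" for y
  proof -
    have "v \<bullet> y = 0" using y by (simp add: v_def)
    then show "y \<bullet> y = (\<Sum>i<n. (e i \<bullet> y)\<^sup>2)" "y \<bullet> (C *\<^sub>v y) = (\<Sum>i<n. d i * (e i \<bullet> y)\<^sup>2)"
      using facts(6,7)[OF y(1)] re[of "\<lambda>i. (E i \<bullet> y)\<^sup>2"] re[of "\<lambda>i. D i * (E i \<bullet> y)\<^sup>2"]
      by (simp_all add: split P0 d00 e_def d_def E_def D_def del: sum.lessThan_Suc)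
  qed
  ultimately show ?thesis by (rule that)
qed

section \<open>The Moore-Penrose inverse\<close>

text \<open>The condition inside the description \<open>moore_penrose\<close>, named so that
  existence and uniqueness can be stated separately.\<close>

definition penrose_eqs :: "real mat \<Rightarrow> real mat \<Rightarrow> bool" where
  "penrose_eqs A X \<longleftrightarrow> X \<in> carrier_mat (dim_col A) (dim_row A) \<and>
      A * X * A = A \<and> X * A * X = X \<and>
      transpose_mat (A * X) = A * X \<and> transpose_mat (X * A) = X * A"

text \<open>\<open>A X\<close> and \<open>A Y\<close> are symmetric and absorb each other:
  \<open>A X = A Y A X\<close>, and transposing the right side gives \<open>A X A Y = A Y\<close>.
  The same on the other side yields \<open>X A = Y A\<close>, and then
  \<open>X = X A X = Y A Y = Y\<close>.\<close>

lemma penrose_eqs_unique: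
  assumes A: "A \<in> carrier_mat m n" and X: "penrose_eqs A X" and Y: "penrose_eqs A Y"
  shows "X = Y"
proof -
  have c: "X \<in> carrier_mat n m" "Y \<in> carrier_mat n m" using A X Y by (auto simp: penrose_eqs_def)
  note eqX = X[unfolded penrose_eqs_def] and eqY = Y[unfolded penrose_eqs_def]
  have AXAY: "A * X = A * Y"
  proof -
    have "A * X = (A * Y) * (A * X)"
      using eqY A c assoc_mult_mat[of "A * Y" m m A n X m] by simp
    then have "A * X = transpose_mat ((A * Y) * (A * X))" using eqX by simp
    also have "transpose_mat ((A * Y) * (A * X)) = transpose_mat (A * X) * transpose_mat (A * Y)"
      by (rule transpose_mult[of _ m m _ m]) (use A c in auto)
    also have "\<dots> = (A * X) * (A * Y)" using eqX eqY by simp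
    also have "\<dots> = A * Y" using eqX A c assoc_mult_mat[of "A * X" m m A n Y m] by simp
    finally show ?thesis .
  qed
  have XAYA: "X * A = Y * A"
  proof -
    have "X * A = (X * A) * (Y * A)"
      using eqY A c assoc_mult_mat[of "X" n m A n "Y * A" n] assoc_mult_mat[of A m n Y m A n] by simp
    then have "X * A = transpose_mat ((X * A) * (Y * A))" using eqX by simp
    also have "transpose_mat ((X * A) * (Y * A)) = transpose_mat (Y * A) * transpose_mat (X * A)"
      by (rule transpose_mult[of _ n n _ n]) (use A c in auto)
    also have "\<dots> = (Y * A) * (X * A)" using eqX eqY by simp
    also have "\<dots> = Y * A"
      using eqX A c assoc_mult_mat[of "Y" n m A n "X * A" n] assoc_mult_mat[of A m n X m A n] by simp
    finally show ?thesis .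
  qed
  have "X = X * A * X" using eqX by simp
  also have "\<dots> = Y * (A * X)" unfolding XAYA by (rule assoc_mult_mat[of _ n m _ n _ m]) (use A c in auto)
  also have "\<dots> = Y * A * Y" unfolding AXAY by (rule assoc_mult_mat[of _ n m _ n _ m, symmetric]) (use A c in auto)
  also have "\<dots> = Y" using eqY by simp
  finally show ?thesis .
qed

text \<open>A diagonalization reduces the four equations to numbers. The convention
  \<open>inverse 0 = 0\<close> makes \<open>inverse\<close> the pseudoinverse of a number, so no
  case distinction on the rank arises.\<close>

lemma symmetric_penrose_exists:
  fixes G :: "real mat"
  assumes G: "G \<in> carrier_mat m m" and sym: "transpose_mat G = G"
  shows "\<exists>X. penrose_eqs G X"
proof -
  from orthogonal_diagonalization[OF G sym] obtain P d where P: "P \<in> carrier_mat m m"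
    "transpose_mat P * P = 1\<^sub>m m" "G * P = P * mat_diag m d" by blast
  let ?T = "transpose_mat P"
  define D where "D f = P * mat_diag m f * ?T" for f
  have D: "D f \<in> carrier_mat m m" for f
    unfolding D_def using P(1) by (intro mult_carrier_mat[of _ m m]) auto
  have mul: "D f * D h = D (\<lambda>i. f i * h i)" for f h
  proof -
    have T: "?T \<in> carrier_mat m m" using P by simp
    have c: "mat_diag m f \<in> carrier_mat m m" "mat_diag m h \<in> carrier_mat m m" by auto
    have hT: "mat_diag m h * ?T \<in> carrier_mat m m" and Pf: "P * mat_diag m f \<in> carrier_mat m m"
      using P(1) T c by (auto intro!: mult_carrier_mat)
    have "D f * D h = P * mat_diag m f * (?T * (P * mat_diag m h * ?T))"
      unfolding D_def by (rule assoc_mult_mat[of _ m m _ m _ m]) (use P T c D[of h] Pf in \<open>auto simp: D_def\<close>)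
    also have "?T * (P * mat_diag m h * ?T) = (?T * P) * (mat_diag m h * ?T)"
      unfolding assoc_mult_mat[OF P(1) c(2) T] by (rule assoc_mult_mat[OF T P(1) hT, symmetric])
    also have "\<dots> = mat_diag m h * ?T" unfolding P(2) by (rule left_mult_one_mat[OF hT])
    also have "P * mat_diag m f * (mat_diag m h * ?T) = P * (mat_diag m f * mat_diag m h) * ?T"
      unfolding assoc_mult_mat[OF P(1) c(1) c(2), symmetric] by (rule assoc_mult_mat[OF Pf c(2) T, symmetric])
    finally show ?thesis by (simp add: D_def)
  qed
  have tr: "transpose_mat (D f) = D f" for f
  proof -
    have "transpose_mat (mat_diag m f) = mat_diag m f" by (rule eq_matI) (auto simp: mat_diag_def)
    moreover have "P * mat_diag m f \<in> carrier_mat m m" using P(1) by (auto intro!: mult_carrier_mat)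
    ultimately have "transpose_mat (D f) = P * (mat_diag m f * ?T)"
      unfolding D_def using P(1) by (simp add: transpose_mult[of _ m m _ m])
    then show ?thesis unfolding D_def using P(1) by (simp add: assoc_mult_mat[of P m m "mat_diag m f" m ?T m])
  qed
  have GD: "G = D d" unfolding D_def using orthogonal_diagonalization_facts(2)[OF G P] .
  have "(\<lambda>i. d i * inverse (d i) * d i) = d" by (rule ext) (simp add: field_simps)
  moreover have "(\<lambda>i. inverse (d i) * d i * inverse (d i)) = (\<lambda>i. inverse (d i))" by (rule ext) (simp add: field_simps)
  ultimately have "penrose_eqs G (D (\<lambda>i. inverse (d i)))"
    unfolding penrose_eqs_def using D[of d] D[of "\<lambda>i. inverse (d i)"] by (simp add: GD mul tr)
  then show ?thesis by blast
qed

text \<open>Symmetry follows from uniqueness: the transpose solves the Penrose equations of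
  \<open>G\<close> as well.\<close>

lemma moore_penrose_symmetric:
  fixes G :: "real mat"
  assumes G: "G \<in> carrier_mat m m" and sym: "transpose_mat G = G"
  shows "penrose_eqs G (moore_penrose G)" and "transpose_mat (moore_penrose G) = moore_penrose G"
proof -
  obtain X where X: "penrose_eqs G X" using symmetric_penrose_exists[OF G sym] ..
  show mp: "penrose_eqs G (moore_penrose G)"
    unfolding moore_penrose_def penrose_eqs_def[symmetric]
    by (rule theI[where P = "penrose_eqs G", OF X]) (rule penrose_eqs_unique[OF G _ X])
  let ?X = "moore_penrose G"
  have c: "?X \<in> carrier_mat m m" using mp G by (simp add: penrose_eqs_def)
  have t: "transpose_mat (?X * G) = G * transpose_mat ?X" "transpose_mat (G * ?X) = transpose_mat ?X * G"
    using transpose_mult[OF c G] transpose_mult[OF G c] sym by auto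
  note eqs = mp[unfolded penrose_eqs_def]
  have "G * transpose_mat ?X * G = transpose_mat (G * ?X * G)"
    using c G sym by (simp add: transpose_mult[of _ m m _ m] assoc_mult_mat[of _ m m _ m _ m])
  moreover have "transpose_mat ?X * G * transpose_mat ?X = transpose_mat (?X * G * ?X)"
    using c G sym by (simp add: transpose_mult[of _ m m _ m] assoc_mult_mat[of _ m m _ m _ m])
  ultimately have "penrose_eqs G (transpose_mat ?X)"
    unfolding penrose_eqs_def using eqs G c t by (metis carrier_matD transpose_carrier_mat transpose_transpose sym)
  then show "transpose_mat ?X = ?X" by (rule penrose_eqs_unique[OF G _ mp])
qed

lemma mult_mat_vec_swap:
  fixes G :: "real mat"
  assumes "G \<in> carrier_mat m m" and "transpose_mat G = G" and "v \<in> carrier_vec m" and "w \<in> carrier_vec m"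
  shows "v \<bullet> (G *\<^sub>v w) = (G *\<^sub>v v) \<bullet> w"
  using transpose_vec_mult_scalar[OF assms(1,4,3)] assms by simp

text \<open>Boundedness below does the work: it forces \<open>G\<close> to be positive semidefinite
  and \<open>f\<close> to lie in the range of \<open>G\<close>. Then \<open>w = X f\<close>
  satisfies \<open>G w = f\<close>, the square can be completed, and the minimum is attained at
  \<open>- w\<close>.\<close>

lemma quadratic_minimum:
  fixes G :: "real mat" and c :: real
  assumes G: "G \<in> carrier_mat m m" and sym: "transpose_mat G = G" and f: "f \<in> carrier_vec m"
    and nonneg: "\<And>v. v \<in> carrier_vec m \<Longrightarrow> 0 \<le> c + 2 * (v \<bullet> f) + v \<bullet> (G *\<^sub>v v)"
  defines "X \<equiv> moore_penrose G"
  shows "v \<in> carrier_vec m \<Longrightarrow> c - f \<bullet> (X *\<^sub>v f) \<le> c + 2 * (v \<bullet> f) + v \<bullet> (G *\<^sub>v v)"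
    and "\<exists>v\<in>carrier_vec m. c - f \<bullet> (X *\<^sub>v f) = c + 2 * (v \<bullet> f) + v \<bullet> (G *\<^sub>v v)"
proof -
  note mp = moore_penrose_symmetric[OF G sym, folded X_def]
  have X: "X \<in> carrier_mat m m" using mp(1) G by (simp add: penrose_eqs_def)
  note eqs = mp(1)[unfolded penrose_eqs_def]
  have psd: "0 \<le> v \<bullet> (G *\<^sub>v v)" if v: "v \<in> carrier_vec m" for v
  proof (rule ccontr)
    assume neg: "\<not> ?thesis"
    define a b where "a = v \<bullet> (G *\<^sub>v v)" and "b = v \<bullet> f"
    have h: "0 \<le> c + 2 * s * b + s\<^sup>2 * a" for s
      using nonneg[of "s \<cdot>\<^sub>v v"] v f G
      by (simp add: a_def b_def mult_mat_vec[of _ m m] power2_eq_square mult_ac)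
    \<comment> \<open>Adding the bounds for \<open>s\<close> and \<open>- s\<close> cancels the
      linear term; a large \<open>s\<close> then contradicts \<open>a < 0\<close>.\<close>
    have h2: "0 \<le> c + s\<^sup>2 * a" for s using h[of s] h[of "- s"] by simp
    have a: "a < 0" using neg by (simp add: a_def)
    have "c \<ge> 0" using h[of 0] by simp
    then have "(sqrt ((c + 1) / (- a)))\<^sup>2 * a = - (c + 1)" using a by (simp add: field_simps)
    then show False using h2[of "sqrt ((c + 1) / (- a))"] by simp
  qed
  define w where "w = X *\<^sub>v f"
  have w: "w \<in> carrier_vec m" using X f by (simp add: w_def)
  \<comment> \<open>\<open>z\<close> is the component of \<open>f\<close> in the kernel of
    \<open>G\<close>. Along \<open>z\<close> the quadratic is affine, so boundedness below forces
    \<open>z \<bullet> f = 0\<close>; but \<open>z \<bullet> f\<close> is the squared length of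
    \<open>z\<close>.\<close>
  define z where "z = f - G *\<^sub>v w"
  have z: "z \<in> carrier_vec m" using f G w by (simp add: z_def)
  have "G * (G * X) = G"
  proof -
    have "G * X = X * G" using eqs transpose_mult[OF G X] sym mp(2) by simp
    then have "G * (G * X) = G * X * G" using assoc_mult_mat[OF G X G] by simp
    then show ?thesis using eqs by simp
  qed
  then have "G *\<^sub>v (G *\<^sub>v w) = G *\<^sub>v f"
    unfolding w_def using G X f by (metis assoc_mult_mat_vec mult_carrier_mat)
  then have Gz: "G *\<^sub>v z = 0\<^sub>v m"
    unfolding z_def using G w f by (simp add: mult_minus_distrib_mat_vec[of _ m m])
  have "z \<bullet> f = 0"
  proof (rule ccontr)
    assume nz: "z \<bullet> f \<noteq> 0"
    have "0 \<le> c + 2 * (s * (z \<bullet> f))" for s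
      using nonneg[of "s \<cdot>\<^sub>v z"] z f G Gz by (simp add: mult_mat_vec[of _ m m])
    from this[of "- (c + 1) / (2 * (z \<bullet> f))"] this[of 0] nz show False by (simp add: field_simps)
  qed
  moreover have "z \<bullet> z = z \<bullet> f - (G *\<^sub>v z) \<bullet> w"
    using mult_mat_vec_swap[OF G sym z w] z f G w unfolding z_def[unfolded z_def]
    by (metis scalar_prod_minus_distrib mult_mat_vec_carrier z_def)
  ultimately have "z \<bullet> z = 0" using Gz w by simp
  then have "(\<Sum>i<m. (z $ i)\<^sup>2) = 0"
    using z by (simp add: scalar_prod_def lessThan_atLeast0 power2_eq_square)
  then have z0: "z $ i = 0" if "i < m" for i using that by (simp add: sum_nonneg_eq_0_iff)
  have Gw: "G *\<^sub>v w = f"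
  proof (rule eq_vecI)
    fix i assume "i < dim_vec f"
    then show "(G *\<^sub>v w) $ i = f $ i" using z0[of i] G w f by (simp add: z_def)
  qed (use G f in simp)
  have square: "c + 2 * (v \<bullet> f) + v \<bullet> (G *\<^sub>v v) = c - f \<bullet> w + (v + w) \<bullet> (G *\<^sub>v (v + w))"
    if v: "v \<in> carrier_vec m" for v
  proof -
    have "w \<bullet> (G *\<^sub>v v) = f \<bullet> v" using mult_mat_vec_swap[OF G sym w v] Gw by simp
    then show ?thesis using v w f G Gw
      by (simp add: mult_add_distrib_mat_vec[of _ m m] scalar_prod_add_distrib[of _ m] add_scalar_prod_distrib[of _ m]
          comm_scalar_prod[of w m f] comm_scalar_prod[of f m v])
  qed
  show "v \<in> carrier_vec m \<Longrightarrow> c - f \<bullet> (X *\<^sub>v f) \<le> c + 2 * (v \<bullet> f) + v \<bullet> (G *\<^sub>v v)"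
    using square[of v] psd[of "v + w"] w by (simp add: w_def[symmetric])
  have "- w + w = 0\<^sub>v m" using w by (simp add: uminus_l_inv_vec)
  then show "\<exists>v\<in>carrier_vec m. c - f \<bullet> (X *\<^sub>v f) = c + 2 * (v \<bullet> f) + v \<bullet> (G *\<^sub>v v)"
    using square[of "- w"] w G by (intro bexI[of _ "- w"]) (auto simp: w_def[symmetric])
qed

section \<open>Criteria as functions of the eigenvalues\<close>

definition mean_A :: "nat \<Rightarrow> (nat \<Rightarrow> real) \<Rightarrow> real" where
  "mean_A n d = (if d 0 = 0 then 0 else real n / (\<Sum>i<n. 1 / d i))"

definition mean_D :: "nat \<Rightarrow> (nat \<Rightarrow> real) \<Rightarrow> real" where
  "mean_D n d = root n (\<Prod>i<n. d i)"

definition mean_T :: "nat \<Rightarrow> (nat \<Rightarrow> real) \<Rightarrow> real" where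
  "mean_T n d = (\<Sum>i<n. d i) / real n"

text \<open>Eigenvalues, on the sum-zero vectors, of the information matrix of a pseudo symmetric
  measure. As \<open>\<beta> \<le> \<alpha>\<close> there, the exceptional eigenvalue has index 0 in
  the sorted list.\<close>

definition pinched :: "real \<Rightarrow> real \<Rightarrow> nat \<Rightarrow> real" where
  "pinched \<alpha> \<beta> i = (if i = 0 then \<beta> else \<alpha>)"

text \<open>Read \<open>d\<close> as the eigenvalues of a matrix \<open>C\<close> on the hyperplane of sum-zero vectors and \<open>z i\<close> as the squared
  inner product of the \<open>i\<close>-th unit eigenvector with a fixed unit vector \<open>x\<close>. Then \<open>\<Sum>d i * z i\<close> is
  \<open>x'Cx\<close> and \<open>\<Sum>d i * (1 - z i)\<close> is the rest of the trace: up to \<open>\<epsilon>\<close>, the criterion has a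
  supporting functional at \<open>pinched \<alpha> \<beta>\<close> that depends on \<open>C\<close> through these two numbers only.\<close>

definition supported :: "nat \<Rightarrow> ((nat \<Rightarrow> real) \<Rightarrow> real) \<Rightarrow> bool" where
  "supported n f \<longleftrightarrow> (\<forall>\<alpha> \<beta> \<epsilon>. 0 \<le> \<beta> \<longrightarrow> \<beta> \<le> \<alpha> \<longrightarrow> 0 < \<epsilon> \<longrightarrow> (\<exists>u v. 0 \<le> u \<and> 0 \<le> v
    \<and> u * (real (n - 1) * \<alpha>) + v * \<beta> \<le> f (pinched \<alpha> \<beta>) + \<epsilon>
    \<and> (\<forall>d z. (\<forall>i<n. 0 \<le> d i \<and> 0 \<le> z i) \<longrightarrow> (\<forall>i j. i \<le> j \<longrightarrow> j < n \<longrightarrow> d i \<le> d j) \<longrightarrow> (\<Sum>i<n. z i) = 1 \<longrightarrow>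
        f d \<le> u * (\<Sum>i<n. d i * (1 - z i)) + v * (\<Sum>i<n. d i * z i))))"

text \<open>A criterion receives the spectrum as the function
  \<open>\<lambda>i. eigs C ! Suc i\<close>, which is unspecified beyond the length of the list;
  agreement can be proved for the first \<open>n\<close> indices only.\<close>

definition depends_on :: "nat \<Rightarrow> ((nat \<Rightarrow> real) \<Rightarrow> real) \<Rightarrow> bool" where
  "depends_on n f \<longleftrightarrow> (\<forall>d d'. (\<forall>i<n. d i = d' i) \<longrightarrow> f d = f d')"

section \<open>Supporting functionals of the four criteria\<close>

lemma sum_pinched:
  assumes "n > 0"
  shows "(\<Sum>i<n. h (pinched \<alpha> \<beta> i)) = h \<beta> + real (n - 1) * h \<alpha>"
    and "(\<Prod>i<n. pinched \<alpha> \<beta> i) = \<beta> * \<alpha> ^ (n - 1)"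
proof -
  obtain m where "n = Suc m" using assms by (cases n) auto
  then show "(\<Sum>i<n. h (pinched \<alpha> \<beta> i)) = h \<beta> + real (n - 1) * h \<alpha>"
    and "(\<Prod>i<n. pinched \<alpha> \<beta> i) = \<beta> * \<alpha> ^ (n - 1)"
    by (simp_all only: sum.lessThan_Suc_shift prod.lessThan_Suc_shift) (simp_all add: pinched_def)
qed

text \<open>The smallest eigenvalue is at most every weighted mean of the eigenvalues, so
  \<open>x'Cx\<close> alone serves as functional, with \<open>u = 0\<close> and
  \<open>v = 1\<close>.\<close>

lemma supported_E: "n > 0 \<Longrightarrow> supported n (\<lambda>d. d 0)"
  unfolding supported_def
proof (intro allI impI, rule exI[of _ 0], rule exI[of _ 1], intro conjI allI impI)
  fix d z :: "nat \<Rightarrow> real"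
  assume n: "n > 0" and nonneg: "\<forall>i<n. 0 \<le> d i \<and> 0 \<le> z i"
    and mono: "\<forall>i j. i \<le> j \<longrightarrow> j < n \<longrightarrow> d i \<le> d j" and z: "(\<Sum>i<n. z i) = 1"
  have "d 0 = (\<Sum>i<n. d 0 * z i)" using z by (simp add: sum_distrib_left[symmetric])
  also have "\<dots> \<le> (\<Sum>i<n. d i * z i)" using nonneg mono by (intro sum_mono mult_right_mono) auto
  finally show "d 0 \<le> 0 * (\<Sum>i<n. d i * (1 - z i)) + 1 * (\<Sum>i<n. d i * z i)" by simp
qed (auto simp: pinched_def)

lemma supported_T:
  assumes n: "n > 0"
  shows "supported n (mean_T n)"
  unfolding supported_def
proof (intro allI impI, rule exI[of _ "1 / n"], rule exI[of _ "1 / n"], intro conjI allI impI)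
  fix \<alpha> \<beta> \<epsilon> :: real
  assume "0 < \<epsilon>"
  then show "1 / n * (real (n - 1) * \<alpha>) + 1 / n * \<beta> \<le> mean_T n (pinched \<alpha> \<beta>) + \<epsilon>"
    using n sum_pinched(1)[OF n, of "\<lambda>x. x"] by (simp add: mean_T_def add_divide_distrib)
next
  fix d z :: "nat \<Rightarrow> real"
  show "mean_T n d \<le> 1 / n * (\<Sum>i<n. d i * (1 - z i)) + 1 / n * (\<Sum>i<n. d i * z i)"
    by (simp add: mean_T_def right_diff_distrib sum_subtractf diff_divide_distrib)
qed auto

lemma pos_of_sorted:
  fixes d :: "nat \<Rightarrow> real"
  assumes "\<forall>i<n. 0 \<le> d i" and "\<forall>i j. i \<le> j \<longrightarrow> j < n \<longrightarrow> d i \<le> d j" and "n > 0" and "d 0 \<noteq> 0"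
  shows "i < n \<Longrightarrow> 0 < d i"
  using assms by (metis le0 less_eq_real_def order_less_le_trans)

text \<open>\<open>n / (a h)^2\<close> and \<open>n / (b h)^2\<close> are the partial derivatives of
  the harmonic mean at \<open>pinched a b\<close>. The bound is Cauchy-Schwarz applied to
  \<open>\<Sum> c i = h\<close>, where \<open>c i\<close> averages \<open>1 / a\<close> and
  \<open>1 / b\<close> with weights \<open>1 - z i\<close> and \<open>z i\<close>, followed by
  convexity of the square.\<close>

lemma mean_A_bound:
  fixes d z :: "nat \<Rightarrow> real"
  assumes n: "n > 0" and d: "\<forall>i<n. 0 \<le> d i \<and> 0 \<le> z i" and mono: "\<forall>i j. i \<le> j \<longrightarrow> j < n \<longrightarrow> d i \<le> d j"
    and z: "(\<Sum>i<n. z i) = 1" and pos: "a > 0" "b > 0"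
  defines "h \<equiv> real (n - 1) / a + 1 / b"
  shows "mean_A n d \<le> n / (a * h)\<^sup>2 * (\<Sum>i<n. d i * (1 - z i)) + n / (b * h)\<^sup>2 * (\<Sum>i<n. d i * z i)"
proof -
  have z1: "z i \<le> 1" if "i < n" for i
    using member_le_sum[of i "{..<n}" z] d z that by auto
  have h: "h > 0" using pos by (simp add: h_def add_nonneg_pos)
  have nn: "0 \<le> (\<Sum>i<n. d i * (1 - z i))" "0 \<le> (\<Sum>i<n. d i * z i)"
    using d z1 by (auto intro!: sum_nonneg)
  show ?thesis
  proof (cases "d 0 = 0")
    case True
    then show ?thesis using nn by (simp add: mean_A_def)
  next
    case False
    then have dpos: "0 < d i" if "i < n" for i using pos_of_sorted[of n d i] d mono n that by blast
    define H where "H = (\<Sum>i<n. 1 / d i)"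
    have H: "H > 0" unfolding H_def using n dpos by (intro sum_pos) auto
    define c where "c i = (1 - z i) / a + z i / b" for i
    define R where "R = (\<Sum>i<n. d i * (1 - z i)) / a\<^sup>2 + (\<Sum>i<n. d i * z i) / b\<^sup>2"
    have "h = (\<Sum>i<n. c i)"
      using z n by (simp add: h_def c_def sum.distrib sum_divide_distrib[symmetric] sum_subtractf of_nat_diff)
    also have "\<dots> = (\<Sum>i<n. sqrt (1 / d i) * (sqrt (d i) * c i))"
    proof (intro sum.cong refl)
      fix i assume "i \<in> {..<n}"
      then show "c i = sqrt (1 / d i) * (sqrt (d i) * c i)" using dpos[of i] by (simp add: real_sqrt_divide)
    qed
    finally have "h\<^sup>2 = (\<Sum>i<n. sqrt (1 / d i) * (sqrt (d i) * c i))\<^sup>2" by simp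
    also have "\<dots> \<le> (\<Sum>i<n. (sqrt (1 / d i))\<^sup>2) * (\<Sum>i<n. (sqrt (d i) * c i)\<^sup>2)"
      by (rule Cauchy_Schwarz_ineq_sum)
    also have "\<dots> = H * (\<Sum>i<n. d i * (c i)\<^sup>2)"
      unfolding H_def using dpos by (intro arg_cong2[of _ _ _ _ "(*)"] sum.cong refl) (auto simp: power_mult_distrib less_imp_le)
    also have "\<dots> \<le> H * R"
    proof (intro mult_left_mono)
      have "d i * (c i)\<^sup>2 \<le> d i * ((1 - z i) / a\<^sup>2 + z i / b\<^sup>2)" if i: "i < n" for i
      proof (intro mult_left_mono)
        \<comment> \<open>The gap in Jensen's inequality for the square and two points, in closed
          form.\<close>
        have "(1 - z i) * p\<^sup>2 + z i * q\<^sup>2 - ((1 - z i) * p + z i * q)\<^sup>2 = z i * (1 - z i) * (p - q)\<^sup>2"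
          for p q :: real by (simp add: power2_eq_square algebra_simps)
        from this[of "1 / a" "1 / b"]
        have "(1 - z i) / a\<^sup>2 + z i / b\<^sup>2 - (c i)\<^sup>2 = z i * (1 - z i) * (1 / a - 1 / b)\<^sup>2"
          by (simp add: c_def power_divide)
        also have "\<dots> \<ge> 0" using d z1 i by simp
        finally show "(c i)\<^sup>2 \<le> (1 - z i) / a\<^sup>2 + z i / b\<^sup>2" by simp
      qed (use d i in auto)
      then have "(\<Sum>i<n. d i * (c i)\<^sup>2) \<le> (\<Sum>i<n. d i * ((1 - z i) / a\<^sup>2 + z i / b\<^sup>2))"
        by (intro sum_mono) auto
      also have "\<dots> = R" by (simp add: R_def distrib_left sum.distrib sum_divide_distrib)
      finally show "(\<Sum>i<n. d i * (c i)\<^sup>2) \<le> R" .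
    qed (use H in auto)
    finally have "h\<^sup>2 \<le> H * R" .
    then have "1 / H \<le> R / h\<^sup>2" using H h by (simp add: field_simps)
    then have "n * (1 / H) \<le> n * (R / h\<^sup>2)" by (intro mult_left_mono) auto
    then show ?thesis using False by (simp add: mean_A_def H_def R_def power_mult_distrib algebra_simps add_divide_distrib)
  qed
qed

lemma supported_A:
  assumes n: "n > 0"
  shows "supported n (mean_A n)"
  unfolding supported_def
proof (intro allI impI)
  fix \<alpha> \<beta> \<epsilon> :: real
  assume ab: "0 \<le> \<beta>" "\<beta> \<le> \<alpha>" and eps: "0 < \<epsilon>"
  \<comment> \<open>At \<open>\<beta> = 0\<close> the reciprocal \<open>1 / b\<close> needs a
    positive \<open>b\<close>; the value \<open>\<epsilon> / n\<close> is chosen to give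
    \<open>n / h \<le> n * b = \<epsilon>\<close>. For \<open>\<beta> > 0\<close> the point is not
    perturbed.\<close>
  define \<delta> where "\<delta> = (if \<beta> = 0 then \<epsilon> / n else 0)"
  define a b where "a = \<alpha> + \<delta>" and "b = \<beta> + \<delta>"
  define h where "h = real (n - 1) / a + 1 / b"
  have pos: "a > 0" "b > 0" "\<alpha> \<le> a" "\<beta> \<le> b"
    using ab eps n by (auto simp: a_def b_def \<delta>_def intro!: add_nonneg_pos)
  have hb: "h \<ge> 1 / b" using pos by (simp add: h_def)
  moreover have "1 / b > 0" using pos by simp
  ultimately have h: "h > 0" by linarith
  have "real (n - 1) * \<alpha> / a\<^sup>2 \<le> real (n - 1) * a / a\<^sup>2"
    using pos by (intro divide_right_mono mult_left_mono) simp_all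
  moreover have "\<beta> / b\<^sup>2 \<le> b / b\<^sup>2" using pos by (intro divide_right_mono) simp_all
  ultimately have "real (n - 1) * \<alpha> / a\<^sup>2 + \<beta> / b\<^sup>2 \<le> h"
    using pos by (simp add: h_def power2_eq_square)
  then have "n / h\<^sup>2 * (real (n - 1) * \<alpha> / a\<^sup>2 + \<beta> / b\<^sup>2) \<le> n / h\<^sup>2 * h"
    by (intro mult_left_mono) auto
  also have "\<dots> = n / h" using h by (simp add: power2_eq_square)
  also have "\<dots> \<le> mean_A n (pinched \<alpha> \<beta>) + \<epsilon>"
  proof (cases "\<beta> = 0")
    case True
    have "n / h \<le> n / (1 / b)" using hb pos h by (intro divide_left_mono) auto
    also have "\<dots> = \<epsilon>" using True n by (simp add: b_def \<delta>_def)
    finally show ?thesis using True by (simp add: mean_A_def pinched_def)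
  next
    case False
    then have "mean_A n (pinched \<alpha> \<beta>) = n / h"
      using sum_pinched(1)[OF n, of "\<lambda>x. 1 / x" \<alpha> \<beta>]
      by (simp add: mean_A_def h_def a_def b_def \<delta>_def add.commute) (simp add: pinched_def)
    then show ?thesis using eps by simp
  qed
  finally have attained: "n / (a * h)\<^sup>2 * (real (n - 1) * \<alpha>) + n / (b * h)\<^sup>2 * \<beta> \<le> mean_A n (pinched \<alpha> \<beta>) + \<epsilon>"
    by (simp add: power_mult_distrib algebra_simps add_divide_distrib)
  show "\<exists>u v. 0 \<le> u \<and> 0 \<le> v \<and> u * (real (n - 1) * \<alpha>) + v * \<beta> \<le> mean_A n (pinched \<alpha> \<beta>) + \<epsilon>
    \<and> (\<forall>d z. (\<forall>i<n. 0 \<le> d i \<and> 0 \<le> z i) \<longrightarrow> (\<forall>i j. i \<le> j \<longrightarrow> j < n \<longrightarrow> d i \<le> d j) \<longrightarrow> (\<Sum>i<n. z i) = 1 \<longrightarrow>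
        mean_A n d \<le> u * (\<Sum>i<n. d i * (1 - z i)) + v * (\<Sum>i<n. d i * z i))"
    by (rule exI[of _ "n / (a * h)\<^sup>2"], rule exI[of _ "n / (b * h)\<^sup>2"])
      (use attained mean_A_bound[OF n _ _ _ pos(1,2), folded h_def] in simp)
qed

text \<open>\<open>r / (n a)\<close> and \<open>r / (n b)\<close> are the partial derivatives of the
  geometric mean at \<open>pinched a b\<close>. With \<open>c i\<close> as for the harmonic mean,
  the arithmetic-geometric inequality is applied to \<open>d i * c i\<close>. Convexity of
  \<open>exp\<close> gives \<open>c i \<ge> a^(z i - 1) b^(- z i)\<close>, and the product of these
  lower bounds is \<open>1 / (b a^(n-1))\<close>.\<close>

lemma mean_D_bound:
  fixes d z :: "nat \<Rightarrow> real"
  assumes n: "n > 0" and d: "\<forall>i<n. 0 \<le> d i \<and> 0 \<le> z i" and z: "(\<Sum>i<n. z i) = 1" and pos: "a > 0" "b > 0"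
  defines "r \<equiv> root n (b * a ^ (n - 1))"
  shows "mean_D n d \<le> r / (n * a) * (\<Sum>i<n. d i * (1 - z i)) + r / (n * b) * (\<Sum>i<n. d i * z i)"
proof -
  have z1: "z i \<le> 1" if "i < n" for i
    using member_le_sum[of i "{..<n}" z] d z that by auto
  define c where "c i = (1 - z i) / a + z i / b" for i
  have r: "r > 0" using n pos by (simp add: r_def)
  have c_ge: "exp (- ((1 - z i) * ln a + z i * ln b)) \<le> c i" if "i < n" for i
    using convex_onD[OF exp_convex, of "z i" "- ln a" "- ln b"] d z1 that pos
    by (simp add: c_def exp_minus divide_inverse algebra_simps)
  have "(\<Sum>i<n. (1 - z i) * ln a + z i * ln b) = real (n - 1) * ln a + ln b"
    using z n by (simp add: sum.distrib sum_distrib_right[symmetric] sum_subtractf of_nat_diff)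
  also have "\<dots> = ln (b * a ^ (n - 1))" using pos by (simp add: ln_mult ln_realpow)
  finally have "exp (- (\<Sum>i<n. (1 - z i) * ln a + z i * ln b)) = inverse (b * a ^ (n - 1))"
    using pos by (simp only: exp_minus) simp
  then have "inverse (b * a ^ (n - 1)) = (\<Prod>i<n. exp (- ((1 - z i) * ln a + z i * ln b)))"
    by (simp only: exp_sum[OF finite_lessThan, symmetric] sum_negf)
  also have "\<dots> \<le> (\<Prod>i<n. c i)" using c_ge by (intro prod_mono) auto
  finally have c_prod: "inverse (b * a ^ (n - 1)) \<le> (\<Prod>i<n. c i)" .
  have c_nonneg: "0 \<le> c i" if "i < n" for i using d z1 that pos by (simp add: c_def)
  have "mean_D n d / r = root n ((\<Prod>i<n. d i) * inverse (b * a ^ (n - 1)))"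
    by (simp add: mean_D_def r_def divide_inverse real_root_mult real_root_inverse)
  also have "\<dots> \<le> root n ((\<Prod>i<n. d i) * (\<Prod>i<n. c i))"
    using n d c_prod by (intro real_root_le_mono mult_left_mono prod_nonneg) auto
  also have "\<dots> = (\<Prod>i<n. d i * c i) powr (1 / n)"
    using n d c_nonneg by (subst root_powr_inverse) (auto simp: prod.distrib intro!: prod_nonneg mult_nonneg_nonneg)
  also have "\<dots> \<le> (\<Sum>i<n. d i * c i / n)"
    using arith_geom_mean[of "{..<n}" "\<lambda>i. d i * c i"] n d c_nonneg by auto
  also have "\<dots> = ((\<Sum>i<n. d i * (1 - z i)) / a + (\<Sum>i<n. d i * z i) / b) / n"
    by (simp add: c_def sum_divide_distrib sum.distrib distrib_left add_divide_distrib)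
  finally show ?thesis using r n pos by (simp add: field_simps)
qed

text \<open>The gradient may blow up as \<open>\<beta>\<close> tends to 0, so the functional is
  taken at the point shifted by \<open>\<delta>\<close> in all coordinates; continuity of
  \<open>F\<close> at 0 from the right keeps the loss below \<open>\<epsilon>\<close>.\<close>

lemma supported_D:
  assumes n: "n > 0"
  shows "supported n (mean_D n)"
  unfolding supported_def
proof (intro allI impI)
  fix \<alpha> \<beta> \<epsilon> :: real
  assume ab: "0 \<le> \<beta>" "\<beta> \<le> \<alpha>" and eps: "0 < \<epsilon>"
  define F where "F \<delta> = root n ((\<beta> + \<delta>) * (\<alpha> + \<delta>) ^ (n - 1))" for \<delta>
  have "(F \<longlongrightarrow> F 0) (at_right 0)" unfolding F_def by (intro tendsto_intros)
  then have "\<forall>\<^sub>F \<delta> in at_right 0. F \<delta> < F 0 + \<epsilon>" using eps by (intro order_tendstoD(2)) auto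
  then obtain \<delta> where \<delta>: "\<delta> > 0" "F \<delta> < F 0 + \<epsilon>"
    by (metis (mono_tags, lifting) dense eventually_at_right_field)
  define a b where "a = \<alpha> + \<delta>" and "b = \<beta> + \<delta>"
  have pos: "a > 0" "b > 0" "\<alpha> \<le> a" "\<beta> \<le> b" using ab \<delta> by (auto simp: a_def b_def)
  define r where "r = root n (b * a ^ (n - 1))"
  have r: "r \<ge> 0" using pos n by (simp add: r_def)
  have "r / (n * a) * (real (n - 1) * \<alpha>) + r / (n * b) * \<beta> \<le> r / (n * a) * (real (n - 1) * a) + r / (n * b) * b"
    using pos r by (intro add_mono mult_left_mono) auto
  also have "\<dots> = r" using pos n by (simp add: field_simps of_nat_diff)
  also have "\<dots> \<le> mean_D n (pinched \<alpha> \<beta>) + \<epsilon>"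
    using \<delta>(2) by (simp add: F_def r_def a_def b_def mean_D_def sum_pinched(2)[OF n])
  finally have attained: "r / (n * a) * (real (n - 1) * \<alpha>) + r / (n * b) * \<beta> \<le> mean_D n (pinched \<alpha> \<beta>) + \<epsilon>" .
  show "\<exists>u v. 0 \<le> u \<and> 0 \<le> v \<and> u * (real (n - 1) * \<alpha>) + v * \<beta> \<le> mean_D n (pinched \<alpha> \<beta>) + \<epsilon>
    \<and> (\<forall>d z. (\<forall>i<n. 0 \<le> d i \<and> 0 \<le> z i) \<longrightarrow> (\<forall>i j. i \<le> j \<longrightarrow> j < n \<longrightarrow> d i \<le> d j) \<longrightarrow> (\<Sum>i<n. z i) = 1 \<longrightarrow>
        mean_D n d \<le> u * (\<Sum>i<n. d i * (1 - z i)) + v * (\<Sum>i<n. d i * z i))"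
    by (rule exI[of _ "r / (n * a)"], rule exI[of _ "r / (n * b)"])
      (use attained r pos mean_D_bound[OF n _ _ pos(1,2), folded r_def] in simp)
qed

section \<open>The bilinear form of a measure\<close>

text \<open>Row \<open>j\<close> of \<open>G_i\<close> is the unit vector of the treatment in period
  \<open>shift k i j\<close>: the period itself, its left or its right neighbour on the circle. The
  summand \<open>k\<close> avoids truncated subtraction at \<open>j = 0\<close>.\<close>

definition shift :: "nat \<Rightarrow> nat \<Rightarrow> nat \<Rightarrow> nat" where
  "shift k i j = (if i = 0 then j else if i = 1 then (j + k - 1) mod k else (j + 1) mod k)"

definition cov :: "nat \<Rightarrow> (nat \<Rightarrow> real) \<Rightarrow> (nat \<Rightarrow> real) \<Rightarrow> real" where
  "cov k f h = (\<Sum>j<k. f j * h j) - (\<Sum>j<k. f j) * (\<Sum>j<k. h j) / real k"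

text \<open>Entry \<open>j\<close> of \<open>(u_0 T_s + u_1 L_s + u_2 R_s) x\<close>.\<close>

definition lift :: "nat \<Rightarrow> (nat \<Rightarrow> real) \<Rightarrow> (nat \<Rightarrow> real) \<Rightarrow> nat list \<Rightarrow> nat \<Rightarrow> real" where
  "lift k u x s j = (\<Sum>i\<le>2. u i * x (s ! shift k i j))"

text \<open>Since \<open>cov k f h = f' Btilde h\<close> for type-H covariances, \<open>cform\<close> is the bilinear form
  \<open>(x, y) \<mapsto> x' C[u,w] y\<close> of the measure \<open>p\<close>.\<close>

definition cform :: "nat \<Rightarrow> nat \<Rightarrow> (nat list \<Rightarrow> real) \<Rightarrow> (nat \<Rightarrow> real) \<Rightarrow> (nat \<Rightarrow> real) \<Rightarrow> (nat \<Rightarrow> real)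
    \<Rightarrow> (nat \<Rightarrow> real) \<Rightarrow> real" where
  "cform k t p u x w y = (\<Sum>s\<in>seqs k t. p s * cov k (lift k u x s) (lift k w y s))"

definition ind :: "nat \<Rightarrow> nat \<Rightarrow> real" where
  "ind a c = (if c = a then 1 else 0)"

section \<open>Linearity of the forms, and constants in their kernel\<close>

lemma shift_lt: "j < k \<Longrightarrow> shift k i j < k"
  by (simp add: shift_def)

lemma seqs_nth: "s \<in> seqs k t \<Longrightarrow> j < k \<Longrightarrow> s ! shift k i j < t"
  using shift_lt[of j k i] by (force simp: seqs_def)

lemma cov_commute: "cov k f h = cov k h f"
  by (simp add: cov_def mult.commute)

lemma cov_sum:
  "cov k f (\<lambda>j. \<Sum>a\<in>A. c a * h a j) = (\<Sum>a\<in>A. c a * cov k f (h a))"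
proof (induction A rule: infinite_finite_induct)
  case (insert b A)
  have "cov k f (\<lambda>j. c b * h b j + (\<Sum>a\<in>A. c a * h a j))
      = c b * cov k f (h b) + cov k f (\<lambda>j. \<Sum>a\<in>A. c a * h a j)"
    by (simp add: cov_def sum.distrib sum_distrib_left algebra_simps add_divide_distrib)
  then show ?case using insert by simp
qed (simp_all add: cov_def)

lemma cov_add_left: "cov k (\<lambda>j. f j + g j) h = cov k f h + cov k g h"
  by (simp add: cov_def sum.distrib algebra_simps add_divide_distrib)

lemma cov_add_right: "cov k h (\<lambda>j. f j + g j) = cov k h f + cov k h g"
  by (simp add: cov_def sum.distrib algebra_simps add_divide_distrib)

lemma cov_const: "cov k f (\<lambda>_. c) = 0"
  by (cases "k = 0") (simp_all add: cov_def sum_distrib_right[symmetric])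

lemma cov_nonneg: "0 \<le> cov k f f"
proof (cases "k = 0")
  case False
  have "(\<Sum>j<k. 1 * f j)\<^sup>2 \<le> (\<Sum>j<k. 1\<^sup>2) * (\<Sum>j<k. (f j)\<^sup>2)"
    by (rule Cauchy_Schwarz_ineq_sum)
  then show ?thesis using False by (simp add: cov_def field_simps power2_eq_square)
qed (simp add: cov_def)

lemma cov_cong: "(\<And>j. j < k \<Longrightarrow> f j = f' j) \<Longrightarrow> (\<And>j. j < k \<Longrightarrow> h j = h' j) \<Longrightarrow> cov k f h = cov k f' h'"
  by (simp add: cov_def)

lemma cov_reindex:
  assumes "bij_betw q {..<k} {..<k}"
  shows "cov k (\<lambda>j. f (q j)) (\<lambda>j. h (q j)) = cov k f h"
  unfolding cov_def
  using sum.reindex_bij_betw[OF assms, of f] sum.reindex_bij_betw[OF assms, of h]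
    sum.reindex_bij_betw[OF assms, of "\<lambda>j. f j * h j"] by simp

lemma lift_expand:
  assumes "s \<in> seqs k t" and "j < k"
  shows "lift k u x s j = (\<Sum>a<t. x a * lift k u (ind a) s j)"
proof -
  have "x (s ! shift k i j) = (\<Sum>a<t. x a * ind a (s ! shift k i j))" for i
    using seqs_nth[OF assms, of i] by (simp add: ind_def if_distrib cong: if_cong)
  then have "lift k u x s j = (\<Sum>i\<le>2. \<Sum>a<t. u i * (x a * ind a (s ! shift k i j)))"
    by (simp add: lift_def sum_distrib_left)
  also have "\<dots> = (\<Sum>a<t. \<Sum>i\<le>2. u i * (x a * ind a (s ! shift k i j)))" by (rule sum.swap)
  finally show ?thesis by (simp add: lift_def sum_distrib_left mult_ac)
qed

lemma lift_sum_weights: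
  "lift k (\<lambda>i. \<Sum>a\<in>A. c a * w a i) x s = (\<lambda>j. \<Sum>a\<in>A. c a * lift k (w a) x s j)"
proof
  fix j
  have "lift k (\<lambda>i. \<Sum>a\<in>A. c a * w a i) x s j = (\<Sum>i\<le>2. \<Sum>a\<in>A. c a * w a i * x (s ! shift k i j))"
    by (simp add: lift_def sum_distrib_right)
  also have "\<dots> = (\<Sum>a\<in>A. \<Sum>i\<le>2. c a * w a i * x (s ! shift k i j))" by (rule sum.swap)
  finally show "lift k (\<lambda>i. \<Sum>a\<in>A. c a * w a i) x s j = (\<Sum>a\<in>A. c a * lift k (w a) x s j)"
    by (simp add: lift_def sum_distrib_left mult_ac)
qed

lemma lift_add_weights: "lift k (\<lambda>i. u i + w i) x s = (\<lambda>j. lift k u x s j + lift k w x s j)"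
  by (rule ext) (simp add: lift_def distrib_right sum.distrib)

lemma lift_const: "lift k u (\<lambda>_. c) s = (\<lambda>_. (\<Sum>i\<le>2. u i) * c)"
  by (rule ext) (simp add: lift_def sum_distrib_right)

lemma lift_add_args: "lift k u (\<lambda>a. x a + y a) s = (\<lambda>j. lift k u x s j + lift k u y s j)"
  by (rule ext) (simp add: lift_def distrib_left sum.distrib)

lemma cform_commute: "cform k t p u x w y = cform k t p w y u x"
  by (simp add: cform_def cov_commute)

lemma cform_expand: "cform k t p u x w y = (\<Sum>b<t. y b * cform k t p u x w (ind b))"
proof -
  have "cform k t p u x w y = (\<Sum>s\<in>seqs k t. \<Sum>b<t. y b * (p s * cov k (lift k u x s) (lift k w (ind b) s)))"
    unfolding cform_def
  proof (intro sum.cong refl)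
    fix s assume "s \<in> seqs k t"
    then have "cov k (lift k u x s) (lift k w y s)
        = cov k (lift k u x s) (\<lambda>j. \<Sum>b<t. y b * lift k w (ind b) s j)"
      by (intro cov_cong refl lift_expand)
    then show "p s * cov k (lift k u x s) (lift k w y s)
        = (\<Sum>b<t. y b * (p s * cov k (lift k u x s) (lift k w (ind b) s)))"
      by (simp add: cov_sum sum_distrib_left mult_ac)
  qed
  also have "\<dots> = (\<Sum>b<t. \<Sum>s\<in>seqs k t. y b * (p s * cov k (lift k u x s) (lift k w (ind b) s)))"
    by (rule sum.swap)
  finally show ?thesis by (simp add: cform_def sum_distrib_left)
qed

lemma cform_sum_weights:
  "cform k t p u x (\<lambda>i. \<Sum>a\<in>A. c a * w a i) y = (\<Sum>a\<in>A. c a * cform k t p u x (w a) y)"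
proof -
  have "cform k t p u x (\<lambda>i. \<Sum>a\<in>A. c a * w a i) y
      = (\<Sum>s\<in>seqs k t. \<Sum>a\<in>A. c a * (p s * cov k (lift k u x s) (lift k (w a) y s)))"
    by (simp add: cform_def lift_sum_weights cov_sum sum_distrib_left mult_ac)
  also have "\<dots> = (\<Sum>a\<in>A. \<Sum>s\<in>seqs k t. c a * (p s * cov k (lift k u x s) (lift k (w a) y s)))"
    by (rule sum.swap)
  finally show ?thesis by (simp add: cform_def sum_distrib_left)
qed

lemma cform_add_weights:
  "cform k t p u x (\<lambda>i. w i + w' i) y = cform k t p u x w y + cform k t p u x w' y"
  by (simp add: cform_def lift_add_weights cov_add_right distrib_left sum.distrib)

lemma cform_add_const: "cform k t p u x w (\<lambda>a. y a + c) = cform k t p u x w y"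
  by (simp add: cform_def lift_add_args lift_const cov_add_right cov_const)

lemma cform_const: "cform k t p u x w (\<lambda>_. c) = 0"
  by (simp add: cform_def lift_const cov_const)

section \<open>Entries of the design matrices expressed through the forms\<close>

lemma Gmat_carrier: "Gmat k t s i \<in> carrier_mat k t"
  by (auto simp: Gmat_def Tmat_def Lmat_def Rmat_def Hmat_def intro!: mult_carrier_mat[of _ k k])

lemma Gmat_entry:
  assumes "j < k" and "a < t"
  shows "Gmat k t s i $$ (j,a) = ind a (s ! shift k i j)"
proof -
  \<comment> \<open>Row \<open>j\<close> of \<open>H\<close> has its 1 in the column
    \<open>r\<close> with \<open>r + 1 = j\<close> modulo \<open>k\<close>; the wrap-around
    \<open>r + 1 = k\<close> is treated separately.\<close>
  have prev: "j mod k = (r + 1) mod k \<longleftrightarrow> r = (j + k - 1) mod k" if r: "r < k" for r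
  proof (cases "r + 1 = k")
    case True
    then show ?thesis using assms by (cases j) (auto simp: mod_if)
  next
    case False
    then have "r + 1 < k" using r by simp
    then show ?thesis using assms by (cases j) (auto simp: mod_if)
  qed
  have nxt: "r mod k = (j + 1) mod k \<longleftrightarrow> r = (j + 1) mod k" if r: "r < k" for r
    using r by simp
  have "Lmat k t s $$ (j,a) = (\<Sum>r<k. (if j mod k = (r + 1) mod k then 1 else 0) * ind a (s ! r))"
    using assms by (simp add: Lmat_def Hmat_def Tmat_def scalar_prod_def lessThan_atLeast0 ind_def)
  also have "\<dots> = (\<Sum>r<k. (if r = (j + k - 1) mod k then ind a (s ! r) else 0))"
    by (intro sum.cong refl) (subst prev, auto)
  finally have L: "Lmat k t s $$ (j,a) = ind a (s ! ((j + k - 1) mod k))" using assms by simp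
  have "Rmat k t s $$ (j,a) = (\<Sum>r<k. (if r mod k = (j + 1) mod k then 1 else 0) * ind a (s ! r))"
    using assms by (simp add: Rmat_def Hmat_def Tmat_def scalar_prod_def lessThan_atLeast0 ind_def)
  also have "\<dots> = (\<Sum>r<k. (if r = (j + 1) mod k then ind a (s ! r) else 0))"
    by (intro sum.cong refl) (subst nxt, auto)
  finally have R: "Rmat k t s $$ (j,a) = ind a (s ! ((j + 1) mod k))" using assms by simp
  show ?thesis using assms L R by (auto simp: Gmat_def shift_def Tmat_def ind_def)
qed

definition centering :: "nat \<Rightarrow> real mat" where
  "centering k = mat k k (\<lambda>(i,j). (if i = j then 1 else 0) - 1 / real k)"

lemma Cs_entry:
  assumes B: "Btilde k S = centering k" and ab: "a < t" "b < t"
  shows "Cs k t S s i j $$ (a,b) = cov k (\<lambda>r. ind a (s ! shift k i r)) (\<lambda>r. ind b (s ! shift k j r))"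
proof -
  define f where "f r = ind a (s ! shift k i r)" for r
  define h where "h r = ind b (s ! shift k j r)" for r
  define M where "M = transpose_mat (Gmat k t s i) * centering k"
  have M: "M \<in> carrier_mat t k"
    unfolding M_def using Gmat_carrier[of k t s i] by (intro mult_carrier_mat) (auto simp: centering_def)
  have GB: "M $$ (a,r) = f r - (\<Sum>q<k. f q) / k" if r: "r < k" for r
  proof -
    have "M $$ (a,r) = (\<Sum>q<k. f q * ((if q = r then 1 else 0) - 1 / k))"
      using ab r Gmat_carrier[of k t s i]
      by (simp add: M_def scalar_prod_def centering_def Gmat_entry f_def lessThan_atLeast0)
    also have "\<dots> = (\<Sum>q<k. (if q = r then f q else 0) - f q / k)"
      by (intro sum.cong) (auto simp: right_diff_distrib)
    also have "\<dots> = f r - (\<Sum>q<k. f q) / k"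
      using r by (simp add: sum_subtractf sum_divide_distrib)
    finally show ?thesis .
  qed
  have "Cs k t S s i j $$ (a,b) = (\<Sum>r<k. M $$ (a,r) * h r)"
    unfolding Cs_def B M_def[symmetric] using ab M Gmat_carrier[of k t s j]
    by (simp add: scalar_prod_def Gmat_entry h_def lessThan_atLeast0)
  also have "\<dots> = (\<Sum>r<k. (f r - (\<Sum>q<k. f q) / k) * h r)"
    by (intro sum.cong refl) (simp add: GB)
  also have "\<dots> = cov k f h"
    by (simp add: cov_def left_diff_distrib sum_subtractf flip: sum_distrib_left sum_divide_distrib)
  finally show ?thesis unfolding f_def h_def .
qed

lemma Cxi_entry:
  assumes "Btilde k S = centering k" and "a < t" and "b < t"
  shows "Cxi k t S p i j $$ (a,b)
    = (\<Sum>s\<in>seqs k t. p s * cov k (\<lambda>r. ind a (s ! shift k i r)) (\<lambda>r. ind b (s ! shift k j r)))"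
  using assms by (simp add: Cxi_def Cs_entry)

lemma cov_lift:
  "cov k (lift k u x s) (lift k w y s)
      = (\<Sum>i\<le>2. \<Sum>j\<le>2. u i * w j * cov k (\<lambda>r. x (s ! shift k i r)) (\<lambda>r. y (s ! shift k j r)))"
proof -
  have *: "cov k f (lift k w y s) = (\<Sum>j\<le>2. w j * cov k f (\<lambda>r. y (s ! shift k j r)))" for f w y
  proof -
    have "lift k w y s = (\<lambda>r. \<Sum>j\<le>2. w j * y (s ! shift k j r))" by (simp add: lift_def fun_eq_iff)
    then show ?thesis by (simp only: cov_sum)
  qed
  have "cov k (lift k u x s) (\<lambda>r. y (s ! shift k j r))
      = (\<Sum>i\<le>2. u i * cov k (\<lambda>r. x (s ! shift k i r)) (\<lambda>r. y (s ! shift k j r)))" for j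
    using *[of "\<lambda>r. y (s ! shift k j r)" u x] by (simp only: cov_commute)
  then show ?thesis unfolding *[of "lift k u x s"]
    by (subst sum.swap) (simp add: sum_distrib_left mult_ac)
qed

lemma Cuw_entry:
  assumes B: "Btilde k S = centering k" and ab: "a < t" "b < t"
  shows "Cuw k t S p u w $$ (a,b) = cform k t p u (ind a) w (ind b)"
proof -
  have "Cuw k t S p u w $$ (a,b) = (\<Sum>i\<le>2. \<Sum>j\<le>2. \<Sum>s\<in>seqs k t. u i * w j * (p s *
      cov k (\<lambda>r. ind a (s ! shift k i r)) (\<lambda>r. ind b (s ! shift k j r))))"
    using ab by (simp add: Cuw_def Cxi_entry[OF B] sum_distrib_left)
  also have "\<dots> = (\<Sum>i\<le>2. \<Sum>s\<in>seqs k t. \<Sum>j\<le>2. u i * w j * (p s *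
      cov k (\<lambda>r. ind a (s ! shift k i r)) (\<lambda>r. ind b (s ! shift k j r))))"
    by (intro sum.cong refl sum.swap)
  also have "\<dots> = (\<Sum>s\<in>seqs k t. \<Sum>i\<le>2. \<Sum>j\<le>2. u i * w j * (p s *
      cov k (\<lambda>r. ind a (s ! shift k i r)) (\<lambda>r. ind b (s ! shift k j r))))"
    by (rule sum.swap)
  finally show ?thesis unfolding cform_def cov_lift by (simp add: sum_distrib_left mult_ac)
qed

section \<open>The information matrix\<close>

lemma pos_defD:
  assumes "pos_def k S" and "v \<in> carrier_vec k" and "v \<noteq> 0\<^sub>v k"
  shows "(\<Sum>i<k. \<Sum>j<k. v $ i * S $$ (i,j) * v $ j) > 0"
  using assms unfolding pos_def_def by (elim conjE allE[of _ v]) simp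

text \<open>A kernel vector would have quadratic form 0, so definiteness gives an inverse. A right
  inverse is also a left inverse and hence unique, which the \<open>THE\<close> in
  \<open>inv_mat\<close> needs.\<close>

lemma pos_def_inverse:
  assumes S: "pos_def k S"
  shows "inv_mat k S \<in> carrier_mat k k" and "S * inv_mat k S = 1\<^sub>m k" and "inv_mat k S * S = 1\<^sub>m k"
proof -
  have c: "S \<in> carrier_mat k k" using S by (simp add: pos_def_def)
  have "det S \<noteq> 0"
  proof
    assume "det S = 0"
    then obtain v where v: "v \<in> carrier_vec k" "v \<noteq> 0\<^sub>v k" "S *\<^sub>v v = 0\<^sub>v k"
      using det_0_iff_vec_prod_zero[OF c] by auto
    have "(\<Sum>i<k. \<Sum>j<k. v $ i * S $$ (i,j) * v $ j) = v \<bullet> (S *\<^sub>v v)"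
      using c v(1) by (simp add: scalar_prod_def lessThan_atLeast0 sum_distrib_left mult_ac)
    also have "\<dots> = 0" using v by simp
    finally show False using pos_defD[OF S v(1,2)] by simp
  qed
  then obtain Z where Z: "Z \<in> carrier_mat k k" "S * Z = 1\<^sub>m k"
    using det_non_zero_imp_unit[OF c, of "()"] unfolding Units_def ring_mat_def by auto
  have "\<exists>!X. X \<in> carrier_mat k k \<and> S * X = 1\<^sub>m k"
  proof (rule ex_ex1I)
    show "\<exists>X. X \<in> carrier_mat k k \<and> S * X = 1\<^sub>m k"
      using Z by blast
    fix X Y assume X: "X \<in> carrier_mat k k \<and> S * X = 1\<^sub>m k" and Y: "Y \<in> carrier_mat k k \<and> S * Y = 1\<^sub>m k"
    then have "X * S = 1\<^sub>m k" using mat_mult_left_right_inverse[OF c, of X] by simp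
    then have "X * (S * Y) = Y" using X Y c by (metis assoc_mult_mat left_mult_one_mat)
    then show "X = Y" using X Y by (metis right_mult_one_mat)
  qed
  from theI'[OF this] show i: "inv_mat k S \<in> carrier_mat k k" "S * inv_mat k S = 1\<^sub>m k"
    unfolding inv_mat_def by auto
  show "inv_mat k S * S = 1\<^sub>m k" by (rule mat_mult_left_right_inverse[OF c i])
qed

text \<open>Write \<open>a = S\<^sup>-\<^sup>1 1\<close>, so that \<open>Btilde = S\<^sup>-\<^sup>1 - a a' / (1'a)\<close> has zero column sums. In
  \<open>S Btilde\<close> with \<open>S = I + eta 1' + 1 eta'\<close>, the term \<open>eta 1' Btilde\<close> therefore vanishes and
  \<open>1 eta' Btilde\<close> has constant columns: each column of \<open>Btilde\<close> is a unit vector up to a constant shift,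
  which the zero column sums determine.\<close>

lemma Btilde_typeH:
  assumes S: "pos_def k S" and H: "typeH k S" and k: "k > 0"
  shows "Btilde k S = centering k"
proof -
  note inv = pos_def_inverse[OF S]
  obtain eta where eta: "eta \<in> carrier_mat k 1"
    "S = 1\<^sub>m k + eta * transpose_mat (ones_vec k) + ones_vec k * transpose_mat eta"
    using H unfolding typeH_def by blast
  define e where "e i = eta $$ (i,0)" for i
  have S_entry: "S $$ (i,j) = (if i = j then 1 else 0) + e i + e j" if "i < k" "j < k" for i j
    using that eta(1) by (simp add: eta(2) ones_vec_def scalar_prod_def e_def)
  have c: "S \<in> carrier_mat k k" using S by (simp add: pos_def_def)
  define X where "X i j = inv_mat k S $$ (i,j)" for i j
  have SX: "(\<Sum>r<k. S $$ (i,r) * X r j) = (if i = j then 1 else 0)" if "i < k" "j < k" for i j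
    using arg_cong[OF inv(2), of "\<lambda>M. M $$ (i,j)"] that c inv(1) by (simp add: X_def scalar_prod_def lessThan_atLeast0)
  have XS: "(\<Sum>r<k. X i r * S $$ (r,j)) = (if i = j then 1 else 0)" if "i < k" "j < k" for i j
    using arg_cong[OF inv(3), of "\<lambda>M. M $$ (i,j)"] that c inv(1) by (simp add: X_def scalar_prod_def lessThan_atLeast0)
  define a where "a i = (\<Sum>r<k. X i r)" for i
  define b where "b j = (\<Sum>r<k. X r j)" for j
  define \<sigma> where "\<sigma> = (\<Sum>i<k. a i)"
  have \<sigma>b: "(\<Sum>j<k. b j) = \<sigma>" unfolding \<sigma>_def a_def b_def by (rule sum.swap)
  have Sa: "(\<Sum>r<k. S $$ (i,r) * a r) = 1" if i: "i < k" for i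
  proof -
    have "(\<Sum>r<k. S $$ (i,r) * a r) = (\<Sum>j<k. \<Sum>r<k. S $$ (i,r) * X r j)"
      unfolding a_def sum_distrib_left by (rule sum.swap)
    also have "\<dots> = (\<Sum>j<k. if i = j then 1 else 0)" using i by (intro sum.cong refl) (simp add: SX)
    finally show ?thesis using i by simp
  qed
  \<comment> \<open>\<open>S a\<close> is the vector of ones, so
    \<open>a' S a = 1' a = \<sigma>\<close> and definiteness applies; \<open>a\<close> is nonzero
    for the same reason.\<close>
  have \<sigma>: "\<sigma> \<noteq> 0"
  proof -
    have "vec k a \<noteq> 0\<^sub>v k"
    proof
      assume "vec k a = 0\<^sub>v k"
      then have "a r = 0" if "r < k" for r using that by (metis index_vec index_zero_vec(1))
      then show False using Sa[OF k] by simp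
    qed
    then have "(\<Sum>i<k. \<Sum>j<k. a i * S $$ (i,j) * a j) > 0"
      using pos_defD[OF S, of "vec k a"] by simp
    also have "(\<Sum>i<k. \<Sum>j<k. a i * S $$ (i,j) * a j) = (\<Sum>i<k. a i * (\<Sum>j<k. S $$ (i,j) * a j))"
      by (simp add: sum_distrib_left mult_ac)
    also have "\<dots> = \<sigma>" by (simp add: Sa \<sigma>_def)
    finally show ?thesis by simp
  qed
  define B where "B i j = X i j - a i * b j / \<sigma>" for i j
  have B_entry: "Btilde k S $$ (i,j) = B i j" if "i < k" "j < k" for i j
  proof -
    have "(\<Sum>x=0..<k. \<Sum>i=0..<k. inv_mat k S $$ (i,x)) = (\<Sum>i=0..<k. \<Sum>x=0..<k. inv_mat k S $$ (i,x))"
      by (rule sum.swap)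
    then show ?thesis
      using that inv(1)
      by (simp add: Btilde_def Let_def ones_vec_def scalar_prod_def B_def X_def a_def b_def \<sigma>_def
          lessThan_atLeast0 sum_distrib_right sum_distrib_left sum_divide_distrib)
  qed
  have B_carrier: "Btilde k S \<in> carrier_mat k k"
  proof -
    have "inv_mat k S * ones_vec k * transpose_mat (ones_vec k) \<in> carrier_mat k k"
      using mult_carrier_mat[OF mult_carrier_mat[OF inv(1), of "ones_vec k" 1], of "transpose_mat (ones_vec k)" k]
      by (simp add: ones_vec_def)
    then have "inv_mat k S * ones_vec k * transpose_mat (ones_vec k) * inv_mat k S \<in> carrier_mat k k"
      using inv(1) by (rule mult_carrier_mat)
    then show ?thesis unfolding Btilde_def Let_def by (intro minus_carrier_mat smult_carrier_mat)
  qed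
  have col0: "(\<Sum>i<k. B i j) = 0" for j
    using \<sigma> by (simp add: B_def sum_subtractf sum_divide_distrib[symmetric] sum_distrib_right[symmetric] \<sigma>_def[symmetric] b_def)
  have SB: "(\<Sum>r<k. S $$ (i,r) * B r j) = (if i = j then 1 else 0) - b j / \<sigma>" if "i < k" "j < k" for i j
  proof -
    have "(\<Sum>r<k. S $$ (i,r) * B r j) = (\<Sum>r<k. S $$ (i,r) * X r j) - (\<Sum>r<k. S $$ (i,r) * a r) * (b j / \<sigma>)"
      by (simp add: B_def right_diff_distrib sum_subtractf sum_distrib_left sum_distrib_right sum_divide_distrib mult_ac)
    then show ?thesis using SX Sa that by simp
  qed
  have B_eq: "B i j = (if i = j then 1 else 0) - b j / \<sigma> - (\<Sum>r<k. e r * B r j)" if "i < k" "j < k" for i j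
  proof -
    have "(\<Sum>r<k. S $$ (i,r) * B r j) = (\<Sum>r<k. (if r = i then B r j else 0) + e i * B r j + e r * B r j)"
      using that by (intro sum.cong refl) (auto simp: S_entry distrib_right)
    also have "\<dots> = B i j + e i * (\<Sum>r<k. B r j) + (\<Sum>r<k. e r * B r j)"
      using that by (simp add: sum.distrib sum_distrib_left)
    finally show ?thesis using SB[OF that] col0 by simp
  qed
  show ?thesis
  proof (rule eq_matI)
    fix i j assume "i < dim_row (centering k)" "j < dim_col (centering k)"
    then have ij: "i < k" "j < k" by (auto simp: centering_def)
    define m where "m = b j / \<sigma> + (\<Sum>r<k. e r * B r j)"
    have B_m: "B i' j = (if i' = j then 1 else 0) - m" if "i' < k" for i' using B_eq[OF that ij(2)] by (simp add: m_def)
    have "0 = (\<Sum>i'<k. (if i' = j then 1 else 0) - m)" using col0[of j] B_m by simp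
    also have "\<dots> = 1 - k * m" using ij by (simp add: sum_subtractf)
    finally have "m = 1 / k" using k by (simp add: field_simps)
    then show "Btilde k S $$ (i,j) = centering k $$ (i,j)"
      using B_entry[OF ij] B_m[OF ij(1)] ij by (simp add: centering_def)
  qed (use B_carrier in \<open>auto simp: centering_def\<close>)
qed

text \<open>The covariance matrix enters the information matrices only through
  \<open>Btilde\<close>, so the value of \<open>Btilde\<close> is the assumption here in place of
  type H.\<close>

locale circular_design =
  fixes k t :: nat and S :: "real mat"
  assumes t: "t \<ge> 2" and B: "Btilde k S = centering k"
begin

lemma Cuw_carrier: "Cuw k t S p u w \<in> carrier_mat t t"
  by (simp add: Cuw_def)

lemma Cuw_mult_vec:
  assumes "a < t"
  shows "(Cuw k t S p u w *\<^sub>v vec t y) $ a = cform k t p u (ind a) w y"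
  using assms Cuw_carrier[of p u w] unfolding cform_expand[of k t p u "ind a" w y]
  by (simp add: scalar_prod_def lessThan_atLeast0 Cuw_entry[OF B] mult_ac)

lemma cform_expand_left: "cform k t p u x w y = (\<Sum>a<t. x a * cform k t p u (ind a) w y)"
  using cform_expand[of k t p w y u x] by (simp only: cform_commute[of k t p w y])

lemma Cuw_bilinear: "vec t x \<bullet> (Cuw k t S p u w *\<^sub>v vec t y) = cform k t p u x w y"
  unfolding cform_expand_left[of p u x w y] using Cuw_carrier[of p u w]
  by (simp add: scalar_prod_def[of "vec t x"] lessThan_atLeast0 Cuw_mult_vec del: index_mult_mat_vec)

definition Fmat :: "(nat list \<Rightarrow> real) \<Rightarrow> (nat \<Rightarrow> real) \<Rightarrow> (nat \<Rightarrow> real) list \<Rightarrow> (nat \<Rightarrow> real) \<Rightarrow> real mat" where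
  "Fmat p u ws x = mat (length ws) t (\<lambda>(a,b). cform k t p u (ind b) (ws ! a) x)"

definition Gram :: "(nat list \<Rightarrow> real) \<Rightarrow> (nat \<Rightarrow> real) list \<Rightarrow> (nat \<Rightarrow> real) \<Rightarrow> real mat" where
  "Gram p ws x = mat (length ws) (length ws) (\<lambda>(a,b). cform k t p (ws ! a) x (ws ! b) x)"

definition cross :: "(nat list \<Rightarrow> real) \<Rightarrow> (nat \<Rightarrow> real) \<Rightarrow> (nat \<Rightarrow> real) list \<Rightarrow> (nat \<Rightarrow> real) \<Rightarrow> (nat \<Rightarrow> real) \<Rightarrow> real vec" where
  "cross p u ws x y = vec (length ws) (\<lambda>a. cform k t p u y (ws ! a) x)"

lemma Info_eq:
  "Info k t S p u ws (vec t x) = Cuw k t S p u u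
    - transpose_mat (Fmat p u ws x) * moore_penrose (Gram p ws x) * Fmat p u ws x"
proof -
  have "mat (length ws) t (\<lambda>(a,b). (Cuw k t S p u (ws ! a) *\<^sub>v vec t x) $ b) = Fmat p u ws x"
    by (rule eq_matI) (auto simp: Fmat_def Cuw_mult_vec simp del: index_mult_mat_vec)
  moreover have "(transpose_mat (col_mat (vec t x)) * Cuw k t S p w w' * col_mat (vec t x)) $$ (0,0)
      = cform k t p w x w' x" for w w'
  proof -
    let ?c = "col_mat (vec t x)" and ?C = "Cuw k t S p w w'"
    have c: "?c \<in> carrier_mat t 1" by (simp add: col_mat_def)
    have "transpose_mat ?c * ?C * ?c = transpose_mat ?c * (?C * ?c)"
      by (rule assoc_mult_mat[of _ 1 t _ t _ 1]) (use c Cuw_carrier in auto)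
    moreover have "col ?c 0 = vec t x" by (rule eq_vecI) (auto simp: col_mat_def)
    moreover have "(transpose_mat ?c * (?C * ?c)) $$ (0,0) = col ?c 0 \<bullet> col (?C * ?c) 0"
      using c Cuw_carrier[of p w w'] by simp
    ultimately show ?thesis
      using col_mult2[OF Cuw_carrier[of p w w'] c, of 0] by (simp add: Cuw_bilinear)
  qed
  then have "mat (length ws) (length ws) (\<lambda>(a,b). (transpose_mat (col_mat (vec t x))
      * Cuw k t S p (ws ! a) (ws ! b) * col_mat (vec t x)) $$ (0,0)) = Gram p ws x"
    by (simp add: Gram_def)
  ultimately show ?thesis by (simp add: Info_def Let_def)
qed

lemma Gram_symmetric: "Gram p ws x \<in> carrier_mat (length ws) (length ws)" "transpose_mat (Gram p ws x) = Gram p ws x"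
proof -
  show "Gram p ws x \<in> carrier_mat (length ws) (length ws)" by (simp add: Gram_def)
  show "transpose_mat (Gram p ws x) = Gram p ws x"
  proof (rule eq_matI)
    fix i j assume "i < dim_row (Gram p ws x)" "j < dim_col (Gram p ws x)"
    then show "transpose_mat (Gram p ws x) $$ (i,j) = Gram p ws x $$ (i,j)"
      by (simp add: Gram_def) (rule cform_commute)
  qed (simp_all add: Gram_def)
qed

lemma moore_penrose_Gram:
  "moore_penrose (Gram p ws x) \<in> carrier_mat (length ws) (length ws)"
  "transpose_mat (moore_penrose (Gram p ws x)) = moore_penrose (Gram p ws x)"
  using moore_penrose_symmetric[OF Gram_symmetric[of p ws x]] Gram_symmetric(1)[of p ws x]
  unfolding penrose_eqs_def carrier_matD[OF Gram_symmetric(1)[of p ws x]] by blast+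

lemma Fmat_carrier: "Fmat p u ws x \<in> carrier_mat (length ws) t"
  by (simp add: Fmat_def)

lemma Fmat_mult_vec: "Fmat p u ws x *\<^sub>v vec t y = cross p u ws x y"
proof (rule eq_vecI)
  fix a assume "a < dim_vec (cross p u ws x y)"
  then have a: "a < length ws" by (simp add: cross_def)
  show "(Fmat p u ws x *\<^sub>v vec t y) $ a = cross p u ws x y $ a"
    using a unfolding cross_def index_vec[OF a] cform_expand_left[of p u y]
    by (simp add: Fmat_def scalar_prod_def lessThan_atLeast0 mult_ac)
qed (simp add: Fmat_def cross_def)

lemma Info_carrier: "Info k t S p u ws (vec t x) \<in> carrier_mat t t"
  unfolding Info_eq using Fmat_carrier[of p u ws x] moore_penrose_Gram(1)[of p ws x]
  by (intro minus_carrier_mat mult_carrier_mat[of _ t "length ws"]) auto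

lemma Info_bilinear:
  "vec t y \<bullet> (Info k t S p u ws (vec t x) *\<^sub>v vec t z)
    = cform k t p u y u z - cross p u ws x y \<bullet> (moore_penrose (Gram p ws x) *\<^sub>v cross p u ws x z)"
proof -
  let ?m = "length ws" and ?F = "Fmat p u ws x" and ?X = "moore_penrose (Gram p ws x)"
  have F: "?F \<in> carrier_mat ?m t" "transpose_mat ?F \<in> carrier_mat t ?m" using Fmat_carrier[of p u ws x] by auto
  note X = moore_penrose_Gram(1)[of p ws x]
  have TX: "transpose_mat ?F * ?X \<in> carrier_mat t ?m" using F X by (intro mult_carrier_mat) auto
  have TXF: "transpose_mat ?F * ?X * ?F \<in> carrier_mat t t" using TX F(1) by (rule mult_carrier_mat)
  have v: "vec t y \<in> carrier_vec t" "vec t z \<in> carrier_vec t" by auto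
  have c: "cross p u ws x z \<in> carrier_vec ?m" "cross p u ws x y \<in> carrier_vec ?m" by (auto simp: cross_def)
  have "transpose_mat ?F * ?X * ?F *\<^sub>v vec t z = transpose_mat ?F *\<^sub>v (?X *\<^sub>v cross p u ws x z)"
    unfolding assoc_mult_mat_vec[OF TX F(1) v(2)] Fmat_mult_vec by (rule assoc_mult_mat_vec[OF F(2) X c(1)])
  moreover have "vec t y \<bullet> (transpose_mat ?F *\<^sub>v w) = cross p u ws x y \<bullet> w" if "w \<in> carrier_vec ?m" for w
    unfolding Fmat_mult_vec[symmetric] using transpose_vec_mult_scalar[OF F(1) v(1) that] F that v
    by (simp add: comm_scalar_prod[of _ t] comm_scalar_prod[of _ ?m])
  moreover have "?X *\<^sub>v cross p u ws x z \<in> carrier_vec ?m" using X c(1) by (rule mult_mat_vec_carrier)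
  moreover from mult_mat_vec_carrier[OF F(2) this]
  have "transpose_mat ?F *\<^sub>v (?X *\<^sub>v cross p u ws x z) \<in> carrier_vec t" .
  moreover have "Cuw k t S p u u *\<^sub>v vec t z \<in> carrier_vec t"
    using Cuw_carrier v(2) by (rule mult_mat_vec_carrier)
  ultimately show ?thesis
    unfolding Info_eq minus_mult_distrib_mat_vec[OF Cuw_carrier TXF v(2)]
    using scalar_prod_minus_distrib[OF v(1)] by (simp add: Cuw_bilinear)
qed

lemma Info_symmetric: "transpose_mat (Info k t S p u ws (vec t x)) = Info k t S p u ws (vec t x)"
proof -
  let ?I = "Info k t S p u ws (vec t x)" and ?X = "moore_penrose (Gram p ws x)"
  have entry: "?I $$ (a,b) = vec t (ind a) \<bullet> (?I *\<^sub>v vec t (ind b))" if "a < t" "b < t" for a b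
  proof -
    have u: "vec t (ind c) = unit_vec t c" for c
      by (intro eq_vecI) (auto simp: ind_def unit_vec_def)
    show ?thesis using that Info_carrier[of p u ws x]
      by (simp add: u mult_mat_vec_unit[of _ t t] scalar_prod_left_unit)
  qed
  have sym: "vec t y \<bullet> (?I *\<^sub>v vec t z) = vec t z \<bullet> (?I *\<^sub>v vec t y)" for y z
  proof -
    have c: "cross p u ws x y \<in> carrier_vec (length ws)" "cross p u ws x z \<in> carrier_vec (length ws)"
      by (auto simp: cross_def)
    show ?thesis
      unfolding Info_bilinear mult_mat_vec_swap[OF moore_penrose_Gram c]
      using c moore_penrose_Gram(1)[of p ws x]
      by (simp add: comm_scalar_prod[of _ "length ws"] cform_commute[of k t p u y])
  qed
  show ?thesis
    by (rule eq_matI) (use Info_carrier[of p u ws x] entry sym in auto)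
qed

text \<open>A constant vector lifts to a function that is constant over the periods, and the
  centering annihilates it. This reduces arbitrary \<open>x\<close> to sum-zero vectors in the
  integrals.\<close>

lemma Info_add_const:
  "Info k t S p u ws (vec t (\<lambda>a. x a + c)) = Info k t S p u ws (vec t x)"
proof -
  have "cform k t p w (\<lambda>a. x a + c) w' y = cform k t p w x w' y" for w w' y
    by (subst (1 2) cform_commute) (rule cform_add_const)
  then show ?thesis unfolding Info_eq by (simp add: Fmat_def Gram_def cform_add_const)
qed

lemma Info_ones: "Info k t S p u ws (vec t x) *\<^sub>v vec t (\<lambda>_. 1) = 0\<^sub>v t"
proof (rule eq_vecI)
  fix a assume "a < dim_vec (0\<^sub>v t)"
  then have a: "a < t" by simp
  let ?v = "Info k t S p u ws (vec t x) *\<^sub>v vec t (\<lambda>_. 1)"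
  have v: "?v \<in> carrier_vec t" using Info_carrier by (intro mult_mat_vec_carrier) auto
  have "cross p u ws x (\<lambda>_. 1) = 0\<^sub>v (length ws)"
    by (rule eq_vecI) (auto simp: cross_def cform_commute[of k t p u "\<lambda>_. 1"] cform_const)
  moreover have "moore_penrose (Gram p ws x) *\<^sub>v 0\<^sub>v (length ws) = 0\<^sub>v (length ws)"
    using moore_penrose_Gram(1)[of p ws x] by (intro eq_vecI) auto
  moreover have "cross p u ws x (ind a) \<in> carrier_vec (length ws)" by (simp add: cross_def)
  ultimately have "vec t (ind a) \<bullet> ?v = 0" unfolding Info_bilinear by (simp add: cform_const)
  moreover have "vec t (ind a) = unit_vec t a" using a by (intro eq_vecI) (auto simp: ind_def)
  ultimately show "?v $ a = 0\<^sub>v t $ a" using a v by simp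
qed (use Info_carrier[of p u ws x] in simp)

end

section \<open>Cyclic invariance and the shape of the quadratic form\<close>

lemma shift_inverse:
  assumes "j < k"
  shows "shift k 1 (shift k 2 j) = j" and "shift k 2 (shift k 1 j) = j"
proof -
  show "shift k 1 (shift k 2 j) = j"
    using assms by (cases "Suc j = k") (auto simp: shift_def)
  show "shift k 2 (shift k 1 j) = j"
    using assms by (cases j) (auto simp: shift_def mod_if)
qed

lemma shift_bij: "bij_betw (shift k 1) {..<k} {..<k}" "bij_betw (shift k 2) {..<k} {..<k}"
  by (rule bij_betw_byWitness[of _ "shift k 2"] bij_betw_byWitness[of _ "shift k 1"];
      auto simp: shift_inverse shift_inverse[simplified] shift_lt)+

text \<open>A cyclic shift of all periods only permutes the summands of \<open>cov\<close>. Shifting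
  by one period turns the pair (plot, left neighbour) into (right neighbour, plot), whence the
  equality of the two mixed terms. This is where the circularity of the design enters.\<close>

lemma cov_shift:
  fixes f :: "nat \<Rightarrow> real" and k :: nat
  defines "c i j \<equiv> cov k (\<lambda>r. f (shift k i r)) (\<lambda>r. f (shift k j r))"
  shows "c 1 1 = c 0 0" and "c 2 2 = c 0 0" and "c 0 2 = c 0 1"
proof -
  have id: "shift k 0 = (\<lambda>r. r)" by (simp add: shift_def fun_eq_iff)
  show "c 1 1 = c 0 0" "c 2 2 = c 0 0"
    unfolding c_def id using cov_reindex[OF shift_bij(1), where f = f and h = f] cov_reindex[OF shift_bij(2), where f = f and h = f] by auto
  have "c 0 1 = cov k (\<lambda>r. f (shift k 2 r)) (\<lambda>r. f (shift k 1 (shift k 2 r)))"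
    unfolding c_def id using cov_reindex[OF shift_bij(2), where f = f and h = "\<lambda>r. f (shift k 1 r)"] by simp
  also have "\<dots> = cov k (\<lambda>r. f (shift k 2 r)) f"
    by (rule cov_cong) (auto simp: shift_inverse simp del: One_nat_def)
  finally show "c 0 2 = c 0 1" unfolding c_def id by (simp add: cov_commute)
qed

definition comb :: "(nat \<Rightarrow> real) list \<Rightarrow> (nat \<Rightarrow> real) \<Rightarrow> nat \<Rightarrow> real" where
  "comb ws v i = (\<Sum>a<length ws. v a * (ws ! a) i)"

lemma cov_add_square: "cov k (\<lambda>j. f j + h j) (\<lambda>j. f j + h j) = cov k f f + 2 * cov k f h + cov k h h"
  by (simp add: cov_add_left cov_add_right cov_commute[of k h f])

text \<open>Two vectors occur: the effect of interest is evaluated at \<open>y\<close>, the nuisance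
  effects at \<open>x\<close>. The expression is still a weighted sum of values
  \<open>cov k f f\<close>, with \<open>f\<close> the sum of both lifts.\<close>

lemma cform_quadratic_nonneg:
  assumes "\<forall>s\<in>seqs k t. 0 \<le> p s"
  shows "0 \<le> cform k t p u y u y + 2 * cform k t p u y w x + cform k t p w x w x"
proof -
  have "cform k t p u y u y + 2 * cform k t p u y w x + cform k t p w x w x
      = (\<Sum>s\<in>seqs k t. p s * cov k (\<lambda>j. lift k u y s j + lift k w x s j) (\<lambda>j. lift k u y s j + lift k w x s j))"
    by (simp add: cform_def cov_add_square distrib_left sum.distrib sum_distrib_left mult_ac)
  also have "\<dots> \<ge> 0" using assms by (intro sum_nonneg mult_nonneg_nonneg cov_nonneg) auto
  finally show ?thesis .
qed

lemma cform_nonneg: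
  assumes "\<forall>s\<in>seqs k t. 0 \<le> p s"
  shows "0 \<le> cform k t p u y u y"
  unfolding cform_def using assms by (intro sum_nonneg mult_nonneg_nonneg cov_nonneg) auto

lemma cform_add_square:
  "cform k t p (\<lambda>i. u i + w i) x (\<lambda>i. u i + w i) x
    = cform k t p u x u x + 2 * cform k t p u x w x + cform k t p w x w x"
  by (simp add: cform_add_weights cform_commute[of k t p "\<lambda>i. u i + w i" x] cform_commute[of k t p w x u x])

text \<open>By \<open>cov_shift\<close> the Gram entries \<open>C i j\<close> take three values: on
  the diagonal, between a plot and either neighbour, and between the two neighbours.
  \<open>A2 \<le> A0\<close> is nonnegativity of the form at \<open>(0, 1, -1)\<close>.\<close>

lemma cform_vec3:
  assumes "\<forall>s\<in>seqs k t. 0 \<le> p s"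
  shows "\<exists>A0 A1 A2. A2 \<le> A0 \<and> (\<forall>a b c. cform k t p (vec3 a b c) x (vec3 a b c) x
      = A0 * (a\<^sup>2 + b\<^sup>2 + c\<^sup>2) + 2 * A1 * a * (b + c) + 2 * A2 * b * c)"
proof -
  define C where "C i j = (\<Sum>s\<in>seqs k t. p s * cov k (\<lambda>r. x (s ! shift k i r)) (\<lambda>r. x (s ! shift k j r)))" for i j
  have eq: "C 1 1 = C 0 0" "C 2 2 = C 0 0" "C 0 2 = C 0 1"
    unfolding C_def using cov_shift[of k "\<lambda>r. x (_ ! r)"] by simp_all
  have comm: "C i j = C j i" for i j unfolding C_def by (simp add: cov_commute)
  have q: "cform k t p w x w x = (\<Sum>i\<le>2. \<Sum>j\<le>2. w i * w j * C i j)" for w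
  proof -
    have "cform k t p w x w x = (\<Sum>s\<in>seqs k t. \<Sum>i\<le>2. \<Sum>j\<le>2. w i * w j * (p s *
        cov k (\<lambda>r. x (s ! shift k i r)) (\<lambda>r. x (s ! shift k j r))))"
      by (simp add: cform_def cov_lift sum_distrib_left mult_ac)
    also have "\<dots> = (\<Sum>i\<le>2. \<Sum>s\<in>seqs k t. \<Sum>j\<le>2. w i * w j * (p s *
        cov k (\<lambda>r. x (s ! shift k i r)) (\<lambda>r. x (s ! shift k j r))))"
      by (rule sum.swap)
    also have "\<dots> = (\<Sum>i\<le>2. \<Sum>j\<le>2. \<Sum>s\<in>seqs k t. w i * w j * (p s *
        cov k (\<lambda>r. x (s ! shift k i r)) (\<lambda>r. x (s ! shift k j r))))"
      by (intro sum.cong refl sum.swap)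
    finally show ?thesis by (simp add: C_def sum_distrib_left)
  qed
  have v: "cform k t p (vec3 a b c) x (vec3 a b c) x
      = C 0 0 * (a\<^sup>2 + b\<^sup>2 + c\<^sup>2) + 2 * C 0 1 * a * (b + c) + 2 * C 1 2 * b * c" for a b c
    unfolding q using eq comm[of 1 0] comm[of 2 0] comm[of 2 1]
    by (simp add: numeral_2_eq_2 vec3_def algebra_simps power2_eq_square)
  have "0 \<le> cform k t p (vec3 0 1 (-1)) x (vec3 0 1 (-1)) x" using assms by (rule cform_nonneg)
  then have "C 1 2 \<le> C 0 0" unfolding v by simp
  then show ?thesis using v by blast
qed

context circular_design
begin

text \<open>The subtracted term \<open>F' G^+ F\<close> is what minimization over the nuisance
  coefficients \<open>v\<close> gains, by \<open>quadratic_minimum\<close> with the cross terms as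
  linear part. A general \<open>y\<close> is kept because semidefiniteness and the comparison with
  \<open>C[u,u]\<close> concern all directions, not only \<open>x\<close>.\<close>

lemma Info_minimum:
  assumes p: "\<forall>s\<in>seqs k t. 0 \<le> p s"
  shows "vec t y \<bullet> (Info k t S p u ws (vec t x) *\<^sub>v vec t y)
      \<le> cform k t p u y u y + 2 * cform k t p u y (comb ws v) x + cform k t p (comb ws v) x (comb ws v) x"
    and "\<exists>v. vec t y \<bullet> (Info k t S p u ws (vec t x) *\<^sub>v vec t y)
      = cform k t p u y u y + 2 * cform k t p u y (comb ws v) x + cform k t p (comb ws v) x (comb ws v) x"
proof -
  let ?m = "length ws" and ?f = "cross p u ws x y" and ?G = "Gram p ws x"
  have f: "?f \<in> carrier_vec ?m" by (simp add: cross_def)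
  have comb: "comb ws v = (\<lambda>i. \<Sum>a<?m. v a * (ws ! a) i)" for v by (simp add: comb_def fun_eq_iff)
  have form: "cform k t p u y u y + 2 * (v \<bullet> ?f) + v \<bullet> (?G *\<^sub>v v)
      = cform k t p u y u y + 2 * cform k t p u y (comb ws (($) v)) x
        + cform k t p (comb ws (($) v)) x (comb ws (($) v)) x" if v: "v \<in> carrier_vec ?m" for v
  proof -
    have "v \<bullet> ?f = cform k t p u y (comb ws (($) v)) x"
      using v by (simp add: comb cform_sum_weights scalar_prod_def cross_def lessThan_atLeast0)
    moreover have "(?G *\<^sub>v v) $ a = cform k t p (ws ! a) x (comb ws (($) v)) x" if "a < ?m" for a
      using that v by (simp add: comb cform_sum_weights scalar_prod_def Gram_def lessThan_atLeast0 mult_ac)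
    then have "v \<bullet> (?G *\<^sub>v v) = (\<Sum>a<?m. v $ a * cform k t p (ws ! a) x (comb ws (($) v)) x)"
      using v Gram_symmetric(1)[of p ws x]
      by (simp add: scalar_prod_def[of v] lessThan_atLeast0 del: index_mult_mat_vec)
    then have "v \<bullet> (?G *\<^sub>v v) = (\<Sum>a<?m. v $ a * cform k t p (comb ws (($) v)) x (ws ! a) x)"
      by (simp only: cform_commute[of k t p "comb ws (($) v)" x])
    then have "v \<bullet> (?G *\<^sub>v v) = cform k t p (comb ws (($) v)) x (comb ws (($) v)) x"
      unfolding comb[of "($) v"] cform_sum_weights[of k t p _ x] .
    ultimately show ?thesis by simp
  qed
  have nonneg: "0 \<le> cform k t p u y u y + 2 * (v \<bullet> ?f) + v \<bullet> (?G *\<^sub>v v)" if "v \<in> carrier_vec ?m" for v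
    unfolding form[OF that] using p by (rule cform_quadratic_nonneg)
  note qm = quadratic_minimum[OF Gram_symmetric f nonneg, folded Info_bilinear]
  have "comb ws (($) (vec ?m v)) = comb ws v" by (simp add: comb_def fun_eq_iff)
  then show "vec t y \<bullet> (Info k t S p u ws (vec t x) *\<^sub>v vec t y)
      \<le> cform k t p u y u y + 2 * cform k t p u y (comb ws v) x + cform k t p (comb ws v) x (comb ws v) x"
    using qm(1)[of "vec ?m v"] form[of "vec ?m v"] by simp
  show "\<exists>v. vec t y \<bullet> (Info k t S p u ws (vec t x) *\<^sub>v vec t y)
      = cform k t p u y u y + 2 * cform k t p u y (comb ws v) x + cform k t p (comb ws v) x (comb ws v) x"
    using qm(2) form by metis
qed

abbreviation qInfo :: "(nat list \<Rightarrow> real) \<Rightarrow> (nat \<Rightarrow> real) \<Rightarrow> (nat \<Rightarrow> real) list \<Rightarrow> (nat \<Rightarrow> real) \<Rightarrow> real" where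
  "qInfo p u ws x \<equiv> vec t x \<bullet> (Info k t S p u ws (vec t x) *\<^sub>v vec t x)"

lemma qInfo_minimum:
  assumes p: "\<forall>s\<in>seqs k t. 0 \<le> p s"
  shows "qInfo p u ws x \<le> cform k t p (\<lambda>i. u i + comb ws v i) x (\<lambda>i. u i + comb ws v i) x"
    and "\<exists>v. qInfo p u ws x = cform k t p (\<lambda>i. u i + comb ws v i) x (\<lambda>i. u i + comb ws v i) x"
  using Info_minimum[OF p, where y = x] by (simp_all add: cform_add_square)

lemma Info_nonneg:
  assumes p: "\<forall>s\<in>seqs k t. 0 \<le> p s" and y: "y \<in> carrier_vec t"
  shows "0 \<le> y \<bullet> (Info k t S p u ws (vec t x) *\<^sub>v y)"
proof -
  have "vec t (($) y) = y" using y by auto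
  moreover obtain v where "vec t (($) y) \<bullet> (Info k t S p u ws (vec t x) *\<^sub>v vec t (($) y))
      = cform k t p u (($) y) u (($) y) + 2 * cform k t p u (($) y) (comb ws v) x + cform k t p (comb ws v) x (comb ws v) x"
    using Info_minimum(2)[OF p] by blast
  ultimately show ?thesis using cform_quadratic_nonneg[OF p] by simp
qed

lemma Info_le_Cuw:
  assumes p: "\<forall>s\<in>seqs k t. 0 \<le> p s"
  shows "vec t y \<bullet> (Info k t S p u ws (vec t x) *\<^sub>v vec t y) \<le> cform k t p u y u y"
proof -
  \<comment> \<open>The zero weight is written as an empty sum to make
    \<open>cform_sum_weights\<close> applicable.\<close>
  have z: "comb ws (\<lambda>_. 0) = (\<lambda>i. \<Sum>a\<in>({}::nat set). 0 * u i)" by (simp add: comb_def fun_eq_iff)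
  have "cform k t p w y (comb ws (\<lambda>_. 0)) x = 0" for w y unfolding z cform_sum_weights by simp
  then show ?thesis using Info_minimum(1)[OF p, where y = y and u = u and ws = ws and x = x and v = "\<lambda>_. 0"] by simp
qed

end

section \<open>Symmetrization over treatment labels\<close>

text \<open>Transpositions act doubly transitively on the labels: \<open>a\<close> is moved to 0,
  then the image \<open>b'\<close> of \<open>b\<close> to 1. The second transposition fixes 0
  because \<open>b' \<noteq> 0\<close>.\<close>

lemma two_valued:
  fixes E :: "nat \<Rightarrow> nat \<Rightarrow> real"
  assumes t: "2 \<le> t"
    and swap: "\<And>c d a b. c < t \<Longrightarrow> d < t \<Longrightarrow> E (Transposition.transpose c d a) (Transposition.transpose c d b) = E a b"
    and ab: "a < t" "b < t"
  shows "E a b = (if a = b then E 0 0 else E 0 1)"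
proof (cases "a = b")
  case True
  then show ?thesis using swap[of a 0 a a] ab t by simp
next
  case False
  define b' where "b' = Transposition.transpose a 0 b"
  have b': "b' < t" "b' \<noteq> 0" using ab t False by (auto simp: b'_def Transposition.transpose_def)
  have "E a b = E 0 b'" using swap[of a 0 a b] ab t by (simp add: b'_def)
  also have "\<dots> = E (Transposition.transpose b' 1 0) (Transposition.transpose b' 1 b')" using swap[of b' 1 0 b'] b' t by simp
  also have "\<dots> = E 0 1" using b' by (simp add: Transposition.transpose_def)
  finally show ?thesis using False by simp
qed

text \<open>The weights are the squared cosines between \<open>x\<close> and the eigenvectors; they
  add up to 1 because \<open>x\<close> lies in the sum-zero space. This brings a matrix into the
  form required by \<open>supported\<close>.\<close>

lemma rayleigh_weights:
  fixes M :: "real mat" and x :: "nat \<Rightarrow> real"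
  assumes M: "M \<in> carrier_mat (Suc n) (Suc n)" "transpose_mat M = M" "M *\<^sub>v vec (Suc n) (\<lambda>_. 1) = 0\<^sub>v (Suc n)"
    and psd: "\<And>y. y \<in> carrier_vec (Suc n) \<Longrightarrow> y \<bullet> (M *\<^sub>v y) \<ge> 0"
    and x: "(\<Sum>a<Suc n. x a) = 0" and N: "(\<Sum>a<Suc n. (x a)\<^sup>2) = N" "N > 0"
  shows "\<exists>z. (\<forall>i<n. 0 \<le> eigs M ! Suc i \<and> 0 \<le> z i)
    \<and> (\<forall>i j. i \<le> j \<longrightarrow> j < n \<longrightarrow> eigs M ! Suc i \<le> eigs M ! Suc j) \<and> (\<Sum>i<n. z i) = 1
    \<and> (\<Sum>a<Suc n. M $$ (a,a)) = (\<Sum>i<n. eigs M ! Suc i)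
    \<and> vec (Suc n) x \<bullet> (M *\<^sub>v vec (Suc n) x) / N = (\<Sum>i<n. eigs M ! Suc i * z i)"
proof -
  show ?thesis
  proof (rule sum_zero_spectrum[OF M psd])
    fix d e
    assume eigs: "eigs M = 0 # map d [0..<n]"
      and d: "\<And>i. i < n \<Longrightarrow> 0 \<le> d i" "\<And>i j. i \<le> j \<Longrightarrow> j < n \<Longrightarrow> d i \<le> d j"
      and e: "\<And>i. i < n \<Longrightarrow> e i \<in> carrier_vec (Suc n)"
        "\<And>i. i < n \<Longrightarrow> vec (Suc n) (\<lambda>_. 1) \<bullet> e i = 0"
        "\<And>i. i < n \<Longrightarrow> M *\<^sub>v e i = d i \<cdot>\<^sub>v e i"
      and orth: "\<And>i j. i < n \<Longrightarrow> j < n \<Longrightarrow> e i \<bullet> e j = (if i = j then 1 else 0)"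
      and tr: "(\<Sum>a<Suc n. M $$ (a,a)) = (\<Sum>i<n. d i)"
      and quad: "\<And>y. y \<in> carrier_vec (Suc n) \<Longrightarrow> vec (Suc n) (\<lambda>_. 1) \<bullet> y = 0 \<Longrightarrow> y \<bullet> y = (\<Sum>i<n. (e i \<bullet> y)\<^sup>2)"
        "\<And>y. y \<in> carrier_vec (Suc n) \<Longrightarrow> vec (Suc n) (\<lambda>_. 1) \<bullet> y = 0 \<Longrightarrow>
          y \<bullet> (M *\<^sub>v y) = (\<Sum>i<n. d i * (e i \<bullet> y)\<^sup>2)"
    let ?x = "vec (Suc n) x"
    have "vec (Suc n) (\<lambda>_. 1) \<bullet> ?x = 0" using x by (simp add: scalar_prod_def lessThan_atLeast0)
    then have q: "?x \<bullet> ?x = (\<Sum>i<n. (e i \<bullet> ?x)\<^sup>2)" "?x \<bullet> (M *\<^sub>v ?x) = (\<Sum>i<n. d i * (e i \<bullet> ?x)\<^sup>2)"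
      using quad[of ?x] by auto
    have xx: "?x \<bullet> ?x = N" using N(1) by (simp add: scalar_prod_def lessThan_atLeast0 power2_eq_square)
    have nth: "eigs M ! Suc i = d i" if "i < n" for i using that by (simp add: eigs)
    show ?thesis
      using d tr q xx N nth
      by (intro exI[of _ "\<lambda>i. (e i \<bullet> ?x)\<^sup>2 / N"]) (auto simp: sum_divide_distrib[symmetric])
  qed
qed

text \<open>Relabelling the sequences in the argument of the measure amounts to the inverse
  relabelling of the vectors, because the forms see a label \<open>c\<close> only through
  \<open>x c\<close> and \<open>y c\<close>.\<close>

lemma cform_permute:
  assumes q: "\<pi> permutes {..<t}"
  shows "(\<Sum>s\<in>seqs k t. p (map \<pi> s) * cov k (lift k u x s) (lift k w y s))
    = cform k t p u (\<lambda>a. x (inv_into UNIV \<pi> a)) w (\<lambda>a. y (inv_into UNIV \<pi> a))"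
proof -
  have bij: "bij_betw (map \<pi>) (seqs k t) (seqs k t)"
  proof (rule bij_betw_byWitness[of _ "map (inv_into UNIV \<pi>)"])
    have map_in: "map \<sigma> s \<in> seqs k t" if "\<sigma> permutes {..<t}" "s \<in> seqs k t" for \<sigma> s
      using that permutes_in_image[OF that(1)] by (auto simp: seqs_def)
    show "map \<pi> ` seqs k t \<subseteq> seqs k t" "map (inv_into UNIV \<pi>) ` seqs k t \<subseteq> seqs k t"
      using map_in q permutes_inv[OF q] by auto
  qed (use permutes_inverses[OF q] in \<open>auto simp: comp_def\<close>)
  have lift: "lift k u x s j = lift k u (\<lambda>a. x (inv_into UNIV \<pi> a)) (map \<pi> s) j" if "s \<in> seqs k t" "j < k" for u x s j
    using that shift_lt[OF that(2)] permutes_inverses[OF q] by (simp add: lift_def seqs_def)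
  have "(\<Sum>s\<in>seqs k t. p (map \<pi> s) * cov k (lift k u x s) (lift k w y s))
    = (\<Sum>s\<in>seqs k t. p (map \<pi> s) * cov k (lift k u (\<lambda>a. x (inv_into UNIV \<pi> a)) (map \<pi> s)) (lift k w (\<lambda>a. y (inv_into UNIV \<pi> a)) (map \<pi> s)))"
    by (intro sum.cong refl arg_cong2[of _ _ _ _ "(*)"] cov_cong) (auto simp: lift)
  then show ?thesis unfolding cform_def
    using sum.reindex_bij_betw[OF bij, of "\<lambda>s. p s * cov k (lift k u (\<lambda>a. x (inv_into UNIV \<pi> a)) s) (lift k w (\<lambda>a. y (inv_into UNIV \<pi> a)) s)"]
    by simp
qed

definition symmetrize :: "nat \<Rightarrow> (nat list \<Rightarrow> real) \<Rightarrow> nat list \<Rightarrow> real" where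
  "symmetrize t q s = (\<Sum>\<pi> | \<pi> permutes {..<t}. q (map \<pi> s)) / fact t"

lemma cform_symmetrize:
  "cform k t (symmetrize t q) u x w y
    = (\<Sum>\<pi> | \<pi> permutes {..<t}. cform k t q u (\<lambda>a. x (\<pi> a)) w (\<lambda>a. y (\<pi> a))) / fact t"
proof -
  let ?P = "{\<pi>. \<pi> permutes {..<t}}"
  have "cform k t (symmetrize t q) u x w y
      = (\<Sum>s\<in>seqs k t. \<Sum>\<pi>\<in>?P. q (map \<pi> s) * cov k (lift k u x s) (lift k w y s)) / fact t"
    by (simp add: cform_def symmetrize_def sum_distrib_right sum_divide_distrib)
  also have "(\<Sum>s\<in>seqs k t. \<Sum>\<pi>\<in>?P. q (map \<pi> s) * cov k (lift k u x s) (lift k w y s))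
      = (\<Sum>\<pi>\<in>?P. cform k t q u (\<lambda>a. x (inv_into UNIV \<pi> a)) w (\<lambda>a. y (inv_into UNIV \<pi> a)))"
    by (subst sum.swap) (simp add: cform_permute)
  also have "\<dots> = (\<Sum>\<pi>\<in>?P. cform k t q u (\<lambda>a. x (\<pi> a)) w (\<lambda>a. y (\<pi> a)))"
    by (rule sum.reindex_bij_witness[of _ "inv_into UNIV" "inv_into UNIV"]) (auto simp: permutes_inv permutes_inv_inv)
  finally show ?thesis .
qed

lemma symmetrize_in_meas_set:
  assumes "q \<in> meas_set k t"
  shows "symmetrize t q \<in> meas_set k t"
proof -
  let ?P = "{\<pi>. \<pi> permutes {..<t}}"
  have map_in: "map \<pi> s \<in> seqs k t" if "\<pi> permutes {..<t}" "s \<in> seqs k t" for \<pi> s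
    using that permutes_in_image[OF that(1)] by (auto simp: seqs_def)
  have "(\<Sum>s\<in>seqs k t. q (map \<pi> s)) = (\<Sum>s\<in>seqs k t. q s)" if q: "\<pi> permutes {..<t}" for \<pi>
    by (rule sum.reindex_bij_witness[of _ "map (inv_into UNIV \<pi>)" "map \<pi>"])
      (auto simp: map_in q permutes_inv permutes_inverses[OF q] comp_def)
  then have "(\<Sum>\<pi>\<in>?P. \<Sum>s\<in>seqs k t. q (map \<pi> s)) = fact t"
    using assms by (simp add: meas_set_def card_permutations[of "{..<t}" t])
  then have "(\<Sum>s\<in>seqs k t. symmetrize t q s) = 1"
    by (subst (asm) sum.swap) (simp add: symmetrize_def sum_divide_distrib[symmetric])
  moreover have "0 \<le> symmetrize t q s" if "s \<in> seqs k t" for s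
    using assms map_in that by (auto simp: symmetrize_def meas_set_def intro!: sum_nonneg divide_nonneg_nonneg)
  ultimately show ?thesis by (simp add: meas_set_def)
qed

text \<open>A matrix \<open>a I + b J\<close> that annihilates constants has trace
  \<open>a (t - 1)\<close>; for a pseudo symmetric measure this is therefore the eigenvalue of
  \<open>C[u,w]\<close> on the sum-zero vectors. For other measures it is just a normalized
  trace.\<close>

definition ctr :: "nat \<Rightarrow> nat \<Rightarrow> (nat list \<Rightarrow> real) \<Rightarrow> (nat \<Rightarrow> real) \<Rightarrow> (nat \<Rightarrow> real) \<Rightarrow> real" where
  "ctr k t p u w = (\<Sum>a<t. cform k t p u (ind a) w (ind a)) / real (t - 1)"

lemma ind_permute: "\<pi> permutes {..<t} \<Longrightarrow> (\<lambda>c. ind a (\<pi> c)) = ind (inv_into UNIV \<pi> a)"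
  by (auto simp: ind_def fun_eq_iff permutes_inverses permutes_inv_eq)

text \<open>A trace is unaffected by relabelling. The eigenvalues \<open>\<alpha>\<close> and
  \<open>\<beta>\<close> of a symmetrized measure can therefore be computed from the original
  one.\<close>

lemma ctr_symmetrize: "ctr k t (symmetrize t q) u w = ctr k t q u w"
proof -
  let ?P = "{\<pi>. \<pi> permutes {..<t}}"
  have perm: "(\<Sum>a<t. cform k t q u (ind (inv_into UNIV \<pi> a)) w (ind (inv_into UNIV \<pi> a))) = (\<Sum>a<t. cform k t q u (ind a) w (ind a))"
    if "\<pi> permutes {..<t}" for \<pi>
    using sum.permute[OF permutes_inv[OF that], of "\<lambda>a. cform k t q u (ind a) w (ind a)"] by (simp add: comp_def)
  have "(\<Sum>a<t. cform k t (symmetrize t q) u (ind a) w (ind a))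
      = (\<Sum>a<t. \<Sum>\<pi>\<in>?P. cform k t q u (ind (inv_into UNIV \<pi> a)) w (ind (inv_into UNIV \<pi> a))) / fact t"
    by (simp add: cform_symmetrize ind_permute sum_divide_distrib)
  also have "\<dots> = (\<Sum>\<pi>\<in>?P. \<Sum>a<t. cform k t q u (ind a) w (ind a)) / fact t"
    by (subst sum.swap) (simp add: perm)
  also have "\<dots> = (\<Sum>a<t. cform k t q u (ind a) w (ind a))"
    by (simp add: card_permutations[of "{..<t}" t])
  finally show ?thesis by (simp add: ctr_def)
qed

lemma cform_symmetrize_invariant:
  assumes s: "\<sigma> permutes {..<t}"
  shows "cform k t (symmetrize t q) u (\<lambda>a. x (\<sigma> a)) w (\<lambda>a. y (\<sigma> a)) = cform k t (symmetrize t q) u x w y"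
proof -
  let ?P = "{\<pi>. \<pi> permutes {..<t}}"
  have "(\<Sum>\<pi>\<in>?P. cform k t q u (\<lambda>a. x (\<sigma> (\<pi> a))) w (\<lambda>a. y (\<sigma> (\<pi> a))))
      = (\<Sum>\<pi>\<in>?P. cform k t q u (\<lambda>a. x (\<pi> a)) w (\<lambda>a. y (\<pi> a)))"
    by (rule sum.reindex_bij_witness[of _ "\<lambda>\<pi>. inv_into UNIV \<sigma> \<circ> \<pi>" "\<lambda>\<pi>. \<sigma> \<circ> \<pi>"])
      (auto simp: permutes_compose s permutes_inv permutes_inverses[OF s] fun_eq_iff)
  then show ?thesis by (simp add: cform_symmetrize)
qed

context circular_design
begin

lemma Cxi_eq_cform:
  assumes "a < t" "b < t" "i \<le> 2" "j \<le> 2"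
  shows "Cxi k t S p i j $$ (a,b) = cform k t p (ind i) (ind a) (ind j) (ind b)"
proof -
  have "lift k (ind i) x s = (\<lambda>r. x (s ! shift k i r))" if "i \<le> 2" for i x s
    using that by (simp add: lift_def ind_def fun_eq_iff if_distrib[of "\<lambda>c. c * _"] cong: if_cong)
  then show ?thesis using assms by (simp add: Cxi_entry[OF B] cform_def)
qed

lemma symmetrize_pseudo_symmetric: "pseudo_symmetric k t S (symmetrize t q)"
  unfolding pseudo_symmetric_def
proof (intro allI impI)
  fix i j :: nat assume ij: "i \<le> 2" "j \<le> 2"
  let ?r = "symmetrize t q"
  define E where "E a b = cform k t ?r (ind i) (ind a) (ind j) (ind b)" for a b
  have swap: "E (Transposition.transpose c d a) (Transposition.transpose c d b) = E a b" if "c < t" "d < t" for c d a b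
  proof -
    have p: "Transposition.transpose c d permutes {..<t}" using that by (intro permutes_swap_id) auto
    show ?thesis
      unfolding E_def using cform_symmetrize_invariant[OF p, of k q "ind i" "ind a" "ind j" "ind b"]
      by (simp add: ind_permute[OF p] inv_transpose_eq)
  qed
  note entries = two_valued[OF t, of E, OF swap]
  have "Cxi k t S ?r i j = (E 0 0 - E 0 1) \<cdot>\<^sub>m 1\<^sub>m t + E 0 1 \<cdot>\<^sub>m ones_mat t"
  proof (rule eq_matI)
    fix a b assume "a < dim_row ((E 0 0 - E 0 1) \<cdot>\<^sub>m 1\<^sub>m t + E 0 1 \<cdot>\<^sub>m ones_mat t)"
      "b < dim_col ((E 0 0 - E 0 1) \<cdot>\<^sub>m 1\<^sub>m t + E 0 1 \<cdot>\<^sub>m ones_mat t)"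
    then have ab: "a < t" "b < t" by (auto simp: ones_mat_def)
    show "Cxi k t S ?r i j $$ (a,b) = ((E 0 0 - E 0 1) \<cdot>\<^sub>m 1\<^sub>m t + E 0 1 \<cdot>\<^sub>m ones_mat t) $$ (a,b)"
      using ab entries[of a b] by (simp add: Cxi_eq_cform ij E_def[symmetric] ones_mat_def)
  qed (auto simp: Cxi_def ones_mat_def)
  then show "completely_symmetric t (Cxi k t S ?r i j)" unfolding completely_symmetric_def by blast
qed

text \<open>On sum-zero vectors the part \<open>b J\<close> vanishes. The remaining coefficient is
  identified with \<open>ctr\<close> through the trace, using that constants lie in the
  kernel.\<close>

lemma pseudo_symmetric_cform:
  assumes p: "pseudo_symmetric k t S p" and y: "(\<Sum>a<t. y a) = 0"
  shows "cform k t p u y w z = ctr k t p u w * (\<Sum>a<t. y a * z a)"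
proof -
  have "\<forall>i j. \<exists>a b. i \<le> 2 \<longrightarrow> j \<le> 2 \<longrightarrow> Cxi k t S p i j = a \<cdot>\<^sub>m 1\<^sub>m t + b \<cdot>\<^sub>m ones_mat t"
    using p unfolding pseudo_symmetric_def completely_symmetric_def by blast
  then obtain A B' where AB: "\<And>i j. i \<le> 2 \<Longrightarrow> j \<le> 2 \<Longrightarrow> Cxi k t S p i j = A i j \<cdot>\<^sub>m 1\<^sub>m t + B' i j \<cdot>\<^sub>m ones_mat t"
    by metis
  define \<alpha> where "\<alpha> = (\<Sum>i\<le>2. \<Sum>j\<le>2. u i * w j * A i j)"
  define \<beta> where "\<beta> = (\<Sum>i\<le>2. \<Sum>j\<le>2. u i * w j * B' i j)"
  have entry: "cform k t p u (ind a) w (ind b) = (if a = b then \<alpha> else 0) + \<beta>" if ab: "a < t" "b < t" for a b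
  proof -
    have "cform k t p u (ind a) w (ind b) = (\<Sum>i\<le>2. \<Sum>j\<le>2. u i * w j * ((if a = b then A i j else 0) + B' i j))"
      unfolding Cuw_entry[OF B ab, of p u w, symmetric] using ab
      by (simp add: Cuw_def AB ones_mat_def)
    then show ?thesis by (simp add: \<alpha>_def \<beta>_def distrib_left sum.distrib)
  qed
  have form: "cform k t p u y w z = \<alpha> * (\<Sum>a<t. y a * z a) + \<beta> * (\<Sum>a<t. y a) * (\<Sum>a<t. z a)" for y z
  proof -
    have "cform k t p u (ind a) w z = \<alpha> * z a + \<beta> * (\<Sum>b<t. z b)" if "a < t" for a
    proof -
      have "cform k t p u (ind a) w z = (\<Sum>b<t. (if b = a then \<alpha> * z b else 0) + \<beta> * z b)"
        unfolding cform_expand[of k t p u "ind a" w z] using that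
        by (intro sum.cong refl) (auto simp: entry algebra_simps)
      then show ?thesis using that by (simp add: sum.distrib sum_distrib_left)
    qed
    then have "cform k t p u y w z = (\<Sum>a<t. \<alpha> * (y a * z a) + y a * (\<beta> * (\<Sum>b<t. z b)))"
      unfolding cform_expand_left[of p u y] by (intro sum.cong refl) (simp add: algebra_simps)
    also have "\<dots> = \<alpha> * (\<Sum>a<t. y a * z a) + (\<Sum>a<t. y a) * (\<beta> * (\<Sum>b<t. z b))"
      by (simp add: sum.distrib sum_distrib_left[symmetric] sum_distrib_right[symmetric])
    finally show ?thesis by (simp add: mult_ac)
  qed
  have "\<alpha> * real t + \<beta> * real t * real t = 0" using form[of "\<lambda>_. 1" "\<lambda>_. 1"] by (simp add: cform_const)
  then have "real t * (\<alpha> + \<beta> * real t) = 0" by (simp add: algebra_simps)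
  then have "\<beta> * real t = - \<alpha>" using t by simp
  then have "(\<Sum>a<t. cform k t p u (ind a) w (ind a)) = \<alpha> * real (t - 1)"
    using t by (simp add: entry of_nat_diff algebra_simps)
  then have "ctr k t p u w = \<alpha>" using t by (simp add: ctr_def)
  then show ?thesis using form[of y z] y by simp
qed

lemma Cuw_symmetric_zero_sums:
  shows "transpose_mat (Cuw k t S p u u) = Cuw k t S p u u" and "Cuw k t S p u u *\<^sub>v vec t (\<lambda>_. 1) = 0\<^sub>v t"
proof -
  show "transpose_mat (Cuw k t S p u u) = Cuw k t S p u u"
  proof (rule eq_matI)
    fix a b assume "a < dim_row (Cuw k t S p u u)" "b < dim_col (Cuw k t S p u u)"
    then have ab: "a < t" "b < t" by (auto simp: Cuw_def)
    then show "transpose_mat (Cuw k t S p u u) $$ (a,b) = Cuw k t S p u u $$ (a,b)"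
      using Cuw_carrier[of p u u] by (simp add: Cuw_entry[OF B]) (rule cform_commute)
  qed (auto simp: Cuw_def)
  show "Cuw k t S p u u *\<^sub>v vec t (\<lambda>_. 1) = 0\<^sub>v t"
    by (rule eq_vecI)
      (use Cuw_carrier[of p u u] in \<open>auto simp: Cuw_mult_vec cform_const simp del: index_mult_mat_vec\<close>)
qed

text \<open>The difference \<open>D\<close> of \<open>C[u,u]\<close> and the information matrix is
  positive semidefinite, so its Rayleigh quotient at \<open>x\<close> is at most its trace.
  Rearranged: the trace of the information matrix without its share at \<open>x\<close> is at most
  the same quantity for \<open>C[u,u]\<close>, whose expectation can be computed. As
  \<open>c1 \<ge> 0\<close>, it may replace that quantity in the bound.\<close>

lemma Info_criterion_bound:
  assumes p: "\<forall>s\<in>seqs k t. 0 \<le> p s" and x: "(\<Sum>a<t. x a) = 0" and N: "(\<Sum>a<t. (x a)\<^sup>2) = N" "N > 0"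
    and c: "0 \<le> c1" "0 \<le> c2"
    and f: "\<forall>d z. (\<forall>i<t-1. 0 \<le> d i \<and> 0 \<le> z i) \<longrightarrow> (\<forall>i j. i \<le> j \<longrightarrow> j < t-1 \<longrightarrow> d i \<le> d j) \<longrightarrow> (\<Sum>i<t-1. z i) = 1 \<longrightarrow>
        f d \<le> c1 * (\<Sum>i<t-1. d i * (1 - z i)) + c2 * (\<Sum>i<t-1. d i * z i)"
  shows "f (\<lambda>i. eigs (Info k t S p u ws (vec t x)) ! Suc i)
    \<le> c1 * ((\<Sum>a<t. cform k t p u (ind a) u (ind a)) - cform k t p u x u x / N) + c2 * (qInfo p u ws x / N)"
proof -
  let ?I = "Info k t S p u ws (vec t x)" and ?C = "Cuw k t S p u u"
  obtain n where n: "t = Suc n" using t by (cases t) auto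
  note I = Info_carrier[of p u ws x] and C = Cuw_carrier[of p u u]
  define D where "D = ?C - ?I"
  have D: "D \<in> carrier_mat t t" unfolding D_def using I by (rule minus_carrier_mat)
  have "transpose_mat D = D"
    using Cuw_symmetric_zero_sums(1)[of p u] Info_symmetric[of p u ws x] C I transpose_minus[OF C I] by (simp add: D_def)
  moreover have "D *\<^sub>v vec t (\<lambda>_. 1) = 0\<^sub>v t"
    unfolding D_def minus_mult_distrib_mat_vec[OF C I vec_carrier] Cuw_symmetric_zero_sums Info_ones by simp
  moreover have Dq: "vec t y \<bullet> (D *\<^sub>v vec t y) = cform k t p u y u y - vec t y \<bullet> (?I *\<^sub>v vec t y)" for y
  proof -
    have "vec t y \<bullet> (?C *\<^sub>v vec t y - ?I *\<^sub>v vec t y) = vec t y \<bullet> (?C *\<^sub>v vec t y) - vec t y \<bullet> (?I *\<^sub>v vec t y)"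
      by (rule scalar_prod_minus_distrib) (use C I in \<open>auto intro!: mult_mat_vec_carrier\<close>)
    then show ?thesis unfolding D_def minus_mult_distrib_mat_vec[OF C I vec_carrier] Cuw_bilinear .
  qed
  moreover have "0 \<le> y \<bullet> (D *\<^sub>v y)" if "y \<in> carrier_vec t" for y
  proof -
    have "vec t (($) y) = y" using that by auto
    then show ?thesis using Dq[of "($) y"] Info_le_Cuw[OF p, of "($) y" u ws x] by simp
  qed
  ultimately obtain \<zeta> where \<zeta>: "\<forall>i<n. 0 \<le> eigs D ! Suc i \<and> 0 \<le> \<zeta> i" "(\<Sum>i<n. \<zeta> i) = 1"
    "(\<Sum>a<t. D $$ (a,a)) = (\<Sum>i<n. eigs D ! Suc i)"
    "vec t x \<bullet> (D *\<^sub>v vec t x) / N = (\<Sum>i<n. eigs D ! Suc i * \<zeta> i)"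
    using rayleigh_weights[of D n x N] D x N unfolding n by blast
  have "\<zeta> i \<le> 1" if "i < n" for i
    using member_le_sum[of i "{..<n}" \<zeta>] \<zeta>(1,2) that by auto
  then have "(\<Sum>i<n. eigs D ! Suc i * \<zeta> i) \<le> (\<Sum>i<n. eigs D ! Suc i)"
    using \<zeta>(1) by (intro sum_mono mult_left_le) auto
  then have D_trace: "(cform k t p u x u x - qInfo p u ws x) / N \<le> (\<Sum>a<t. D $$ (a,a))"
    using \<zeta>(3,4) Dq[of x] by simp
  have "(\<Sum>a<t. D $$ (a,a)) = (\<Sum>a<t. cform k t p u (ind a) u (ind a)) - (\<Sum>a<t. ?I $$ (a,a))"
    using C I by (simp add: D_def Cuw_entry[OF B] sum_subtractf)
  with D_trace have tr: "(\<Sum>a<t. ?I $$ (a,a)) - qInfo p u ws x / N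
      \<le> (\<Sum>a<t. cform k t p u (ind a) u (ind a)) - cform k t p u x u x / N"
    by (simp add: diff_divide_distrib)
  obtain z where z: "\<forall>i<n. 0 \<le> eigs ?I ! Suc i \<and> 0 \<le> z i"
    "\<forall>i j. i \<le> j \<longrightarrow> j < n \<longrightarrow> eigs ?I ! Suc i \<le> eigs ?I ! Suc j" "(\<Sum>i<n. z i) = 1"
    "(\<Sum>a<t. ?I $$ (a,a)) = (\<Sum>i<n. eigs ?I ! Suc i)"
    "qInfo p u ws x / N = (\<Sum>i<n. eigs ?I ! Suc i * z i)"
    using rayleigh_weights[of ?I n x N] I Info_symmetric[of p u ws x] Info_ones[of p u ws x]
      Info_nonneg[OF p, of _ u ws x] x N unfolding n by blast
  have "f (\<lambda>i. eigs ?I ! Suc i) \<le> c1 * (\<Sum>i<n. eigs ?I ! Suc i * (1 - z i)) + c2 * (\<Sum>i<n. eigs ?I ! Suc i * z i)"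
    using f[rule_format, of "\<lambda>i. eigs ?I ! Suc i" z] z(1,2,3) by (simp add: n)
  also have "(\<Sum>i<n. eigs ?I ! Suc i * (1 - z i)) = (\<Sum>a<t. ?I $$ (a,a)) - qInfo p u ws x / N"
    using z(4,5) by (simp add: right_diff_distrib sum_subtractf)
  also have "(\<Sum>i<n. eigs ?I ! Suc i * z i) = qInfo p u ws x / N" using z(5) by simp
  finally show ?thesis using mult_left_mono[OF tr c(1)] by linarith
qed

text \<open>By pseudo symmetry every form of two sum-zero vectors is a multiple of their inner
  product, hence the information matrix acts on these vectors as
  \<open>\<alpha> I - \<gamma> x x'\<close>. This is read off in the eigenbasis: for
  \<open>\<gamma> \<noteq> 0\<close> the vanishing off-diagonal entries show that exactly one
  eigenvector has a component along \<open>x\<close>.\<close>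

lemma pseudo_symmetric_eigs:
  assumes p: "\<forall>s\<in>seqs k t. 0 \<le> p s" and ps: "pseudo_symmetric k t S p"
    and x: "(\<Sum>a<t. x a) = 0" and N: "(\<Sum>a<t. (x a)\<^sup>2) = N" "N > 0" and i: "i < t - 1"
  shows "eigs (Info k t S p u ws (vec t x)) ! Suc i = pinched (ctr k t p u u) (qInfo p u ws x / N) i"
proof -
  let ?I = "Info k t S p u ws (vec t x)" and ?x = "vec t x"
  obtain n where n: "t = Suc n" using t by (cases t) auto
  note I_facts = Info_carrier[of p u ws x] Info_symmetric[of p u ws x] Info_ones[of p u ws x]
    Info_nonneg[OF p, of _ u ws x]
  show ?thesis
  proof (rule sum_zero_spectrum[OF I_facts[unfolded n], folded n])
    fix d e
    assume eigs: "eigs ?I = 0 # map d [0..<n]"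
      and d: "\<And>i. i < n \<Longrightarrow> 0 \<le> d i" "\<And>i j. i \<le> j \<Longrightarrow> j < n \<Longrightarrow> d i \<le> d j"
      and e: "\<And>i. i < n \<Longrightarrow> e i \<in> carrier_vec t"
        "\<And>i. i < n \<Longrightarrow> vec t (\<lambda>_. 1) \<bullet> e i = 0"
        "\<And>i. i < n \<Longrightarrow> ?I *\<^sub>v e i = d i \<cdot>\<^sub>v e i"
      and orth: "\<And>i j. i < n \<Longrightarrow> j < n \<Longrightarrow> e i \<bullet> e j = (if i = j then 1 else 0)"
      and tr: "(\<Sum>a<t. ?I $$ (a,a)) = (\<Sum>i<n. d i)"
      and quad: "\<And>y. y \<in> carrier_vec t \<Longrightarrow> vec t (\<lambda>_. 1) \<bullet> y = 0 \<Longrightarrow> y \<bullet> y = (\<Sum>i<n. (e i \<bullet> y)\<^sup>2)"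
        "\<And>y. y \<in> carrier_vec t \<Longrightarrow> vec t (\<lambda>_. 1) \<bullet> y = 0 \<Longrightarrow>
          y \<bullet> (?I *\<^sub>v y) = (\<Sum>i<n. d i * (e i \<bullet> y)\<^sup>2)"
    define \<alpha> where "\<alpha> = ctr k t p u u"
    define g where "g i = e i \<bullet> ?x" for i
    define kv where "kv = vec (length ws) (\<lambda>a. ctr k t p u (ws ! a))"
    define \<gamma> where "\<gamma> = kv \<bullet> (moore_penrose (Gram p ws x) *\<^sub>v kv)"
    have "vec t (\<lambda>_. 1) \<bullet> ?x = 0" using x by (simp add: scalar_prod_def lessThan_atLeast0)
    moreover have "?x \<bullet> ?x = N" using N(1) by (simp add: scalar_prod_def lessThan_atLeast0 power2_eq_square)
    ultimately have NN: "N = (\<Sum>i<n. (g i)\<^sup>2)" and qI: "qInfo p u ws x = (\<Sum>i<n. d i * (g i)\<^sup>2)"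
      using quad[of ?x] by (auto simp: g_def)
    have main: "d j * (e i \<bullet> e j) = \<alpha> * (e i \<bullet> e j) - \<gamma> * (g i * g j)" if ij: "i < n" "j < n" for i j
    proof -
      have ec: "e i \<in> carrier_vec t" "e j \<in> carrier_vec t" using e ij by auto
      have ev: "vec t (($) (e i)) = e i" "vec t (($) (e j)) = e j" using ec by auto
      have sum0: "(\<Sum>a<t. e m $ a) = 0" if "m < n" for m
        using e(2)[OF that] carrier_vecD[OF e(1)[OF that]] by (simp add: scalar_prod_def lessThan_atLeast0)
      have cr: "cross p u ws x (($) (e m)) = g m \<cdot>\<^sub>v kv" if "m < n" for m
      proof (rule eq_vecI)
        fix a assume "a < dim_vec (g m \<cdot>\<^sub>v kv)"
        then have a: "a < length ws" by (simp add: kv_def)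
        note sum0[OF that]
        moreover have "g m = (\<Sum>a<t. e m $ a * x a)" by (simp add: g_def scalar_prod_def lessThan_atLeast0)
        ultimately show "cross p u ws x (($) (e m)) $ a = (g m \<cdot>\<^sub>v kv) $ a"
          using a by (simp add: cross_def kv_def pseudo_symmetric_cform[OF ps])
      qed (simp add: cross_def kv_def)
      have kvc: "kv \<in> carrier_vec (length ws)" by (simp add: kv_def)
      have "e i \<bullet> (?I *\<^sub>v e j) = \<alpha> * (e i \<bullet> e j) - \<gamma> * (g i * g j)"
        using Info_bilinear[of "($) (e i)" p u ws x "($) (e j)"] moore_penrose_Gram(1)[of p ws x] kvc ec
        by (simp add: ev cr ij pseudo_symmetric_cform[OF ps sum0[OF ij(1)]] mult_mat_vec[of _ "length ws" "length ws"] \<gamma>_def \<alpha>_def)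
          (simp add: scalar_prod_def lessThan_atLeast0)
      then show ?thesis using e ij ec by simp
    qed
    have dd: "d m = \<alpha> - \<gamma> * (g m)\<^sup>2" if "m < n" for m
      using main[OF that that] orth that by (simp add: power2_eq_square)
    have off: "\<gamma> * (g m * g j) = 0" if "m < n" "j < n" "m \<noteq> j" for m j
      using main[OF that(1,2)] orth that by simp
    have x_form: "cform k t p u x u x = \<alpha> * N"
      unfolding pseudo_symmetric_cform[OF ps x] \<alpha>_def using N(1) by (simp add: power2_eq_square)
    define \<beta> where "\<beta> = qInfo p u ws x / N"
    have \<beta>\<alpha>: "\<beta> \<le> \<alpha>" using Info_le_Cuw[OF p, of x u ws x] N(2) x_form by (simp add: \<beta>_def pos_divide_le_eq)
    have "\<forall>m<n. d m = pinched \<alpha> \<beta> m"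
    proof (cases "\<gamma> = 0")
      case True
      then have d_all: "d m = \<alpha>" if "m < n" for m using dd that by simp
      then have "qInfo p u ws x = \<alpha> * N" by (simp add: qI NN sum_distrib_left)
      then have "\<beta> = \<alpha>" using N(2) by (simp add: \<beta>_def)
      then show ?thesis using d_all by (simp add: pinched_def)
    next
      case False
      have "\<exists>m<n. g m \<noteq> 0"
      proof (rule ccontr)
        assume "\<not> ?thesis"
        then have "N = 0" by (simp add: NN)
        then show False using N(2) by simp
      qed
      then obtain m where m: "m < n" "g m \<noteq> 0" by blast
      have g0: "g j = 0" if "j < n" "j \<noteq> m" for j using off[OF m(1) that(1)] that m False by auto
      have sing: "(\<Sum>j<n. c j * (g j)\<^sup>2) = c m * (g m)\<^sup>2" for c :: "nat \<Rightarrow> real"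
      proof -
        have "(\<Sum>j<n. c j * (g j)\<^sup>2) = (\<Sum>j<n. if j = m then c j * (g j)\<^sup>2 else 0)"
          by (intro sum.cong refl) (auto simp: g0)
        then show ?thesis using m(1) by simp
      qed
      have "N = (g m)\<^sup>2" using NN sing[of "\<lambda>_. 1"] by simp
      then have dm: "d m = \<beta>" using qI sing[of d] m by (simp add: \<beta>_def)
      have dj: "d j = \<alpha>" if "j < n" "j \<noteq> m" for j using dd[OF that(1)] g0[OF that] by simp
      show ?thesis
      proof (cases "m = 0")
        case True
        then show ?thesis using dm dj by (auto simp: pinched_def)
      next
        case False
        \<comment> \<open>The list is sorted, so a position of \<open>\<beta>\<close> other than the
          first forces \<open>\<alpha> = \<beta>\<close>.\<close>
        then have "\<alpha> \<le> \<beta>" using d(2)[of 0 m] m dm dj[of 0] by simp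
        then have "\<alpha> = \<beta>" using \<beta>\<alpha> by simp
        then show ?thesis using dm dj by (auto simp: pinched_def)
      qed
    qed
    moreover have "i < n" using i n by simp
    ultimately show ?thesis unfolding eigs \<alpha>_def[symmetric] \<beta>_def[symmetric] by simp
  qed
qed

end

section \<open>Expected criteria\<close>

definition sqnorm :: "nat \<Rightarrow> (nat \<Rightarrow> real) \<Rightarrow> real" where
  "sqnorm t x = (\<Sum>a<t. (x a)\<^sup>2)"

lemma Tset_sqnorm_pos: "x \<in> Tset t \<Longrightarrow> 0 < sqnorm t x"
  unfolding Tset_def sqnorm_def by (auto intro!: sum_pos2)

lemma abs_mult_le_sqnorm:
  assumes "a < t" and "b < t"
  shows "\<bar>x a * x b\<bar> \<le> sqnorm t x"
proof -
  have "(x a)\<^sup>2 \<le> sqnorm t x" "(x b)\<^sup>2 \<le> sqnorm t x"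
    unfolding sqnorm_def using assms by (auto intro!: member_le_sum)
  moreover have "2 * \<bar>x a * x b\<bar> \<le> (x a)\<^sup>2 + (x b)\<^sup>2"
    using sum_squares_bound[of "\<bar>x a\<bar>" "\<bar>x b\<bar>"] by (simp add: abs_mult)
  ultimately show ?thesis by linarith
qed

locale exchangeable_design = circular_design +
  fixes g :: "(nat \<Rightarrow> real) measure"
  assumes exch: "exch_distribution t g"
begin

sublocale prob_space g
  using exch by (simp add: exch_distribution_def)

lemma g_sets: "sets g = sets borel"
  using exch unfolding exch_distribution_def by blast

lemma coordinate_measurable [measurable]: "(\<lambda>x. x a) \<in> borel_measurable g"
proof -
  have "(\<lambda>x :: nat \<Rightarrow> real. x a) \<in> borel_measurable borel"
    by (intro borel_measurable_continuous_onI continuous_on_product_coordinates)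
  then show ?thesis using measurable_cong_sets[OF g_sets refl] by blast
qed

lemma permute_measurable: "(\<lambda>x i. x (\<pi> i)) \<in> measurable g g"
proof -
  have "(\<lambda>(x :: nat \<Rightarrow> real) i. x (\<pi> i)) \<in> borel_measurable borel"
    by (intro borel_measurable_continuous_onI continuous_on_coordinatewise_then_product continuous_on_product_coordinates)
  then show ?thesis using measurable_cong_sets[OF g_sets g_sets] by blast
qed

lemma AE_Tset: "AE x in g. x \<in> Tset t"
proof -
  have one: "emeasure g (Tset t) = 1" using exch by (simp add: exch_distribution_def)
  then have "Tset t \<in> sets g" using emeasure_notin_sets by fastforce
  then show ?thesis using AE_in_set_eq_1 one by (simp add: emeasure_eq_measure)
qed

definition moment :: "nat \<Rightarrow> nat \<Rightarrow> real" where
  "moment a b = (\<integral>x. x a * x b / sqnorm t x \<partial>g)"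

lemma sqnorm_measurable [measurable]: "sqnorm t \<in> borel_measurable g"
  unfolding sqnorm_def by measurable

lemma moment_integrable:
  assumes "a < t" and "b < t"
  shows "integrable g (\<lambda>x. x a * x b / sqnorm t x)"
proof (rule integrable_const_bound[where B = 1])
  show "AE x in g. norm (x a * x b / sqnorm t x) \<le> 1"
    using AE_Tset
  proof eventually_elim
    case (elim x)
    then show ?case using Tset_sqnorm_pos[OF elim] abs_mult_le_sqnorm[OF assms, of x] by simp
  qed
qed measurable

lemma moment_permute:
  assumes p: "\<pi> permutes {..<t}"
  shows "moment (\<pi> a) (\<pi> b) = moment a b"
proof -
  have norm: "sqnorm t (\<lambda>i. x (\<pi> i)) = sqnorm t x" for x
    unfolding sqnorm_def using sum.permute[OF p, of "\<lambda>a. (x a)\<^sup>2"] by (simp add: comp_def)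
  have "moment a b = (\<integral>x. x a * x b / sqnorm t x \<partial>distr g g (\<lambda>x i. x (\<pi> i)))"
    using exch p by (simp add: moment_def exch_distribution_def)
  also have "\<dots> = (\<integral>x. x (\<pi> a) * x (\<pi> b) / sqnorm t (\<lambda>i. x (\<pi> i)) \<partial>g)"
    by (rule integral_distr[OF permute_measurable]) measurable
  finally show ?thesis by (simp add: norm moment_def)
qed

text \<open>Exchangeability leaves one diagonal and one off-diagonal value. The diagonal sums to 1
  by the normalization, and the rows sum to 0 because \<open>x\<close> does; the result is the
  centering matrix divided by \<open>t - 1\<close>.\<close>

lemma moment_eq:
  assumes ab: "a < t" "b < t"
  shows "moment a b = (if a = b then 1 / real (t - 1) else 0) - 1 / (real t * real (t - 1))"
proof -
  have vals: "moment a b = (if a = b then moment 0 0 else moment 0 1)" if "a < t" "b < t" for a b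
    by (rule two_valued[OF t _ that]) (intro moment_permute permutes_swap_id, auto)
  have t0: "0 < t" "1 < t" using t by auto
  have "(\<Sum>b<t. moment b b) = (\<integral>x. (\<Sum>b<t. x b * x b / sqnorm t x) \<partial>g)"
    unfolding moment_def by (rule Bochner_Integration.integral_sum[symmetric]) (simp add: moment_integrable)
  also have "\<dots> = (\<integral>x. 1 \<partial>g)"
  proof (rule integral_cong_AE)
    show "AE x in g. (\<Sum>b<t. x b * x b / sqnorm t x) = 1"
      using AE_Tset
    proof eventually_elim
      case (elim x)
      then show ?case using Tset_sqnorm_pos[OF elim]
        by (simp add: sum_divide_distrib[symmetric] power2_eq_square[symmetric] sqnorm_def)
    qed
  qed measurable
  finally have "(\<Sum>b<t. moment b b) = 1" using prob_space by simp
  moreover have "(\<Sum>b<t. moment b b) = (\<Sum>b<t. moment 0 0)"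
    by (intro sum.cong refl) (subst vals, auto)
  ultimately have tr: "real t * moment 0 0 = 1" by simp
  have "(\<Sum>b<t. moment 0 b) = (\<integral>x. (\<Sum>b<t. x 0 * x b / sqnorm t x) \<partial>g)"
    unfolding moment_def by (rule Bochner_Integration.integral_sum[symmetric]) (simp add: moment_integrable t0)
  also have "\<dots> = (\<integral>x. 0 \<partial>g)"
  proof (rule integral_cong_AE)
    show "AE x in g. (\<Sum>b<t. x 0 * x b / sqnorm t x) = 0"
      using AE_Tset
    proof eventually_elim
      case (elim x)
      then show ?case by (simp add: sum_divide_distrib[symmetric] sum_distrib_left[symmetric] Tset_def)
    qed
  qed measurable
  finally have "(\<Sum>b<t. moment 0 b) = 0" by simp
  moreover have "(\<Sum>b<t. moment 0 b) = moment 0 0 + real (t - 1) * moment 0 1"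
  proof -
    obtain n where n: "t = Suc n" using t by (cases t) auto
    have "(\<Sum>i<n. moment 0 (Suc i)) = (\<Sum>i<n. moment 0 1)"
      by (intro sum.cong refl) (subst vals, auto simp: n)
    then show ?thesis unfolding n sum.lessThan_Suc_shift by simp
  qed
  ultimately have row: "moment 0 0 + real (t - 1) * moment 0 1 = 0" by simp
  have "moment 0 0 = 1 / real t" using tr t0 by (simp add: field_simps)
  moreover have "moment 0 1 = - 1 / (real t * real (t - 1))"
  proof -
    have "real t * (moment 0 0 + real (t - 1) * moment 0 1) = 0" unfolding row by simp
    then have "1 + (real t * real (t - 1)) * moment 0 1 = 0" by (simp only: distrib_left tr mult.assoc)
    moreover have "real t * real (t - 1) \<noteq> 0" using t by simp
    moreover have "m = - 1 / K" if "1 + K * m = 0" "K \<noteq> 0" for K m :: real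
    proof -
      have "K * m = - 1" using that(1) by simp
      then have "m = (- 1) / K" using that(2) by (metis nonzero_mult_div_cancel_left)
      then show ?thesis .
    qed
    ultimately show ?thesis by blast
  qed
  moreover have "1 / real t = 1 / real (t - 1) - 1 / (real t * real (t - 1))"
  proof -
    have "1 / real (t - 1) = real t / (real t * real (t - 1))" using t0 by simp
    then have "1 / real (t - 1) - 1 / (real t * real (t - 1)) = (real t - 1) / (real t * real (t - 1))"
      by (simp only: diff_divide_distrib)
    also have "real t - 1 = real (t - 1)" using t0 by simp
    finally show ?thesis using t0 by simp
  qed
  ultimately show ?thesis using vals[OF ab] by simp
qed

text \<open>The expectation is the entrywise pairing of \<open>C[w,w]\<close> with the moments.
  Their constant part contributes the form at the constant vector, which is 0, and the diagonal part
  leaves the trace over \<open>t - 1\<close>.\<close>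

lemma expectation_cform:
  shows "integrable g (\<lambda>x. cform k t p w x w x / sqnorm t x)"
    and "(\<integral>x. cform k t p w x w x / sqnorm t x \<partial>g) = ctr k t p w w"
proof -
  let ?c = "\<lambda>a b. cform k t p w (ind a) w (ind b)"
  have eq: "cform k t p w x w x / sqnorm t x = (\<Sum>a<t. \<Sum>b<t. ?c a b * (x a * x b / sqnorm t x))" for x
  proof -
    have "cform k t p w x w x = (\<Sum>a<t. x a * (\<Sum>b<t. x b * ?c a b))"
      unfolding cform_expand_left[of p w x] by (subst cform_expand) simp
    then show ?thesis by (simp add: sum_distrib_left sum_divide_distrib mult_ac)
  qed
  have int: "integrable g (\<lambda>x. ?c a b * (x a * x b / sqnorm t x))" if "a < t" "b < t" for a b
    using moment_integrable[OF that] by (rule integrable_mult_right)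
  show "integrable g (\<lambda>x. cform k t p w x w x / sqnorm t x)"
    unfolding eq using int by (intro Bochner_Integration.integrable_sum) auto
  have "(\<integral>x. cform k t p w x w x / sqnorm t x \<partial>g) = (\<Sum>a<t. \<integral>x. (\<Sum>b<t. ?c a b * (x a * x b / sqnorm t x)) \<partial>g)"
    unfolding eq using int by (intro Bochner_Integration.integral_sum Bochner_Integration.integrable_sum) auto
  also have "\<dots> = (\<Sum>a<t. \<Sum>b<t. ?c a b * moment a b)"
  proof (intro sum.cong refl)
    fix a assume "a \<in> {..<t}"
    then have "(\<integral>x. (\<Sum>b<t. ?c a b * (x a * x b / sqnorm t x)) \<partial>g)
        = (\<Sum>b<t. \<integral>x. ?c a b * (x a * x b / sqnorm t x) \<partial>g)"
      using int by (intro Bochner_Integration.integral_sum) auto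
    then show "(\<integral>x. (\<Sum>b<t. ?c a b * (x a * x b / sqnorm t x)) \<partial>g) = (\<Sum>b<t. ?c a b * moment a b)"
      by (simp only: integral_mult_right_zero moment_def)
  qed
  also have "\<dots> = (\<Sum>a<t. \<Sum>b<t. (if b = a then ?c a b / real (t - 1) else 0) - ?c a b / (real t * real (t - 1)))"
    by (intro sum.cong refl) (auto simp: moment_eq right_diff_distrib)
  also have "\<dots> = ctr k t p w w - (\<Sum>a<t. \<Sum>b<t. ?c a b) / (real t * real (t - 1))"
    by (simp add: sum_subtractf ctr_def sum_divide_distrib)
  also have "(\<Sum>a<t. \<Sum>b<t. ?c a b) = cform k t p w (\<lambda>_. 1) w (\<lambda>_. 1)"
    unfolding cform_expand_left[of p w "\<lambda>_. 1"] by (subst (2) cform_expand) simp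
  finally show "(\<integral>x. cform k t p w x w x / sqnorm t x \<partial>g) = ctr k t p w w" by (simp add: cform_const)
qed

text \<open>Up to the factor \<open>sqnorm t x\<close>, the minimized form is \<open>ctr\<close> at
  the weight vector, in which \<open>x\<close> no longer occurs; so a minimizer for \<open>y\<close>
  competes equally well at \<open>x\<close>.\<close>

lemma pseudo_symmetric_qInfo:
  assumes p: "\<forall>s\<in>seqs k t. 0 \<le> p s" and ps: "pseudo_symmetric k t S p"
    and x: "(\<Sum>a<t. x a) = 0" "0 < sqnorm t x" and y: "(\<Sum>a<t. y a) = 0" "0 < sqnorm t y"
  shows "qInfo p u ws x / sqnorm t x = qInfo p u ws y / sqnorm t y"
proof -
  have "qInfo p u ws x / sqnorm t x \<le> qInfo p u ws y / sqnorm t y"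
    if x: "(\<Sum>a<t. x a) = 0" "0 < sqnorm t x" and y: "(\<Sum>a<t. y a) = 0" "0 < sqnorm t y" for x y
  proof -
    have form: "cform k t p w x w x = ctr k t p w w * sqnorm t x" if "(\<Sum>a<t. x a) = 0" for w x
      using pseudo_symmetric_cform[OF ps that, of w w x] by (simp add: sqnorm_def power2_eq_square)
    obtain v where "qInfo p u ws y = ctr k t p (\<lambda>i. u i + comb ws v i) (\<lambda>i. u i + comb ws v i) * sqnorm t y"
      using qInfo_minimum(2)[OF p] form[OF y(1)] by metis
    moreover have "qInfo p u ws x \<le> ctr k t p (\<lambda>i. u i + comb ws v i) (\<lambda>i. u i + comb ws v i) * sqnorm t x"
      using qInfo_minimum(1)[OF p] form[OF x(1)] by metis
    ultimately show ?thesis using x y by (simp add: pos_divide_le_eq)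
  qed
  from this[OF x y] this[OF y x] show ?thesis by simp
qed

text \<open>The criterion of a measure is evaluated on vectors outside \<open>Tset\<close> as well. There \<open>Info\<close> only
  depends on the centered vector, so that the integrand takes at most two values.\<close>

lemma pseudo_symmetric_value:
  assumes p: "\<forall>s\<in>seqs k t. 0 \<le> p s" and ps: "pseudo_symmetric k t S p"
    and x0: "(\<Sum>a<t. x0 a) = 0" "0 < sqnorm t x0" and f: "depends_on (t - 1) f"
  shows "(\<integral>x. f (\<lambda>i. eigs (Info k t S p u ws (vec t x)) ! Suc i) \<partial>g)
    = f (pinched (ctr k t p u u) (qInfo p u ws x0 / sqnorm t x0))"
proof -
  let ?v = "f (pinched (ctr k t p u u) (qInfo p u ws x0 / sqnorm t x0))"
  define h where "h x = f (\<lambda>i. eigs (Info k t S p u ws (vec t x)) ! Suc i)" for x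
  define m where "m x = (\<Sum>a<t. x a) / real t" for x :: "nat \<Rightarrow> real"
  define c0 where "c0 = h (\<lambda>_. 0)"
  have cen: "h x = h (\<lambda>a. x a - m x)" for x
    using Info_add_const[of p u ws x "- m x"] by (simp add: h_def)
  have sum0: "(\<Sum>a<t. x a - m x) = 0" for x using t by (simp add: m_def sum_subtractf)
  have val: "h x = ?v" if "(\<Sum>a<t. x a) = 0" "0 < sqnorm t x" for x
  proof -
    have "eigs (Info k t S p u ws (vec t x)) ! Suc i
        = pinched (ctr k t p u u) (qInfo p u ws x0 / sqnorm t x0) i" if "i < t - 1" for i
      unfolding pseudo_symmetric_qInfo[OF p ps x0 \<open>(\<Sum>a<t. x a) = 0\<close> \<open>0 < sqnorm t x\<close>]
      by (rule pseudo_symmetric_eigs[OF p ps]) (use that \<open>(\<Sum>a<t. x a) = 0\<close> \<open>0 < sqnorm t x\<close> in \<open>auto simp: sqnorm_def\<close>)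
    then show ?thesis unfolding h_def by (intro f[unfolded depends_on_def, rule_format]) simp
  qed
  have h_eq: "h x = (if sqnorm t (\<lambda>a. x a - m x) = 0 then c0 else ?v)" for x
  proof (cases "sqnorm t (\<lambda>a. x a - m x) = 0")
    case True
    then have "x a - m x = 0" if "a < t" for a using that by (simp add: sqnorm_def sum_nonneg_eq_0_iff)
    then have "vec t (\<lambda>a. x a - m x) = vec t (\<lambda>_. 0)" by auto
    then show ?thesis using True cen[of x] by (simp add: h_def c0_def)
  next
    case False
    moreover have "0 \<le> sqnorm t (\<lambda>a. x a - m x)" by (simp add: sqnorm_def sum_nonneg)
    ultimately show ?thesis using cen[of x] val[OF sum0[of x]] by simp
  qed
  have [measurable]: "(\<lambda>x. sqnorm t (\<lambda>a. x a - m x)) \<in> borel_measurable g"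
    unfolding sqnorm_def m_def by measurable
  have "(\<integral>x. h x \<partial>g) = (\<integral>x. ?v \<partial>g)"
  proof (rule integral_cong_AE)
    show "h \<in> borel_measurable g" unfolding h_eq[abs_def] by measurable
    show "AE x in g. h x = ?v" using AE_Tset
    proof eventually_elim
      case (elim x)
      then show ?case using val[of x] Tset_sqnorm_pos[OF elim] by (simp add: Tset_def)
    qed
  qed simp
  then show ?thesis by (simp add: h_def prob_space)
qed

lemma value_le_symmetrize:
  assumes q: "q \<in> meas_set k t" and f: "depends_on (t - 1) f" "supported (t - 1) f"
  shows "(\<integral>x. f (\<lambda>i. eigs (Info k t S q u ws (vec t x)) ! Suc i) \<partial>g)
    \<le> (\<integral>x. f (\<lambda>i. eigs (Info k t S (symmetrize t q) u ws (vec t x)) ! Suc i) \<partial>g)"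
proof -
  let ?r = "symmetrize t q"
  define h where "h x = f (\<lambda>i. eigs (Info k t S q u ws (vec t x)) ! Suc i)" for x
  have q0: "\<forall>s\<in>seqs k t. 0 \<le> q s" and r0: "\<forall>s\<in>seqs k t. 0 \<le> ?r s"
    using q symmetrize_in_meas_set[OF q] by (auto simp: meas_set_def)
  note ps = symmetrize_pseudo_symmetric[of q]
  \<comment> \<open>Any nonzero sum-zero vector would do as reference: for the symmetrized measure,
    \<open>qInfo\<close> divided by the squared length is the same for all of them.\<close>
  define x0 where "x0 a = (if a = 0 then 1 else if a = 1 then - 1 else 0 :: real)" for a :: nat
  have x0: "(\<Sum>a<t. x0 a) = 0" "0 < sqnorm t x0"
  proof -
    have "x0 = (\<lambda>a. ind 0 a - ind 1 a)" by (auto simp: x0_def ind_def)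
    then show "(\<Sum>a<t. x0 a) = 0" using t by (simp add: ind_def sum_subtractf)
    show "0 < sqnorm t x0" unfolding sqnorm_def using t by (intro sum_pos2[of _ 0]) (auto simp: x0_def)
  qed
  define \<alpha> \<beta> where "\<alpha> = ctr k t ?r u u" and "\<beta> = qInfo ?r u ws x0 / sqnorm t x0"
  have form: "cform k t ?r w x0 w x0 = ctr k t ?r w w * sqnorm t x0" for w
    using pseudo_symmetric_cform[OF ps x0(1), of w w x0] by (simp add: sqnorm_def power2_eq_square)
  obtain v where "qInfo ?r u ws x0 = ctr k t ?r (\<lambda>i. u i + comb ws v i) (\<lambda>i. u i + comb ws v i) * sqnorm t x0"
    using qInfo_minimum(2)[OF r0] form by metis
  moreover define w where "w = (\<lambda>i. u i + comb ws v i)"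
  ultimately have \<beta>: "\<beta> = ctr k t q w w" using x0(2) by (simp add: \<beta>_def ctr_symmetrize)
  have \<alpha>: "\<alpha> = ctr k t q u u" by (simp add: \<alpha>_def ctr_symmetrize)
  have "\<beta> \<le> \<alpha>"
    using Info_le_Cuw[OF r0, of x0 u ws x0] x0(2) form[of u] by (simp add: \<alpha>_def \<beta>_def pos_divide_le_eq)
  moreover have "0 \<le> \<beta>"
    using Info_nonneg[OF r0, of "vec t x0" u ws x0] x0(2) by (simp add: \<beta>_def)
  ultimately have sup: "\<exists>c1 c2. 0 \<le> c1 \<and> 0 \<le> c2 \<and> c1 * (real (t - 1 - 1) * \<alpha>) + c2 * \<beta> \<le> f (pinched \<alpha> \<beta>) + \<epsilon>
    \<and> (\<forall>d z. (\<forall>i<t-1. 0 \<le> d i \<and> 0 \<le> z i) \<longrightarrow> (\<forall>i j. i \<le> j \<longrightarrow> j < t-1 \<longrightarrow> d i \<le> d j) \<longrightarrow> (\<Sum>i<t-1. z i) = 1 \<longrightarrow>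
        f d \<le> c1 * (\<Sum>i<t-1. d i * (1 - z i)) + c2 * (\<Sum>i<t-1. d i * z i))" if "0 < \<epsilon>" for \<epsilon>
    using f(2) that unfolding supported_def by blast
  have "(\<integral>x. h x \<partial>g) \<le> f (pinched \<alpha> \<beta>) + \<epsilon>" if \<epsilon>: "0 < \<epsilon>" for \<epsilon>
  proof -
    obtain c1 c2 where c: "0 \<le> c1" "0 \<le> c2" and le: "c1 * (real (t - 1 - 1) * \<alpha>) + c2 * \<beta> \<le> f (pinched \<alpha> \<beta>) + \<epsilon>"
      and bound: "\<forall>d z. (\<forall>i<t-1. 0 \<le> d i \<and> 0 \<le> z i) \<longrightarrow> (\<forall>i j. i \<le> j \<longrightarrow> j < t-1 \<longrightarrow> d i \<le> d j) \<longrightarrow> (\<Sum>i<t-1. z i) = 1 \<longrightarrow>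
        f d \<le> c1 * (\<Sum>i<t-1. d i * (1 - z i)) + c2 * (\<Sum>i<t-1. d i * z i)"
      using sup[OF \<epsilon>] by blast
    show ?thesis
    proof (cases "integrable g h")
      case False
      \<comment> \<open>The integral of a non-integrable function is 0 by convention, and the
        supporting functional is nonnegative at \<open>pinched \<alpha> \<beta>\<close>.\<close>
      have "0 \<le> c1 * (real (t - 1 - 1) * \<alpha>) + c2 * \<beta>" using c \<open>0 \<le> \<beta>\<close> \<open>\<beta> \<le> \<alpha>\<close> by simp
      then show ?thesis using False le by (simp add: not_integrable_integral_eq)
    next
      case True
      let ?tr = "\<Sum>a<t. cform k t q u (ind a) u (ind a)"
      let ?b = "\<lambda>x. c1 * (?tr - cform k t q u x u x / sqnorm t x) + c2 * (cform k t q w x w x / sqnorm t x)"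
      have int: "integrable g ?b"
        by (intro Bochner_Integration.integrable_add integrable_mult_right Bochner_Integration.integrable_diff
            expectation_cform(1) integrable_const)
      have "(\<integral>x. h x \<partial>g) \<le> (\<integral>x. ?b x \<partial>g)"
      proof (rule integral_mono_AE[OF True int])
        show "AE x in g. h x \<le> ?b x" using AE_Tset
        proof eventually_elim
          case (elim x)
          note N = Tset_sqnorm_pos[OF elim]
          have "h x \<le> c1 * (?tr - cform k t q u x u x / sqnorm t x) + c2 * (qInfo q u ws x / sqnorm t x)"
            unfolding h_def
            by (rule Info_criterion_bound[OF q0 _ _ N c bound]) (use elim in \<open>auto simp: Tset_def sqnorm_def\<close>)
          \<comment> \<open>The vector \<open>w\<close> comes from the symmetrized measure and need
            not be optimal for \<open>q\<close> at this \<open>x\<close>, but every competitor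
            bounds the minimum from above.\<close>
          also have "\<dots> \<le> ?b x"
            using c(2) N qInfo_minimum(1)[OF q0, where u = u and ws = ws and x = x and v = v]
            by (intro add_left_mono mult_left_mono divide_right_mono) (auto simp: w_def)
          finally show ?case .
        qed
      qed
      also have "\<dots> = c1 * (?tr - ctr k t q u u) + c2 * ctr k t q w w"
      proof -
        have "(\<integral>x. c1 * (?tr - A x) + c2 * B x \<partial>g) = c1 * (?tr - (\<integral>x. A x \<partial>g)) + c2 * (\<integral>x. B x \<partial>g)"
          if "integrable g A" "integrable g B" for A B :: "(nat \<Rightarrow> real) \<Rightarrow> real"
          using that by (simp add: prob_space)
        from this[OF expectation_cform(1)[of q u] expectation_cform(1)[of q w]]
        show ?thesis unfolding expectation_cform(2) .
      qed
      \<comment> \<open>The trace is \<open>(t - 1) \<alpha>\<close>; removing the expected share of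
        \<open>x\<close> leaves \<open>t - 2\<close> copies of \<open>\<alpha>\<close>.\<close>
      also have "?tr - ctr k t q u u = real (t - 1 - 1) * \<alpha>"
        using t by (simp add: \<alpha> ctr_def of_nat_diff field_simps)
      finally show ?thesis using le \<beta> by simp
    qed
  qed
  then have "(\<integral>x. h x \<partial>g) \<le> f (pinched \<alpha> \<beta>)" by (rule field_le_epsilon)
  then show ?thesis
    unfolding h_def pseudo_symmetric_value[OF r0 ps x0 f(1)] \<alpha>_def \<beta>_def .
qed

text \<open>If some measure improves on \<open>p\<close>, so does its symmetrization, which is
  pseudo symmetric; and on pseudo symmetric measures both models give the same value. The hypothesis
  on \<open>u1\<close> and \<open>u2\<close> covers the two ways in which the values can agree: a
  common \<open>\<alpha>\<close>, or a criterion insensitive to it.\<close>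

lemma optimal_transfer:
  assumes Phi: "\<And>C. Phi C = f (\<lambda>i. eigs C ! Suc i)" and f: "depends_on (t - 1) f" "supported (t - 1) f"
    and models: "\<And>q x. C1 q (vec t x) = Info k t S q u1 ws1 (vec t x)" "\<And>q x. C2 q (vec t x) = Info k t S q u2 ws2 (vec t x)"
    and q: "\<And>p x. \<forall>s\<in>seqs k t. 0 \<le> p s \<Longrightarrow> qInfo p u1 ws1 x = qInfo p u2 ws2 x"
    and u: "u1 = u2 \<or> (\<forall>\<alpha> \<alpha>' \<beta>. f (pinched \<alpha> \<beta>) = f (pinched \<alpha>' \<beta>))"
    and p: "p \<in> meas_set k t" "pseudo_symmetric k t S p"
  shows "optimal k t g Phi C1 p \<longleftrightarrow> optimal k t g Phi C2 p"
proof -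
  define V1 where "V1 q = (\<integral>x. f (\<lambda>i. eigs (Info k t S q u1 ws1 (vec t x)) ! Suc i) \<partial>g)" for q
  define V2 where "V2 q = (\<integral>x. f (\<lambda>i. eigs (Info k t S q u2 ws2 (vec t x)) ! Suc i) \<partial>g)" for q
  have eq: "V1 r = V2 r" if "r \<in> meas_set k t" "pseudo_symmetric k t S r" for r
  proof -
    have r0: "\<forall>s\<in>seqs k t. 0 \<le> r s" using that by (simp add: meas_set_def)
    define x0 where "x0 a = ind 0 a - ind 1 a" for a
    have "(\<Sum>a<t. x0 a) = 0" using t by (simp add: x0_def ind_def sum_subtractf)
    moreover have "0 < sqnorm t x0"
      unfolding sqnorm_def using t by (intro sum_pos2[of _ 0]) (auto simp: x0_def ind_def)
    ultimately have "V1 r = f (pinched (ctr k t r u1 u1) (qInfo r u1 ws1 x0 / sqnorm t x0))"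
      and "V2 r = f (pinched (ctr k t r u2 u2) (qInfo r u2 ws2 x0 / sqnorm t x0))"
      unfolding V1_def V2_def using pseudo_symmetric_value[OF r0 that(2) _ _ f(1), of x0] by auto
    then show ?thesis using u q[OF r0, of x0] by metis
  qed
  have V1: "V1 q \<le> V1 (symmetrize t q)" and V2: "V2 q \<le> V2 (symmetrize t q)" if "q \<in> meas_set k t" for q
    unfolding V1_def V2_def by (rule value_le_symmetrize[OF that f])+
  have "optimal k t g Phi C1 p \<longleftrightarrow> (\<forall>q\<in>meas_set k t. V1 q \<le> V1 p)"
    using p(1) by (simp add: optimal_def Phi models V1_def)
  moreover have "optimal k t g Phi C2 p \<longleftrightarrow> (\<forall>q\<in>meas_set k t. V2 q \<le> V2 p)"
    using p(1) by (simp add: optimal_def Phi models V2_def)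
  moreover have "(\<forall>q\<in>meas_set k t. V1 q \<le> V1 p) \<longleftrightarrow> (\<forall>q\<in>meas_set k t. V2 q \<le> V2 p)"
    using V1 V2 eq[OF p] eq[OF symmetrize_in_meas_set symmetrize_pseudo_symmetric]
      symmetrize_in_meas_set by (metis order_trans)
  ultimately show ?thesis by simp
qed

end

section \<open>Comparison of the two models\<close>

context circular_design
begin

lemma qInfo_le:
  assumes p: "\<forall>s\<in>seqs k t. 0 \<le> p s"
    and dom: "\<And>v. \<exists>v'. cform k t p (\<lambda>i. u1 i + comb ws1 v' i) x (\<lambda>i. u1 i + comb ws1 v' i) x
      \<le> cform k t p (\<lambda>i. u2 i + comb ws2 v i) x (\<lambda>i. u2 i + comb ws2 v i) x"
  shows "qInfo p u1 ws1 x \<le> qInfo p u2 ws2 x"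
proof -
  obtain v where v: "qInfo p u2 ws2 x = cform k t p (\<lambda>i. u2 i + comb ws2 v i) x (\<lambda>i. u2 i + comb ws2 v i) x"
    using qInfo_minimum(2)[OF p, where u = u2 and ws = ws2 and x = x] by blast
  obtain v' where "cform k t p (\<lambda>i. u1 i + comb ws1 v' i) x (\<lambda>i. u1 i + comb ws1 v' i) x \<le> qInfo p u2 ws2 x"
    unfolding v using dom[of v] by blast
  with qInfo_minimum(1)[OF p, where u = u1 and ws = ws1 and x = x and v = v'] show ?thesis by (rule order_trans)
qed

text \<open>Exchanging the two neighbour coordinates preserves the quadratic form, so averaging a vector with its
  mirror image does not increase it. Both minima below are therefore attained on vectors with equal neighbour
  coordinates, which are the vectors of the undirectional model.\<close>

lemma cform_average:
  assumes p: "\<forall>s\<in>seqs k t. 0 \<le> p s"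
  shows "cform k t p (vec3 a ((b + c) / 2) ((b + c) / 2)) x (vec3 a ((b + c) / 2) ((b + c) / 2)) x
    \<le> cform k t p (vec3 a b c) x (vec3 a b c) x"
proof -
  obtain A0 A1 A2 where A: "A2 \<le> A0" "\<And>a b c. cform k t p (vec3 a b c) x (vec3 a b c) x
      = A0 * (a\<^sup>2 + b\<^sup>2 + c\<^sup>2) + 2 * A1 * a * (b + c) + 2 * A2 * b * c"
    using cform_vec3[OF p, of x] by blast
  have "0 \<le> (A0 - A2) * (b - c)\<^sup>2" using A(1) by simp
  then show ?thesis unfolding A(2) by (simp add: power2_eq_square field_simps)
qed

text \<open>\<open>P\<close> describes the affine family of the directional model. The undirectional
  family is its slice \<open>b = c\<close>, and averaging stays within \<open>P\<close>, so each
  competitor in one family is matched by one at most as large in the other.\<close>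

lemma qInfo_vec3_eq:
  assumes p: "\<forall>s\<in>seqs k t. 0 \<le> p s"
    and fam1: "\<And>v. \<exists>a b. P a b b \<and> (\<lambda>i. u1 i + comb ws1 v i) = vec3 a b b"
      "\<And>a b. P a b b \<Longrightarrow> \<exists>v. (\<lambda>i. u1 i + comb ws1 v i) = vec3 a b b"
    and fam2: "\<And>v. \<exists>a b c. P a b c \<and> (\<lambda>i. u2 i + comb ws2 v i) = vec3 a b c"
      "\<And>a b. P a b b \<Longrightarrow> \<exists>v. (\<lambda>i. u2 i + comb ws2 v i) = vec3 a b b"
    and P: "\<And>a b c. P a b c \<Longrightarrow> P a ((b + c) / 2) ((b + c) / 2)"
  shows "qInfo p u1 ws1 x = qInfo p u2 ws2 x"
proof (rule antisym)
  show "qInfo p u1 ws1 x \<le> qInfo p u2 ws2 x"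
  proof (rule qInfo_le[OF p])
    fix v
    obtain a b c where "P a b c" and eq: "(\<lambda>i. u2 i + comb ws2 v i) = vec3 a b c" using fam2(1) by blast
    then obtain v' where v': "(\<lambda>i. u1 i + comb ws1 v' i) = vec3 a ((b + c) / 2) ((b + c) / 2)"
      using P fam1(2) by blast
    show "\<exists>v'. cform k t p (\<lambda>i. u1 i + comb ws1 v' i) x (\<lambda>i. u1 i + comb ws1 v' i) x
      \<le> cform k t p (\<lambda>i. u2 i + comb ws2 v i) x (\<lambda>i. u2 i + comb ws2 v i) x"
      unfolding eq by (rule exI[of _ v']) (unfold v', rule cform_average[OF p])
  qed
  show "qInfo p u2 ws2 x \<le> qInfo p u1 ws1 x"
  proof (rule qInfo_le[OF p])
    fix v
    obtain a b where "P a b b" and eq: "(\<lambda>i. u1 i + comb ws1 v i) = vec3 a b b" using fam1(1) by blast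
    then obtain v' where v': "(\<lambda>i. u2 i + comb ws2 v' i) = vec3 a b b"
      using fam2(2) by blast
    show "\<exists>v'. cform k t p (\<lambda>i. u2 i + comb ws2 v' i) x (\<lambda>i. u2 i + comb ws2 v' i) x
      \<le> cform k t p (\<lambda>i. u1 i + comb ws1 v i) x (\<lambda>i. u1 i + comb ws1 v i) x"
      unfolding eq by (rule exI[of _ v']) (unfold v', rule order_refl)
  qed
qed

text \<open>The nuisance weights absorb \<open>l\<close>, \<open>l1\<close> and \<open>l2\<close>:
  the families consist of all vectors with first coordinate 1, in the undirectional model with equal
  neighbour coordinates, whatever the parameters.\<close>

lemma qInfo_tau:
  assumes p: "\<forall>s\<in>seqs k t. 0 \<le> p s"
  shows "qInfo p (vec3 1 l l) [vec3 0 1 1] x = qInfo p (vec3 1 l1 l2) [vec3 0 1 0, vec3 0 0 1] x"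
proof (rule qInfo_vec3_eq[OF p, where P = "\<lambda>a b c. a = 1"])
  fix v :: "nat \<Rightarrow> real"
  have "(\<lambda>i. vec3 1 l l i + comb [vec3 0 1 1] v i) = vec3 1 (l + v 0) (l + v 0)"
    by (auto simp: comb_def vec3_def)
  then show "\<exists>a b. a = 1 \<and> (\<lambda>i. vec3 1 l l i + comb [vec3 0 1 1] v i) = vec3 a b b" by blast
next
  fix a b :: real assume "a = 1"
  then show "\<exists>v. (\<lambda>i. vec3 1 l l i + comb [vec3 0 1 1] v i) = vec3 a b b"
    by (intro exI[of _ "\<lambda>_. b - l"]) (auto simp: comb_def vec3_def)
next
  fix v :: "nat \<Rightarrow> real"
  have "(\<lambda>i. vec3 1 l1 l2 i + comb [vec3 0 1 0, vec3 0 0 1] v i) = vec3 1 (l1 + v 0) (l2 + v 1)"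
    by (auto simp: comb_def vec3_def)
  then show "\<exists>a b c. a = 1 \<and> (\<lambda>i. vec3 1 l1 l2 i + comb [vec3 0 1 0, vec3 0 0 1] v i) = vec3 a b c" by blast
next
  fix a b :: real assume "a = 1"
  then show "\<exists>v. (\<lambda>i. vec3 1 l1 l2 i + comb [vec3 0 1 0, vec3 0 0 1] v i) = vec3 a b b"
    by (intro exI[of _ "\<lambda>i. if i = 0 then b - l1 else b - l2"]) (auto simp: comb_def vec3_def)
qed auto

text \<open>After the scaling the effect weights have coordinate sum 1, while all nuisance weights
  have coordinate sum 0. The families are therefore the plane \<open>a + b + c = 1\<close> and its
  slice with equal neighbour coordinates, again independent of the parameters.\<close>

lemma qInfo_theta:
  assumes p: "\<forall>s\<in>seqs k t. 0 \<le> p s" and l: "1 + 2 * l \<noteq> 0" "1 + l1 + l2 \<noteq> 0"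
  shows "qInfo p (\<lambda>i. 1 / (1 + 2 * l) * vec3 1 l l i) [vec3 2 (-1) (-1)] x
    = qInfo p (\<lambda>i. 1 / (1 + l1 + l2) * vec3 1 l1 l2 i) [vec3 (-1) (1 + l2) (- l2), vec3 (-1) (- l1) (1 + l1)] x"
    (is "qInfo p ?u1 ?ws1 x = qInfo p ?u2 ?ws2 x")
proof (rule qInfo_vec3_eq[OF p, where P = "\<lambda>a b c. a + b + c = 1"])
  define c where "c = 1 / (1 + 2 * l)"
  have c: "c + 2 * (c * l) = 1" using l(1) by (simp add: c_def field_simps)
  have fam: "(\<lambda>i. ?u1 i + comb ?ws1 v i) = vec3 (c + 2 * v 0) (c * l - v 0) (c * l - v 0)" for v
    by (auto simp: comb_def vec3_def c_def)
  show "\<exists>a b. a + b + b = 1 \<and> (\<lambda>i. ?u1 i + comb ?ws1 v i) = vec3 a b b" for v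
    unfolding fam by (intro exI conjI, rule _) (use c in auto)
  fix a b :: real assume "a + b + b = 1"
  then show "\<exists>v. (\<lambda>i. ?u1 i + comb ?ws1 v i) = vec3 a b b"
    unfolding fam using c by (intro exI[of _ "\<lambda>_. c * l - b"]) (auto simp: vec3_def fun_eq_iff)
next
  define s c where "s = 1 + l1 + l2" and "c = 1 / s"
  have s: "s \<noteq> 0" using l(2) by (simp add: s_def)
  have "c * (1 + l1 + l2) = 1" using l(2) by (simp add: c_def s_def)
  then have c: "c + c * l1 + c * l2 = 1" by (simp add: distrib_left)
  have fam: "(\<lambda>i. ?u2 i + comb ?ws2 v i) = vec3 (c - v 0 - v 1) (c * l1 + (1 + l2) * v 0 - l1 * v 1)
      (c * l2 - l2 * v 0 + (1 + l1) * v 1)" for v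
    by (auto simp: comb_def vec3_def c_def s_def algebra_simps)
  show "\<exists>a b e. a + b + e = 1 \<and> (\<lambda>i. ?u2 i + comb ?ws2 v i) = vec3 a b e" for v
  proof -
    have "(c - v 0 - v 1) + (c * l1 + (1 + l2) * v 0 - l1 * v 1) + (c * l2 - l2 * v 0 + (1 + l1) * v 1) = 1"
      using c by (simp add: algebra_simps)
    then show ?thesis unfolding fam by blast
  qed
  fix a b :: real assume ab: "a + b + b = 1"
  define m1 m2 where "m1 = b - c * l1" and "m2 = b - c * l2"
  \<comment> \<open>Cramer's rule for the two neighbour coordinates: the matrix with rows
    \<open>(1 + l2, - l1)\<close> and \<open>(- l2, 1 + l1)\<close> has determinant
    \<open>1 + l1 + l2 = s\<close>. The first coordinate is then right as well, because all
    coordinate sums are 1.\<close>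
  define v where "v i = (if i = 0 then ((1 + l1) * m1 + l1 * m2) / s else (l2 * m1 + (1 + l2) * m2) / s)" for i :: nat
  have v0: "s * v 0 = (1 + l1) * m1 + l1 * m2" and v1: "s * v 1 = l2 * m1 + (1 + l2) * m2"
    using s by (simp_all add: v_def)
  have "s * ((1 + l2) * v 0 - l1 * v 1) = (1 + l2) * (s * v 0) - l1 * (s * v 1)" by (simp add: algebra_simps)
  also have "\<dots> = s * m1" unfolding v0 v1 by (simp add: s_def algebra_simps)
  finally have e1: "(1 + l2) * v 0 - l1 * v 1 = m1" using s by simp
  have "s * ((1 + l1) * v 1 - l2 * v 0) = (1 + l1) * (s * v 1) - l2 * (s * v 0)" by (simp add: algebra_simps)
  also have "\<dots> = s * m2" unfolding v0 v1 by (simp add: s_def algebra_simps)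
  finally have e2: "(1 + l1) * v 1 - l2 * v 0 = m2" using s by simp
  have "s * (v 0 + v 1) = s * (m1 + m2)" unfolding distrib_left v0 v1 by (simp add: s_def algebra_simps)
  then have "v 0 + v 1 = m1 + m2" using s by simp
  then have "c - v 0 - v 1 = a" using c ab by (simp add: m1_def m2_def)
  moreover have "c * l1 + (1 + l2) * v 0 - l1 * v 1 = b" using e1 by (simp add: m1_def)
  moreover have "c * l2 - l2 * v 0 + (1 + l1) * v 1 = b" using e2 by (simp add: m2_def)
  ultimately show "\<exists>v. (\<lambda>i. ?u2 i + comb ?ws2 v i) = vec3 a b b"
    unfolding fam by (intro exI[of _ v]) simp
qed (simp add: field_simps)

lemma cform_scale: "cform k t p (\<lambda>i. c * u i) x w y = c * cform k t p u x w y"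
proof -
  have "cform k t p w y (\<lambda>i. \<Sum>a\<in>{0::nat}. c * u i) x = (\<Sum>a\<in>{0::nat}. c * cform k t p w y u x)"
    by (rule cform_sum_weights)
  then show ?thesis by (simp add: cform_commute[of k t p w y])
qed

text \<open>The information matrix is homogeneous of degree 2 in the weights of interest, since
  these occur in \<open>F\<close> and not in \<open>Gram\<close>. This turns the factor of the total
  effect into a rescaling of its weights.\<close>

lemma Info_scale: "c\<^sup>2 \<cdot>\<^sub>m Info k t S p u ws (vec t x) = Info k t S p (\<lambda>i. c * u i) ws (vec t x)"
proof -
  let ?F = "Fmat p u ws x" and ?X = "moore_penrose (Gram p ws x)"
  have F: "Fmat p (\<lambda>i. c * u i) ws x = c \<cdot>\<^sub>m ?F"
    by (rule eq_matI) (auto simp: Fmat_def cform_scale)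
  have C: "Cuw k t S p (\<lambda>i. c * u i) (\<lambda>i. c * u i) = c\<^sup>2 \<cdot>\<^sub>m Cuw k t S p u u"
  proof (rule eq_matI)
    fix a b assume "a < dim_row (c\<^sup>2 \<cdot>\<^sub>m Cuw k t S p u u)" "b < dim_col (c\<^sup>2 \<cdot>\<^sub>m Cuw k t S p u u)"
    then have ab: "a < t" "b < t" by (auto simp: Cuw_def)
    have "cform k t p (\<lambda>i. c * u i) (ind a) (\<lambda>i. c * u i) (ind b) = c * (c * cform k t p u (ind a) u (ind b))"
      unfolding cform_scale cform_commute[of k t p u "ind a"] ..
    then show "Cuw k t S p (\<lambda>i. c * u i) (\<lambda>i. c * u i) $$ (a,b) = (c\<^sup>2 \<cdot>\<^sub>m Cuw k t S p u u) $$ (a,b)"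
      using ab Cuw_carrier[of p u u] by (simp add: Cuw_entry[OF B] power2_eq_square)
  qed (auto simp: Cuw_def)
  have f: "?F \<in> carrier_mat (length ws) t" by (rule Fmat_carrier)
  note X = moore_penrose_Gram(1)[of p ws x]
  have TX: "transpose_mat ?F * ?X \<in> carrier_mat t (length ws)" using f X by (intro mult_carrier_mat) auto
  have "transpose_mat (c \<cdot>\<^sub>m ?F) * ?X * (c \<cdot>\<^sub>m ?F) = c\<^sup>2 \<cdot>\<^sub>m (transpose_mat ?F * ?X * ?F)"
  proof -
    have "transpose_mat (c \<cdot>\<^sub>m ?F) = c \<cdot>\<^sub>m transpose_mat ?F" by (rule eq_matI) auto
    then have "transpose_mat (c \<cdot>\<^sub>m ?F) * ?X = c \<cdot>\<^sub>m (transpose_mat ?F * ?X)"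
      using mult_smult_assoc_mat[of "transpose_mat ?F" t "length ws" ?X "length ws" c] f X by simp
    then have "transpose_mat (c \<cdot>\<^sub>m ?F) * ?X * (c \<cdot>\<^sub>m ?F) = c \<cdot>\<^sub>m (c \<cdot>\<^sub>m (transpose_mat ?F * ?X * ?F))"
      using mult_smult_assoc_mat[OF TX, of "c \<cdot>\<^sub>m ?F" t c] mult_smult_distrib[OF TX f, of c] f by simp
    also have "\<dots> = c\<^sup>2 \<cdot>\<^sub>m (transpose_mat ?F * ?X * ?F)"
      by (rule eq_matI) (auto simp: power2_eq_square)
    finally show ?thesis .
  qed
  then show ?thesis unfolding Info_eq C F
    using Cuw_carrier[of p u u] f by (intro eq_matI) (auto simp: algebra_simps)
qed

end

text \<open>The criteria index the sorted list from 1 to \<open>t - 1\<close>, skipping its first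
  entry 0; the shift by \<open>Suc\<close> restarts the count at 0.\<close>

lemma Phi_eq:
  shows "Phi_A t C = mean_A (t - 1) (\<lambda>i. eigs C ! Suc i)"
    and "Phi_D t C = mean_D (t - 1) (\<lambda>i. eigs C ! Suc i)"
    and "Phi_E t C = (\<lambda>d. d 0) (\<lambda>i. eigs C ! Suc i)"
    and "Phi_T t C = mean_T (t - 1) (\<lambda>i. eigs C ! Suc i)"
proof -
  have "(\<Sum>i\<in>{1..t-1}. h i) = (\<Sum>i<t-1. h (Suc i))" for h :: "nat \<Rightarrow> real"
    by (simp add: sum.atLeast1_atMost_eq)
  moreover have "(\<Prod>i\<in>{1..t-1}. h i) = (\<Prod>i<t-1. h (Suc i))" for h :: "nat \<Rightarrow> real"
    by (simp add: prod.atLeast1_atMost_eq)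
  ultimately show "Phi_A t C = mean_A (t - 1) (\<lambda>i. eigs C ! Suc i)"
    and "Phi_D t C = mean_D (t - 1) (\<lambda>i. eigs C ! Suc i)"
    and "Phi_T t C = mean_T (t - 1) (\<lambda>i. eigs C ! Suc i)"
    by (simp_all add: Phi_A_def Phi_D_def Phi_T_def mean_A_def mean_D_def mean_T_def Let_def)
qed (simp add: Phi_E_def)

theorem theorem5:
  fixes k t :: nat and S :: "real mat" and g :: "(nat \<Rightarrow> real) measure"
    and l l1 l2 :: real
  assumes "k \<ge> 2" and "t \<ge> 2"
    and "pos_def k S" and "typeH k S"
    and "exch_distribution t g"
  shows
    "(\<forall>p. p \<in> meas_set k t \<longrightarrow> pseudo_symmetric k t S p \<longrightarrow>
        (optimal k t g (Phi_E t) (C_undir_tau k t S l) p \<longleftrightarrow>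
         optimal k t g (Phi_E t) (C_dir_tau k t S l1 l2) p))
   \<and> (1 + 2 * l \<noteq> 0 \<longrightarrow> 1 + l1 + l2 \<noteq> 0 \<longrightarrow>
      (\<forall>p. p \<in> meas_set k t \<longrightarrow> pseudo_symmetric k t S p \<longrightarrow>
        (optimal k t g (Phi_E t) (C_undir_theta k t S l) p \<longleftrightarrow>
         optimal k t g (Phi_E t) (C_dir_theta k t S l1 l2) p)))
   \<and> (l1 = l \<longrightarrow> l2 = l \<longrightarrow>
      (\<forall>Phi \<in> {Phi_A t, Phi_D t, Phi_T t}.
        (\<forall>p. p \<in> meas_set k t \<longrightarrow> pseudo_symmetric k t S p \<longrightarrow>
          (optimal k t g Phi (C_undir_tau k t S l) p \<longleftrightarrow>
           optimal k t g Phi (C_dir_tau k t S l1 l2) p))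
      \<and> (1 + 2 * l \<noteq> 0 \<longrightarrow>
        (\<forall>p. p \<in> meas_set k t \<longrightarrow> pseudo_symmetric k t S p \<longrightarrow>
          (optimal k t g Phi (C_undir_theta k t S l) p \<longleftrightarrow>
           optimal k t g Phi (C_dir_theta k t S l1 l2) p)))))"
proof -
  have k0: "k > 0" and n: "t - 1 > 0" using assms(1,2) by auto
  have B: "Btilde k S = centering k" using Btilde_typeH[OF assms(3,4) k0] .
  interpret exchangeable_design k t S g
    using assms B by unfold_locales auto
  let ?n = "t - 1"
  have dep: "depends_on ?n (mean_A ?n)" "depends_on ?n (mean_D ?n)" "depends_on ?n (\<lambda>d. d 0)" "depends_on ?n (mean_T ?n)"
    using n by (auto simp: depends_on_def mean_A_def mean_D_def mean_T_def)
  note sup = supported_A[OF n] supported_D[OF n] supported_E[OF n] supported_T[OF n]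
  have criteria: "\<exists>f. (\<forall>C. Phi C = f (\<lambda>i. eigs C ! Suc i)) \<and> depends_on ?n f \<and> supported ?n f"
    if "Phi \<in> {Phi_A t, Phi_D t, Phi_T t}" for Phi
    using that Phi_eq[of t] dep sup by auto
  have theta: "(1 / c\<^sup>2) \<cdot>\<^sub>m Info k t S q u ws (vec t x) = Info k t S q (\<lambda>i. 1 / c * u i) ws (vec t x)" for c q u ws x
    using Info_scale[of "1 / c"] by (simp add: power_divide)
  have tau_models: "C_undir_tau k t S l q (vec t x) = Info k t S q (vec3 1 l l) [vec3 0 1 1] (vec t x)"
    "C_dir_tau k t S l1 l2 q (vec t x) = Info k t S q (vec3 1 l1 l2) [vec3 0 1 0, vec3 0 0 1] (vec t x)" for q x
    by (simp_all add: C_undir_tau_def C_dir_tau_def)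
  have theta_models: "C_undir_theta k t S l q (vec t x)
      = Info k t S q (\<lambda>i. 1 / (1 + 2 * l) * vec3 1 l l i) [vec3 2 (-1) (-1)] (vec t x)"
    "C_dir_theta k t S l1 l2 q (vec t x)
      = Info k t S q (\<lambda>i. 1 / (1 + l1 + l2) * vec3 1 l1 l2 i) [vec3 (-1) (1 + l2) (- l2), vec3 (-1) (- l1) (1 + l1)] (vec t x)" for q x
    unfolding C_undir_theta_def C_dir_theta_def by (rule theta)+
  \<comment> \<open>The smallest eigenvalue does not see \<open>\<alpha>\<close>, so the effect
    weights of the two models may differ for this criterion.\<close>
  have E: "\<forall>\<alpha> \<alpha>' \<beta>. (\<lambda>d. d 0) (pinched \<alpha> \<beta>) = (\<lambda>d. d 0) (pinched \<alpha>' \<beta>)" by (simp add: pinched_def)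
  show ?thesis
  proof (intro conjI impI allI ballI)
    fix p assume p: "p \<in> meas_set k t" "pseudo_symmetric k t S p"
    show "optimal k t g (Phi_E t) (C_undir_tau k t S l) p \<longleftrightarrow> optimal k t g (Phi_E t) (C_dir_tau k t S l1 l2) p"
      by (rule optimal_transfer[OF Phi_eq(3) dep(3) sup(3) tau_models qInfo_tau disjI2[OF E] p])
  next
    fix p assume l: "1 + 2 * l \<noteq> 0" "1 + l1 + l2 \<noteq> 0" and p: "p \<in> meas_set k t" "pseudo_symmetric k t S p"
    show "optimal k t g (Phi_E t) (C_undir_theta k t S l) p \<longleftrightarrow> optimal k t g (Phi_E t) (C_dir_theta k t S l1 l2) p"
      by (rule optimal_transfer[OF Phi_eq(3) dep(3) sup(3) theta_models qInfo_theta[OF _ l] disjI2[OF E] p])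
  next
    fix Phi p assume l: "l1 = l" "l2 = l" and Phi: "Phi \<in> {Phi_A t, Phi_D t, Phi_T t}"
      and p: "p \<in> meas_set k t" "pseudo_symmetric k t S p"
    obtain f where f: "\<And>C. Phi C = f (\<lambda>i. eigs C ! Suc i)" "depends_on ?n f" "supported ?n f"
      using criteria[OF Phi] by blast
    have u: "vec3 1 l l = vec3 1 l1 l2" using l by simp
    show "optimal k t g Phi (C_undir_tau k t S l) p \<longleftrightarrow> optimal k t g Phi (C_dir_tau k t S l1 l2) p"
      by (rule optimal_transfer[OF f tau_models qInfo_tau disjI1[OF u] p])
  next
    fix Phi p assume l: "l1 = l" "l2 = l" and Phi: "Phi \<in> {Phi_A t, Phi_D t, Phi_T t}" and l0: "1 + 2 * l \<noteq> 0"
      and p: "p \<in> meas_set k t" "pseudo_symmetric k t S p"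
    obtain f where f: "\<And>C. Phi C = f (\<lambda>i. eigs C ! Suc i)" "depends_on ?n f" "supported ?n f"
      using criteria[OF Phi] by blast
    have l0': "1 + l1 + l2 \<noteq> 0" using l l0 by simp
    have u: "(\<lambda>i. 1 / (1 + 2 * l) * vec3 1 l l i) = (\<lambda>i. 1 / (1 + l1 + l2) * vec3 1 l1 l2 i)"
    proof -
      have "1 + 2 * l = 1 + l1 + l2" using l by simp
      then show ?thesis using l by (simp only:)
    qed
    show "optimal k t g Phi (C_undir_theta k t S l) p \<longleftrightarrow> optimal k t g Phi (C_dir_theta k t S l1 l2) p"
      by (rule optimal_transfer[OF f theta_models qInfo_theta[OF _ l0 l0'] disjI1[OF u] p])
  qed
qed

end
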